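(* Let $(\mathfrak{M}, \tau)$ be a tracial von Neumann algebra with unit $I_{\mathfrak{M}}$, let $T, S \in \mathfrak{M}$, and let $C, C_1, C_2 \in \mathfrak{M}_{\mathrm{sa}}$. Then: (i) $V_C(T)$ is a convex set; (ii) $V_C(T^* )$ equals the complex conjugate of $V_C(T)$, i.e. $V_C(T^* )=\{\overline{z}\mid z\in V_C(T)\}$; (iii) $V_C(\mathrm{Re}(T)) = \{\mathrm{Re}(z)\mid z \in V_C(T)\}$ and $V_C(\mathrm{Im}(T)) = \{\mathrm{Im}(z)\mid z \in V_C(T)\}$; (iv) $V_C(T + S) \subseteq V_C(T) + V_C(S)$; (v) $V_C( z I_{\mathfrak{M}} + w T) = z\tau(C) + w V_C(T)$ for all $z,w \in \mathbb{C}$; (vi) $V_C(U^*TU) = V_C(T)$ for all unitaries $U \in \mathfrak{M}$; (vii) $V_{C_1}(T) \subseteq V_{C_2}(T)$ whenever $\lambda_{C_1} \prec \lambda_{C_2}$; (viii) $V_{aC+bI_{\mathfrak{M}}}(T) = aV_C(T) + b\tau(T)$ for all $a,b \in \mathbb{R}$.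
   Context: A tracial von Neumann algebra is a pair $(\mathfrak{M},\tau)$ with $\mathfrak{M}$ a von Neumann algebra and $\tau$ a normal, faithful, tracial state on $\mathfrak{M}$. $\mathfrak{M}_{\mathrm{sa}}$ is the set of self-adjoint elements of $\mathfrak{M}$. For a normal operator $N$ and a Borel set $B\subseteq\mathbb{C}$, $1_B(N)$ is the spectral projection of $N$ for $B$. For $T\in\mathfrak{M}_{\mathrm{sa}}$ the eigenvalue function of $T$ is $\lambda_T(s) = \inf\{t\in\mathbb{R} \mid \tau(1_{(t,\infty)}(T))\le s\}$ for $s\in[0,1)$. For real-valued $f,g\in L^\infty[0,1]$, write $g\prec f$ ($f$ majorizes $g$) if $\int_0^t g(x)\,dx\le\int_0^t f(x)\,dx$ for all $t\in[0,1]$ and $\int_0^1 g(x)\,dx=\int_0^1 f(x)\,dx$. For $C\in\mathfrak{M}_{\mathrm{sa}}$ and $T\in\mathfrak{M}$, the $C$-numerical range of $T$ is $V_C(T)=\{\tau(TX)\mid X\in\mathfrak{M}_{\mathrm{sa}},\ \lambda_X\prec\lambda_C\}$. $\mathrm{Re}(T)=\frac12(T+T^* )$ and $\mathrm{Im}(T)=\frac1{2i}(T-T^* )$. For $X,Y\subseteq\mathbb{C}$ and $\omega\in\mathbb{C}$: $\omega X=\{\omega z\mid z\in X\}$, $\omega+X=\{\omega+z\mid z\in X\}$, $X+Y=\{z+w\mid z\in X, w\in Y\}$. *)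

theory Defs
  imports "HOL-Analysis.Analysis" "HOL-Library.Set_Algebras"
begin

section \<open>Complex Hilbert spaces\<close>

class scaleC =
  fixes scaleC :: "complex \<Rightarrow> 'a \<Rightarrow> 'a" (infixr \<open>*\<^sub>C\<close> 75)

text \<open>
  A complex Hilbert space is a real Hilbert space (so that norm, topology and completeness are
  those of the library) with a compatible complex scalar multiplication and a complex inner product,
  linear in its first argument, whose real part is the real inner product.
\<close>

class complex_hilbert_space = scaleC + real_inner + complete_space +
  fixes cinner :: "'a \<Rightarrow> 'a \<Rightarrow> complex"
  assumes scaleC_add_right: "a *\<^sub>C (x + y) = a *\<^sub>C x + a *\<^sub>C y"
    and scaleC_add_left: "(a + b) *\<^sub>C x = a *\<^sub>C x + b *\<^sub>C x"
    and scaleC_scaleC: "a *\<^sub>C (b *\<^sub>C x) = (a * b) *\<^sub>C x"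
    and scaleR_scaleC: "r *\<^sub>R x = complex_of_real r *\<^sub>C x"
    and cinner_commute: "cinner x y = cnj (cinner y x)"
    and cinner_add_left: "cinner (x + y) z = cinner x z + cinner y z"
    and cinner_scaleC_left: "cinner (a *\<^sub>C x) y = a * cinner x y"
    and inner_eq_Re_cinner: "inner x y = Re (cinner x y)"

lemma norm_scaleC: "norm (a *\<^sub>C x) = cmod a * norm (x :: 'a::complex_hilbert_space)"
proof -
  have right: "cinner u (b *\<^sub>C v) = cnj b * cinner u v" for b and u v :: 'a
    by (metis cinner_commute cinner_scaleC_left complex_cnj_mult)
  have "cinner (a *\<^sub>C x) (a *\<^sub>C x) = complex_of_real ((cmod a)\<^sup>2) * cinner x x"
    by (simp add: cinner_scaleC_left right mult.assoc [symmetric] complex_norm_square del: of_real_power)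
  then have "(norm (a *\<^sub>C x))\<^sup>2 = (cmod a * norm x)\<^sup>2"
    by (simp add: power2_norm_eq_inner inner_eq_Re_cinner power_mult_distrib del: of_real_power)
  then show ?thesis
    by (metis mult_nonneg_nonneg norm_ge_zero power2_eq_imp_eq)
qed

instantiation blinfun :: (real_normed_vector, complex_hilbert_space) scaleC
begin

lift_definition scaleC_blinfun :: "complex \<Rightarrow> ('a \<Rightarrow>\<^sub>L 'b) \<Rightarrow> 'a \<Rightarrow>\<^sub>L 'b"
  is "\<lambda>c T x. c *\<^sub>C T x"
proof -
  fix c :: complex and T :: "'a \<Rightarrow> 'b"
  assume T: "bounded_linear T"
  have "bounded_linear (\<lambda>y::'b. c *\<^sub>C y)"
    by (rule bounded_linear_intro [where K = "cmod c"])
      (simp_all add: scaleC_add_right scaleR_scaleC scaleC_scaleC norm_scaleC mult.commute)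
  from bounded_linear_compose [OF this T] show "bounded_linear (\<lambda>x. c *\<^sub>C T x)" .
qed

instance ..

end


section \<open>Bounded operators\<close>

text \<open>The elements of type \<open>'h \<Rightarrow>\<^sub>L 'h\<close> are only real-linear; \<open>bounded_ops\<close> is $B(H)$.\<close>

definition bounded_ops :: "('h::complex_hilbert_space \<Rightarrow>\<^sub>L 'h) set" where
  "bounded_ops = {T :: 'h \<Rightarrow>\<^sub>L 'h. \<forall>c x. T (c *\<^sub>C x) = c *\<^sub>C T x}"

definition cadjoint :: "('h::complex_hilbert_space \<Rightarrow>\<^sub>L 'h) \<Rightarrow> 'h \<Rightarrow>\<^sub>L 'h" where
  "cadjoint T = (THE S :: 'h \<Rightarrow>\<^sub>L 'h. \<forall>x y. cinner (T x) y = cinner x (S y))"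

definition positive_op :: "('h::complex_hilbert_space \<Rightarrow>\<^sub>L 'h) \<Rightarrow> bool" where
  "positive_op A \<longleftrightarrow> (\<forall>x. cinner (A x) x \<in> \<real>\<^sub>\<ge>\<^sub>0)"

definition op_le :: "('h::complex_hilbert_space \<Rightarrow>\<^sub>L 'h) \<Rightarrow> ('h \<Rightarrow>\<^sub>L 'h) \<Rightarrow> bool" where
  "op_le A B \<longleftrightarrow> positive_op (B - A)"

definition Re_op :: "('h::complex_hilbert_space \<Rightarrow>\<^sub>L 'h) \<Rightarrow> 'h \<Rightarrow>\<^sub>L 'h" where
  "Re_op T = (1 / 2) *\<^sub>C (T + cadjoint T)"

definition Im_op :: "('h::complex_hilbert_space \<Rightarrow>\<^sub>L 'h) \<Rightarrow> 'h \<Rightarrow>\<^sub>L 'h" where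
  "Im_op T = (1 / (2 * \<i>)) *\<^sub>C (T - cadjoint T)"


section \<open>Spectral projections\<close>

definition projection_valued_measure ::
    "(complex set \<Rightarrow> ('h::complex_hilbert_space \<Rightarrow>\<^sub>L 'h)) \<Rightarrow> bool" where
  "projection_valued_measure E \<longleftrightarrow>
     (\<forall>B\<in>sets borel. E B \<in> bounded_ops \<and> E B o\<^sub>L E B = E B \<and> cadjoint (E B) = E B) \<and>
     E UNIV = id_blinfun \<and>
     (\<forall>A\<in>sets borel. \<forall>B\<in>sets borel. E (A \<inter> B) = E A o\<^sub>L E B) \<and>
     (\<forall>A :: nat \<Rightarrow> complex set. range A \<subseteq> sets borel \<longrightarrow> disjoint_family A \<longrightarrow>
        (\<forall>x. (\<lambda>n. E (A n) x) sums E (\<Union>n. A n) x))"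

text \<open>The scalar measure $E_{x,x}(B) = \langle E(B)x, x\rangle$.\<close>

definition pvm_scalar_measure ::
    "(complex set \<Rightarrow> ('h::complex_hilbert_space \<Rightarrow>\<^sub>L 'h)) \<Rightarrow> 'h \<Rightarrow> complex measure" where
  "pvm_scalar_measure E x = measure_of UNIV (sets borel) (\<lambda>B. ennreal (Re (cinner (E B x) x)))"

text \<open>
  $E$ is the spectral measure of the normal operator $N$: it is concentrated on a bounded set, and
  $N = \int z\,dE(z)$ weakly, i.e.\ $\langle Nx, x\rangle = \int z\,dE_{x,x}(z)$ for all $x$. By
  polarization the diagonal values $\langle Nx, x\rangle$ determine $N$.
\<close>

definition is_spectral_measure ::
    "('h::complex_hilbert_space \<Rightarrow>\<^sub>L 'h) \<Rightarrow> (complex set \<Rightarrow> ('h \<Rightarrow>\<^sub>L 'h)) \<Rightarrow> bool" where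
  "is_spectral_measure N E \<longleftrightarrow>
     projection_valued_measure E \<and>
     (\<exists>r. E (cball 0 r) = id_blinfun) \<and>
     (\<forall>x. cinner (N x) x = integral\<^sup>L (pvm_scalar_measure E x) (\<lambda>z. z))"

text \<open>
  $1_B(N)$. The spectral measure itself is unique only on Borel sets, hence the definite description
  is applied to its value at $B$. It is meaningful for normal \<open>N \<in> bounded_ops\<close> and Borel \<open>B\<close>.
\<close>

definition spectral_projection ::
    "('h::complex_hilbert_space \<Rightarrow>\<^sub>L 'h) \<Rightarrow> complex set \<Rightarrow> 'h \<Rightarrow>\<^sub>L 'h" where
  "spectral_projection N B = (THE P. \<exists>E. is_spectral_measure N E \<and> P = E B)"


section \<open>Tracial von Neumann algebras\<close>

definition commutant ::
    "('h::complex_hilbert_space \<Rightarrow>\<^sub>L 'h) set \<Rightarrow> ('h \<Rightarrow>\<^sub>L 'h) set" where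
  "commutant M = {S \<in> bounded_ops. \<forall>T\<in>M. S o\<^sub>L T = T o\<^sub>L S}"

text \<open>
  A von Neumann algebra is a $*$-closed subset of $B(H)$ that equals its bicommutant; being a
  commutant, it is then a unital subalgebra.
\<close>

locale von_neumann_algebra =
  fixes M :: "('h::complex_hilbert_space \<Rightarrow>\<^sub>L 'h) set"
  assumes subset_bounded_ops: "M \<subseteq> bounded_ops"
    and cadjoint_closed: "T \<in> M \<Longrightarrow> cadjoint T \<in> M"
    and bicommutant: "commutant (commutant M) = M"

definition selfadjoints ::
    "('h::complex_hilbert_space \<Rightarrow>\<^sub>L 'h) set \<Rightarrow> ('h \<Rightarrow>\<^sub>L 'h) set" where
  "selfadjoints M = {X \<in> M. cadjoint X = X}"

definition unitaries ::
    "('h::complex_hilbert_space \<Rightarrow>\<^sub>L 'h) set \<Rightarrow> ('h \<Rightarrow>\<^sub>L 'h) set" where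
  "unitaries M = {U \<in> M. cadjoint U o\<^sub>L U = id_blinfun \<and> U o\<^sub>L cadjoint U = id_blinfun}"

definition is_op_lub ::
    "('h::complex_hilbert_space \<Rightarrow>\<^sub>L 'h) set \<Rightarrow> ('h \<Rightarrow>\<^sub>L 'h) set \<Rightarrow> ('h \<Rightarrow>\<^sub>L 'h) \<Rightarrow> bool" where
  "is_op_lub M D S \<longleftrightarrow>
     S \<in> selfadjoints M \<and> (\<forall>A\<in>D. op_le A S) \<and>
     (\<forall>R\<in>selfadjoints M. (\<forall>A\<in>D. op_le A R) \<longrightarrow> op_le S R)"

text \<open>
  \<open>\<tau>\<close> is constrained on \<open>M\<close> only. Normality is preservation of suprema of bounded increasing nets
  of positive elements, expressed through upward directed sets.
\<close>

locale tracial_von_neumann_algebra = von_neumann_algebra M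
  for M :: "('h::complex_hilbert_space \<Rightarrow>\<^sub>L 'h) set" +
  fixes \<tau> :: "('h \<Rightarrow>\<^sub>L 'h) \<Rightarrow> complex"
  assumes trace_add: "\<lbrakk>A \<in> M; B \<in> M\<rbrakk> \<Longrightarrow> \<tau> (A + B) = \<tau> A + \<tau> B"
    and trace_scaleC: "A \<in> M \<Longrightarrow> \<tau> (c *\<^sub>C A) = c * \<tau> A"
    and trace_positive: "A \<in> M \<Longrightarrow> \<tau> (cadjoint A o\<^sub>L A) \<in> \<real>\<^sub>\<ge>\<^sub>0"
    and trace_unit: "\<tau> id_blinfun = 1"
    and trace_faithful: "\<lbrakk>A \<in> M; \<tau> (cadjoint A o\<^sub>L A) = 0\<rbrakk> \<Longrightarrow> A = 0"
    and trace_tracial: "\<lbrakk>A \<in> M; B \<in> M\<rbrakk> \<Longrightarrow> \<tau> (A o\<^sub>L B) = \<tau> (B o\<^sub>L A)"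
    and trace_normal:
      "\<lbrakk>D \<subseteq> M; D \<noteq> {}; \<forall>A\<in>D. positive_op A;
        \<forall>A\<in>D. \<forall>B\<in>D. \<exists>C\<in>D. op_le A C \<and> op_le B C; is_op_lub M D S\<rbrakk>
        \<Longrightarrow> Re (\<tau> S) = (SUP A\<in>D. Re (\<tau> A))"


section \<open>Eigenvalue functions, majorization and numerical ranges\<close>

text \<open>
  Only the values at $s \in [0,1)$ are meaningful: for $s \ge 1$ the infimum is taken over an
  unbounded set. In the integrals below this affects the single point $s = 1$. For a self-adjoint
  element of \<open>M\<close> the function is monotone and bounded on $[0,1)$, so these integrals exist.
\<close>

definition eigenvalue_function ::
    "(('h::complex_hilbert_space \<Rightarrow>\<^sub>L 'h) \<Rightarrow> complex) \<Rightarrow> ('h \<Rightarrow>\<^sub>L 'h) \<Rightarrow> real \<Rightarrow> real" where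
  "eigenvalue_function \<tau> T s =
     Inf {t. Re (\<tau> (spectral_projection T (complex_of_real ` {t<..}))) \<le> s}"

definition majorized_by :: "(real \<Rightarrow> real) \<Rightarrow> (real \<Rightarrow> real) \<Rightarrow> bool" (infix \<open>majorized'_by\<close> 50) where
  "g majorized_by f \<longleftrightarrow>
     (\<forall>t\<in>{0..1}. (LBINT x:{0..t}. g x) \<le> (LBINT x:{0..t}. f x)) \<and>
     (LBINT x:{0..1}. g x) = (LBINT x:{0..1}. f x)"

definition C_numerical_range ::
    "('h::complex_hilbert_space \<Rightarrow>\<^sub>L 'h) set \<Rightarrow> (('h \<Rightarrow>\<^sub>L 'h) \<Rightarrow> complex) \<Rightarrow>
     ('h \<Rightarrow>\<^sub>L 'h) \<Rightarrow> ('h \<Rightarrow>\<^sub>L 'h) \<Rightarrow> complex set" where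
  "C_numerical_range M \<tau> C T =
     {\<tau> (T o\<^sub>L X) | X. X \<in> selfadjoints M \<and>
        eigenvalue_function \<tau> X majorized_by eigenvalue_function \<tau> C}"

end

theory Submission
  imports Defs
begin

text \<open>
All eight claims are statements about the set of self-adjoint elements \<open>X\<close> of \<open>M\<close> with
$\lambda_X \prec \lambda_C$, and they are easy once majorization is expressed without eigenvalue
functions. The key fact, \<open>majorized_by_iff\<close>, is that $\lambda_X \prec \lambda_C$ holds iff
$\tau(X) = \tau(C)$ and for every real \<open>c\<close> and every $A \in M$ with $0 \le A \le 1$ there is such a \<open>B\<close> with
$\mathrm{Re}\,\tau((X - c)A) \le \mathrm{Re}\,\tau((C - c)B)$. Here \<open>X\<close> occurs in linear functionals only. So
the condition visibly passes to convex combinations, is carried along by affine maps $X \mapsto aX + b$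
(for $a < 0$ replace \<open>A\<close> by $1 - A$), and is invariant under unitary conjugation (conjugate \<open>A\<close> instead).
Faithfulness of the trace enters at one point: the only element majorized by a scalar is that scalar.
The claims about $T^*$, the real and the imaginary part also use $\tau(A^*) = \overline{\tau(A)}$.

To prove the key fact, put $F(c) = \tau(1_{(c,\infty)}(X))$ and $G(c) = \tau((X - c)_+)$. Positivity of the
trace on products of positive elements shows that $G(c)$ is the maximum of $\mathrm{Re}\,\tau((X - c)A)$ over
$0 \le A \le 1$, attained at $A = 1_{(c,\infty)}(X)$ (\<open>trace_positive_part_max\<close>). Inserting the maximizer for
another \<open>d\<close> gives $G(c) - G(d) \ge (d - c) F(d)$, so $-F$ is a subgradient of the convex function \<open>G\<close>. As
$\lambda_X$ is the quantile function of \<open>F\<close>, it follows that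
$\int_0^t \lambda_X = \min_c\,(G(c) + ct)$ (\<open>legendre_transform_quantile\<close>). Legendre duality then turns the
comparison of the integrals into the comparison of the functions \<open>G\<close>.

What remains is the spectral theorem, since $1_{(c,\infty)}(X)$ is defined through a spectral measure,
whose existence and uniqueness on rays must be known. Square roots come from a dominated
iteration, and projections onto kernels from strong limits of powers. Together they give
the spectral projection $E_t$ for $(-\infty, t]$ as the projection onto the kernel of $(T - t)_+$. For each
vector \<open>x\<close> the increasing function $t \mapsto \langle E_t x, x\rangle$ defines a Stieltjes measure $\mu_x$, and a
Dynkin argument yields for every Borel set a projection with quadratic form $\mu_x(B)$
(\<open>represents_exists\<close>). Conversely, any spectral measure of \<open>T\<close> cuts \<open>T\<close> at every \<open>t\<close> into a part above and a
part below \<open>t\<close>, and such a cut is unique (\<open>spectral_family_unique\<close>, \<open>pvm_ray\<close>). Everything is built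
inside double commutants, which keeps it in the von Neumann algebra.
\<close>

section \<open>Self-adjoint operators and functions of an operator\<close>

instance complex_hilbert_space \<subseteq> banach ..

text \<open>
The spectral theory below uses the real inner product $\mathrm{Re}\,\langle x, y\rangle$ only. For a
complex-linear operator, symmetry with respect to it is self-adjointness in the complex sense; see
\<open>cadjoint_eq_self_iff\<close>.
\<close>

definition selfadj :: "('a::real_inner \<Rightarrow>\<^sub>L 'a) \<Rightarrow> bool" where
  "selfadj T \<longleftrightarrow> (\<forall>x y. inner (T x) y = inner x (T y))"

definition projection :: "('a::real_inner \<Rightarrow>\<^sub>L 'a) \<Rightarrow> bool" where
  "projection Q \<longleftrightarrow> selfadj Q \<and> Q o\<^sub>L Q = Q"

text \<open>
Being in the double commutant of \<open>T\<close> stands for being a function of \<open>T\<close>. The commuting operators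
\<open>S\<close> range over all bounded real-linear operators, in particular over the complex scalars, so that
for a complex-linear \<open>T\<close> the elements of this set are again complex-linear, and they lie in every
von Neumann algebra that contains \<open>T\<close>.
\<close>

definition double_commutant :: "('a::real_normed_vector \<Rightarrow>\<^sub>L 'a) \<Rightarrow> ('a \<Rightarrow>\<^sub>L 'a) set" where
  "double_commutant T = {Z. \<forall>S. S o\<^sub>L T = T o\<^sub>L S \<longrightarrow> S o\<^sub>L Z = Z o\<^sub>L S}"

lemma blinfun_eq_iff: "S = T \<longleftrightarrow> (\<forall>x. blinfun_apply S x = blinfun_apply T x)"
  by (metis blinfun_eqI)

lemma selfadjD: "selfadj T \<Longrightarrow> inner (T x) y = inner x (T y)"
  by (simp add: selfadj_def)

lemma double_commutant_self: "T \<in> double_commutant T"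
  by (simp add: double_commutant_def)

lemma double_commutant_zero: "0 \<in> double_commutant T"
  by (simp add: double_commutant_def blinfun_eqI)

lemma double_commutant_id: "id_blinfun \<in> double_commutant T"
  by (simp add: double_commutant_def blinfun_eqI)

lemma double_commutantD: "Z \<in> double_commutant T \<Longrightarrow> S o\<^sub>L T = T o\<^sub>L S \<Longrightarrow> S o\<^sub>L Z = Z o\<^sub>L S"
  by (simp add: double_commutant_def)

lemma double_commutant_trans: "Z \<in> double_commutant Y \<Longrightarrow> Y \<in> double_commutant T \<Longrightarrow> Z \<in> double_commutant T"
  by (simp add: double_commutant_def)

lemma double_commutant_add: "Y \<in> double_commutant T \<Longrightarrow> Z \<in> double_commutant T \<Longrightarrow> Y + Z \<in> double_commutant T"
  by (simp add: double_commutant_def bounded_bilinear.add_left [OF bounded_bilinear_blinfun_compose]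
      bounded_bilinear.add_right [OF bounded_bilinear_blinfun_compose])

lemma double_commutant_diff: "Y \<in> double_commutant T \<Longrightarrow> Z \<in> double_commutant T \<Longrightarrow> Y - Z \<in> double_commutant T"
  by (simp add: double_commutant_def bounded_bilinear.diff_left [OF bounded_bilinear_blinfun_compose]
      bounded_bilinear.diff_right [OF bounded_bilinear_blinfun_compose])

lemma double_commutant_scaleR: "Y \<in> double_commutant T \<Longrightarrow> r *\<^sub>R Y \<in> double_commutant T"
  by (simp add: double_commutant_def bounded_bilinear.scaleR_left [OF bounded_bilinear_blinfun_compose]
      bounded_bilinear.scaleR_right [OF bounded_bilinear_blinfun_compose])

lemma double_commutant_compose: "Y \<in> double_commutant T \<Longrightarrow> Z \<in> double_commutant T \<Longrightarrow> Y o\<^sub>L Z \<in> double_commutant T"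
  unfolding double_commutant_def mem_Collect_eq blinfun_eq_iff blinfun_apply_blinfun_compose by metis

lemma double_commutant_strong_limit:
  assumes "\<And>n. S n \<in> double_commutant T" and lim: "\<And>x. (\<lambda>n. blinfun_apply (S n) x) \<longlonglongrightarrow> blinfun_apply L x"
  shows "L \<in> double_commutant T"
  unfolding double_commutant_def
proof safe
  fix R assume R: "R o\<^sub>L T = T o\<^sub>L R"
  have eq: "R (S n x) = S n (R x)" for n x
    using double_commutantD [OF assms(1) R, of n] by (metis blinfun_apply_blinfun_compose)
  have "R (L x) = L (R x)" for x
  proof (rule LIMSEQ_unique)
    show "(\<lambda>n. R (S n x)) \<longlonglongrightarrow> R (L x)"
      by (intro tendsto_intros lim)
    show "(\<lambda>n. R (S n x)) \<longlonglongrightarrow> L (R x)"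
      unfolding eq by (rule lim)
  qed
  then show "R o\<^sub>L L = L o\<^sub>L R" by (simp add: blinfun_eqI)
qed

lemma selfadj_strong_limit:
  assumes "\<And>n. selfadj (S n)" and lim: "\<And>x. (\<lambda>n. blinfun_apply (S n) x) \<longlonglongrightarrow> blinfun_apply L x"
  shows "selfadj L"
  unfolding selfadj_def
proof safe
  fix x y
  show "inner (L x) y = inner x (L y)"
  proof (rule LIMSEQ_unique)
    show "(\<lambda>n. inner (S n x) y) \<longlonglongrightarrow> inner (L x) y" by (intro tendsto_intros lim)
    show "(\<lambda>n. inner (S n x) y) \<longlonglongrightarrow> inner x (L y)"
      unfolding selfadjD [OF assms(1)] by (intro tendsto_intros lim)
  qed
qed

lemma strong_limit:
  fixes S :: "nat \<Rightarrow> 'a::real_normed_vector \<Rightarrow>\<^sub>L 'b::real_normed_vector"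
  assumes conv: "\<And>x. convergent (\<lambda>n. S n x)" and bound: "\<And>n x. norm (S n x) \<le> K * norm x"
  obtains L :: "'a \<Rightarrow>\<^sub>L 'b" where "\<And>x. (\<lambda>n. S n x) \<longlonglongrightarrow> blinfun_apply L x"
proof -
  define f where "f x = lim (\<lambda>n. S n x)" for x
  have lim: "(\<lambda>n. S n x) \<longlonglongrightarrow> f x" for x
    using conv unfolding f_def by (simp add: convergent_LIMSEQ_iff)
  have "bounded_linear f"
  proof (rule bounded_linear_intro)
    fix x y
    have "(\<lambda>n. S n x + S n y) \<longlonglongrightarrow> f x + f y" by (intro tendsto_intros lim)
    then show "f (x + y) = f x + f y"
      using lim [of "x + y"] by (auto simp: blinfun.add_right intro: LIMSEQ_unique)
  next
    fix r x
    have "(\<lambda>n. r *\<^sub>R S n x) \<longlonglongrightarrow> r *\<^sub>R f x" by (intro tendsto_intros lim)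
    then show "f (r *\<^sub>R x) = r *\<^sub>R f x"
      using lim [of "r *\<^sub>R x"] by (auto simp: blinfun.scaleR_right intro: LIMSEQ_unique)
  next
    fix x
    show "norm (f x) \<le> norm x * K"
      using bound [of _ x] by (intro Lim_bounded [OF tendsto_norm [OF lim]]) (auto simp: mult.commute)
  qed
  then show ?thesis
    using lim that [of "Blinfun f"] by (simp add: bounded_linear_Blinfun_apply)
qed

text \<open>
Both bounds come from expanding $\langle B(x - Bx), x - Bx\rangle \ge 0$ and using
$\langle B(Bx), Bx\rangle \le \langle Bx, Bx\rangle$.
\<close>

lemma norm_le_if_between_0_1:
  assumes "selfadj B" "\<And>x. 0 \<le> inner (B x) x" "\<And>x. inner (B x) x \<le> inner x x"
  shows "inner (B x) (B x) \<le> inner (B x) x" and "norm (B x) \<le> norm x"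
proof -
  have "0 \<le> inner (B (x - B x)) (x - B x)" by (rule assms)
  also have "\<dots> = inner (B x) x - 2 * inner (B x) (B x) + inner (B (B x)) (B x)"
    using selfadjD [OF assms(1), of "B x" x] selfadjD [OF assms(1), of x "B x"]
    by (simp add: blinfun.diff_right inner_diff_left inner_diff_right inner_commute)
  finally show le: "inner (B x) (B x) \<le> inner (B x) x"
    using assms(3) [of "B x"] by linarith
  then show "norm (B x) \<le> norm x"
    using assms(3) [of x] by (simp add: norm_le)
qed

lemma norm_blinfun_le_1: "(\<And>x. norm (blinfun_apply B x) \<le> norm x) \<Longrightarrow> norm B \<le> 1"
  by (rule norm_blinfun_bound) auto

lemma selfadj_id: "selfadj id_blinfun"
  by (simp add: selfadj_def)

lemma selfadj_add: "selfadj S \<Longrightarrow> selfadj T \<Longrightarrow> selfadj (S + T)"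
  by (simp add: selfadj_def blinfun.add_left inner_add_left inner_add_right)

lemma selfadj_diff: "selfadj S \<Longrightarrow> selfadj T \<Longrightarrow> selfadj (S - T)"
  by (simp add: selfadj_def blinfun.diff_left inner_diff_left inner_diff_right)

lemma selfadj_scaleR: "selfadj S \<Longrightarrow> selfadj (r *\<^sub>R S)"
  by (simp add: selfadj_def blinfun.scaleR_left)

lemma selfadj_square: "selfadj S \<Longrightarrow> selfadj (S o\<^sub>L S)"
  by (simp add: selfadj_def)

lemmas selfadj_intros = selfadj_id selfadj_add selfadj_diff selfadj_scaleR selfadj_square

lemmas double_commutant_intros = double_commutant_self double_commutant_id double_commutant_add
  double_commutant_diff double_commutant_scaleR double_commutant_compose

section \<open>Square roots and kernel projections\<close>

text \<open>
With \<open>B = 1 - A\<close>, a solution of $L = \frac12 (B + L^2)$ gives $(1 - L)^2 = A$. The iteration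
$Y_{n+1} = \frac12 (B + Y_n^2)$ from $Y_0 = 0$ converges in norm because it is dominated by the same
iteration for the number $1$: if $y_{n+1} = \frac12 (1 + y_n^2)$ and $y_0 = 0$, then
$\|Y_n\| \le y_n$ and $\|Y_{n+1} - Y_n\| \le y_{n+1} - y_n$, and $y_n$ increases within $[0,1]$.
\<close>

lemma square_root_exists:
  fixes A :: "'a::{real_inner,banach} \<Rightarrow>\<^sub>L 'a"
  assumes A: "selfadj A" "\<And>x. 0 \<le> inner (A x) x" "\<And>x. inner (A x) x \<le> inner x x"
  obtains R where "selfadj R" "\<And>x. 0 \<le> inner (R x) x" "R o\<^sub>L R = A" "R \<in> double_commutant A"
proof -
  define B where "B = id_blinfun - A"
  define Y where "Y = rec_nat (0 :: 'a \<Rightarrow>\<^sub>L 'a) (\<lambda>_ Z. (1/2) *\<^sub>R (B + (Z o\<^sub>L Z)))"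
  define y where "y = rec_nat (0 :: real) (\<lambda>_ z. (1 + z * z) / 2)"
  have Y0: "Y 0 = 0" and YS: "Y (Suc n) = (1/2) *\<^sub>R (B + (Y n o\<^sub>L Y n))" for n
    by (simp_all add: Y_def)
  have y0: "y 0 = 0" and yS: "y (Suc n) = (1 + y n * y n) / 2" for n
    by (simp_all add: y_def)
  have B: "norm B \<le> 1"
    by (intro norm_blinfun_le_1 norm_le_if_between_0_1(2))
      (use A in \<open>auto simp: B_def blinfun.diff_left inner_diff_left intro!: selfadj_intros\<close>)
  have y01: "0 \<le> y n \<and> y n \<le> 1" for n
  proof (induction n)
    case (Suc n)
    then have "y n * y n \<le> 1" by (simp add: mult_le_one)
    with Suc show ?case by (simp add: yS)
  qed (simp add: y0)
  have Yy: "norm (Y n) \<le> y n" for n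
  proof (induction n)
    case (Suc n)
    have "norm (B + (Y n o\<^sub>L Y n)) \<le> 1 + y n * y n"
      by (intro norm_triangle_le add_mono B order_trans [OF norm_blinfun_compose] mult_mono Suc y01
          norm_ge_zero) (use y01 in auto)
    then show ?case by (simp add: YS yS)
  qed (simp add: Y0 y0)
  have step: "norm (Y (Suc n) - Y n) \<le> y (Suc n) - y n" for n
  proof (induction n)
    case (Suc n)
    let ?D = "Y (Suc n) - Y n"
    have "Y (Suc (Suc n)) - Y (Suc n) = (1/2) *\<^sub>R ((?D o\<^sub>L Y (Suc n)) + (Y n o\<^sub>L ?D))"
      unfolding YS [of "Suc n"] YS [of n]
      by (rule blinfun_eqI)
        (simp add: blinfun.add_left blinfun.diff_left blinfun.scaleR_left blinfun.add_right
          blinfun.diff_right blinfun.scaleR_right algebra_simps flip: YS)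
    then have "norm (Y (Suc (Suc n)) - Y (Suc n)) = norm ((?D o\<^sub>L Y (Suc n)) + (Y n o\<^sub>L ?D)) / 2"
      by simp
    also have "norm ((?D o\<^sub>L Y (Suc n)) + (Y n o\<^sub>L ?D)) \<le>
        (y (Suc n) - y n) * y (Suc n) + y n * (y (Suc n) - y n)"
      by (intro norm_triangle_le add_mono order_trans [OF norm_blinfun_compose] mult_mono Suc Yy
          norm_ge_zero) (use y01 order_trans [OF norm_ge_zero Suc] in auto)
    also have "\<dots> = y (Suc n) * y (Suc n) - y n * y n" by (simp add: algebra_simps)
    finally show ?case by (simp add: yS [of "Suc n"] yS [of n] diff_divide_distrib add_divide_distrib)
  qed (use Yy [of "Suc 0"] in \<open>simp add: Y0 y0\<close>)
  have "incseq y"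
    by (rule incseq_SucI) (use order_trans [OF norm_ge_zero step] in simp)
  then have "convergent y"
    by (intro Bseq_monoseq_convergent incseq_imp_monoseq BseqI' [where K = 1]) (use y01 in auto)
  then have "summable (\<lambda>n. y (Suc n) - y n)"
    by (auto intro: telescope_summable simp: convergent_def)
  then have "summable (\<lambda>n. Y (Suc n) - Y n)"
    by (rule summable_comparison_test' [where N = 0]) (use step in auto)
  moreover have "(\<Sum>k<n. Y (Suc k) - Y k) = Y n" for n
    by (simp add: sum_lessThan_telescope Y0)
  ultimately have "convergent Y"
    by (simp add: summable_iff_convergent)
  then obtain L where L: "Y \<longlonglongrightarrow> L" by (auto simp: convergent_def)
  have "norm L \<le> 1"
    by (rule Lim_bounded [OF tendsto_norm [OF L], of 0]) (use Yy y01 order_trans in blast)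
  have "(\<lambda>n. Y (Suc n)) \<longlonglongrightarrow> (1/2) *\<^sub>R (B + (L o\<^sub>L L))"
    unfolding YS
    by (intro tendsto_intros L bounded_bilinear.tendsto [OF bounded_bilinear_blinfun_compose])
  then have fixpoint: "L = (1/2) *\<^sub>R (B + (L o\<^sub>L L))"
    using L LIMSEQ_Suc LIMSEQ_unique by blast
  have Lx: "(\<lambda>n. Y n x) \<longlonglongrightarrow> L x" for x
    by (intro tendsto_intros L)
  have saY: "selfadj (Y n)" for n
    by (induction n) (auto simp: Y0 YS B_def selfadj_def [of 0] intro!: selfadj_intros A)
  have dcY: "Y n \<in> double_commutant A" for n
    by (induction n) (auto simp: Y0 YS B_def double_commutant_zero intro!: double_commutant_add double_commutant_diff double_commutant_scaleR double_commutant_compose double_commutant_self double_commutant_id)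
  show ?thesis
  proof (rule that [of "id_blinfun - L"])
    show "selfadj (id_blinfun - L)"
      by (intro selfadj_intros selfadj_strong_limit [OF saY Lx])
    show "id_blinfun - L \<in> double_commutant A"
      by (intro double_commutant_intros double_commutant_strong_limit [OF dcY Lx])
    show "0 \<le> inner ((id_blinfun - L) x) x" for x
    proof -
      have "inner (L x) x \<le> norm (L x) * norm x" by (rule norm_cauchy_schwarz)
      also have "norm (L x) \<le> 1 * norm x"
        by (rule order_trans [OF norm_blinfun]) (intro mult_right_mono \<open>norm L \<le> 1\<close> norm_ge_zero)
      finally show ?thesis
        by (simp add: blinfun.diff_left inner_diff_left power2_norm_eq_inner [symmetric]
            power2_eq_square mult_right_mono)
    qed
    have "L x = (1/2) *\<^sub>R (B x + L (L x))" for x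
      using fixpoint by (metis blinfun.add_left blinfun.scaleR_left blinfun_apply_blinfun_compose)
    then have "2 *\<^sub>R L x = 2 *\<^sub>R (1/2) *\<^sub>R (B x + L (L x))" for x
      by presburger
    then have "2 *\<^sub>R L x = B x + L (L x)" for x
      by simp
    then have "A x = x - 2 *\<^sub>R L x + L (L x)" for x
      by (simp add: B_def blinfun.diff_left)
    then show "(id_blinfun - L) o\<^sub>L (id_blinfun - L) = A"
      by (intro blinfun_eqI) (simp add: blinfun.diff_left blinfun.diff_right scaleR_2)
  qed
qed

text \<open>
The form in which completeness is used: in a Hilbert space squared distances are what one can
compute.
\<close>

lemma convergent_if_dist_square_small:
  fixes z :: "nat \<Rightarrow> 'a::banach"
  assumes small: "\<And>e. 0 < e \<Longrightarrow> \<exists>N. \<forall>m\<ge>N. \<forall>n\<ge>m. (norm (z n - z m))\<^sup>2 < e"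
  shows "convergent z"
proof -
  have "Cauchy z"
  proof (rule CauchyI)
    fix e :: real assume "0 < e"
    then obtain N where N: "\<And>m n. m \<ge> N \<Longrightarrow> n \<ge> m \<Longrightarrow> (norm (z n - z m))\<^sup>2 < e\<^sup>2"
      using small [of "e\<^sup>2"] by auto
    have *: "norm (z n - z m) < e" if "m \<le> n" "m \<ge> N" for m n
      using N [OF that(2,1)] \<open>0 < e\<close> by (auto intro: power2_less_imp_less)
    have "norm (z m - z n) < e" if "m \<ge> N" "n \<ge> N" for m n
      using * [of m n] * [of n m] that by (cases "m \<le> n") (auto simp: norm_minus_commute)
    then show "\<exists>N. \<forall>m\<ge>N. \<forall>n\<ge>N. norm (z m - z n) < e" by blast
  qed
  then show ?thesis by (simp add: Cauchy_convergent_iff)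
qed

lemma convergent_if_dist_square_le:
  fixes z :: "nat \<Rightarrow> 'a::banach" and f :: "nat \<Rightarrow> real"
  assumes "convergent f" and le: "\<And>m n. m \<le> n \<Longrightarrow> (norm (z n - z m))\<^sup>2 \<le> \<bar>f n - f m\<bar>"
  shows "convergent z"
proof (rule convergent_if_dist_square_small)
  fix e :: real assume "0 < e"
  then obtain N where N: "\<And>m n. m \<ge> N \<Longrightarrow> n \<ge> N \<Longrightarrow> norm (f n - f m) < e"
    using convergent_Cauchy [OF assms(1)] CauchyD [of f e] by metis
  have "(norm (z n - z m))\<^sup>2 < e" if "m \<ge> N" "n \<ge> m" for m n
    using le [OF that(2)] N [of m n] that by simp
  then show "\<exists>N. \<forall>m\<ge>N. \<forall>n\<ge>m. (norm (z n - z m))\<^sup>2 < e" by blast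
qed

text \<open>
The numbers $\|A^k x\|^2 = \langle A^{2k} x, x\rangle$ decrease, hence converge, and
$\|A^{2n}x - A^{2m}x\|^2 = \|A^{2n}x\|^2 + \|A^{2m}x\|^2 - 2\|A^{n+m}x\|^2
\le \|A^{2m}x\|^2 - \|A^{2n}x\|^2$ for $m \le n$. So $A^{2n}$ converges strongly, and the limit is the
orthogonal projection onto the fixed vectors of $A^2$. Only even powers are taken so that $n + m$
counts applications of $A$ on each side of the inner product.
\<close>

lemma even_powers_limit:
  fixes A :: "'a::{real_inner,banach} \<Rightarrow>\<^sub>L 'a"
  assumes A: "selfadj A" "\<And>x. norm (A x) \<le> norm x"
  obtains Q where "projection Q" "Q \<in> double_commutant A" "\<And>x. A x = x \<Longrightarrow> Q x = x" "\<And>x. A (A (Q x)) = Q x"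
proof -
  define P where "P k = ((o\<^sub>L) A ^^ k) id_blinfun" for k
  have P0: "P 0 = id_blinfun" and PS: "P (Suc k) = A o\<^sub>L P k" for k
    by (simp_all add: P_def)
  have Padd: "P (j + k) x = P j (P k x)" for j k x
    by (induction j) (simp_all add: P0 PS)
  have PA: "P k (A x) = A (P k x)" for k x
    by (induction k) (simp_all add: P0 PS)
  have saP: "selfadj (P k)" for k
    by (induction k) (simp_all add: P0 PS selfadj_def PA selfadjD [OF A(1)])
  have dcP: "P k \<in> double_commutant A" for k
    by (induction k) (auto simp: P0 PS intro: double_commutant_intros)
  define b where "b x k = inner (P k x) (P k x)" for x k
  have b_dec: "decseq (b x)" for x
    using A(2) by (intro decseq_SucI) (simp add: b_def PS norm_le)
  have b_le: "b x k \<le> b x 0" "0 \<le> b x k" for x k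
    using decseqD [OF b_dec, of 0 k x] by (auto simp: b_def)
  have inner_P: "inner (P j x) (P k x) = inner x (P (j + k) x)" for j k x
    by (simp add: selfadjD [OF saP] Padd)
  have P_norm: "norm (P k x) \<le> 1 * norm x" for k x
    using b_le(1) [of x k] by (simp add: b_def P0 norm_le)
  have "convergent (\<lambda>n. P (2 * n) x)" for x
  proof (rule convergent_if_dist_square_le)
    have conv: "convergent (b x)"
      by (intro Bseq_monoseq_convergent decseq_imp_monoseq b_dec BseqI' [where K = "b x 0"])
        (use b_le [of x] in auto)
    show "convergent (\<lambda>n. b x (2 * n))"
      by (rule convergent_subseq_convergent [OF conv, of "\<lambda>n. 2 * n", unfolded comp_def])
        (simp add: strict_mono_def)
    fix m n :: nat assume "m \<le> n"
    have "(norm (P (2 * n) x - P (2 * m) x))\<^sup>2 =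
        b x (2 * n) + b x (2 * m) - 2 * inner (P (2 * n) x) (P (2 * m) x)"
      by (simp add: power2_norm_eq_inner b_def inner_diff_left inner_diff_right inner_commute)
    also have "inner (P (2 * n) x) (P (2 * m) x) = b x (n + m)"
      unfolding b_def inner_P by (rule arg_cong [where f = "\<lambda>k. inner x (P k x)"]) simp
    finally show "(norm (P (2 * n) x - P (2 * m) x))\<^sup>2 \<le> \<bar>b x (2 * n) - b x (2 * m)\<bar>"
      using decseqD [OF b_dec, of "n + m" "2 * n" x] \<open>m \<le> n\<close> by simp
  qed
  then obtain Q where Q: "\<And>x. (\<lambda>n. P (2 * n) x) \<longlonglongrightarrow> blinfun_apply Q x"
    using strong_limit [of "\<lambda>n. P (2 * n)" 1] P_norm by blast
  have AAQ: "A (A (Q x)) = Q x" for x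
  proof (rule LIMSEQ_unique)
    have "(\<lambda>n. P (2 * Suc n) x) \<longlonglongrightarrow> Q x"
      using Q LIMSEQ_Suc by blast
    then show "(\<lambda>n. A (A (P (2 * n) x))) \<longlonglongrightarrow> Q x" by (simp add: PS)
  qed (intro tendsto_intros Q)
  have fixed: "Q x = x" if "A (A x) = x" for x
  proof (rule LIMSEQ_unique [OF Q])
    have "P (2 * n) x = x" for n
      by (induction n) (simp_all add: P0 PS that)
    then show "(\<lambda>n. P (2 * n) x) \<longlonglongrightarrow> x" by simp
  qed
  have "projection Q"
    unfolding projection_def
    using selfadj_strong_limit [OF saP Q] fixed [OF AAQ] by (auto intro: blinfun_eqI)
  moreover have "Q \<in> double_commutant A" by (rule double_commutant_strong_limit [OF dcP Q])
  ultimately show ?thesis using AAQ fixed by (intro that [of Q]) auto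
qed

text \<open>
\<open>Q\<close> is the spectral projection of \<open>Y\<close> for $(-\infty, 0]$. Strict positivity on the kernel of \<open>Q\<close> is
what puts the eigenvalue \<open>0\<close> on the side of \<open>Q\<close>, and it makes \<open>Q\<close> unique.
\<close>

definition cut_projection :: "('a::real_inner \<Rightarrow>\<^sub>L 'a) \<Rightarrow> ('a \<Rightarrow>\<^sub>L 'a) \<Rightarrow> bool" where
  "cut_projection Y Q \<longleftrightarrow> projection Q \<and> Q \<in> double_commutant Y \<and>
     (\<forall>x. inner (Y (Q x)) (Q x) \<le> 0) \<and> (\<forall>x. Q x = 0 \<longrightarrow> x \<noteq> 0 \<longrightarrow> 0 < inner (Y x) x)"

lemma double_commutant_commute: "Z \<in> double_commutant T \<Longrightarrow> S o\<^sub>L T = T o\<^sub>L S \<Longrightarrow> Z (S x) = S (Z x)"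
  by (metis blinfun_apply_blinfun_compose double_commutantD)

text \<open>
\<open>Q\<close> is the projection onto the kernel of the positive part \<open>W = (\<bar>Y\<bar> + Y) / 2\<close>, where
\<open>R = \<bar>Y\<bar>\<close> is a square root of $Y^2$. As $W$ is a contraction, so is $1 - W^2$, whose fixed vectors
are the kernel of $W$, and \<open>even_powers_limit\<close> applies. On the kernel of $W$ we have $Y = -R \le 0$.
Since \<open>W (R - Y) = 0\<close>, the range of \<open>R - Y\<close> lies in that kernel, so \<open>Y = R\<close> wherever \<open>Q\<close> vanishes.
\<close>

lemma cut_projection_exists_contraction:
  fixes Y :: "'a::{real_inner,banach} \<Rightarrow>\<^sub>L 'a"
  assumes Y: "selfadj Y" "\<And>x. norm (Y x) \<le> norm x"
  shows "\<exists>Q. cut_projection Y Q"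
proof -
  have YY: "inner ((Y o\<^sub>L Y) x) x = inner (Y x) (Y x)" for x
    by (simp add: selfadjD [OF Y(1)])
  obtain R where R: "selfadj R" "\<And>x. 0 \<le> inner (R x) x" "R o\<^sub>L R = Y o\<^sub>L Y" "R \<in> double_commutant (Y o\<^sub>L Y)"
  proof (rule square_root_exists [of "Y o\<^sub>L Y"])
    show "selfadj (Y o\<^sub>L Y)" by (intro selfadj_intros Y)
    show "0 \<le> inner ((Y o\<^sub>L Y) x) x" "inner ((Y o\<^sub>L Y) x) x \<le> inner x x" for x
      unfolding YY using Y(2) [of x] by (simp_all add: norm_le)
  qed (use that in blast)
  have R_dc: "R \<in> double_commutant Y" using R(4) by (rule double_commutant_trans) (intro double_commutant_intros)
  have RR: "R (R x) = Y (Y x)" for x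
    using R(3) by (metis blinfun_apply_blinfun_compose)
  have "inner (R x) (R x) = inner (Y x) (Y x)" for x
    using RR [of x] by (metis Y(1) R(1) selfadjD)
  then have R_norm: "norm (R x) = norm (Y x)" for x
    by (simp add: norm_eq)
  have RY: "R (Y x) = Y (R x)" for x
    by (rule double_commutant_commute [OF R_dc]) simp
  define W where "W = (1/2) *\<^sub>R (R + Y)"
  have W_sa: "selfadj W" unfolding W_def by (intro selfadj_intros R Y)
  have W_norm: "norm (W x) \<le> norm x" for x
    using norm_triangle_ineq [of "R x" "Y x"] Y(2) [of x] R_norm [of x]
    by (simp add: W_def blinfun.scaleR_left blinfun.add_left)
  have WD: "W (R x - Y x) = 0" for x
    by (simp add: W_def blinfun.scaleR_left blinfun.add_left blinfun.diff_right RR RY)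
  define A where "A = id_blinfun - (W o\<^sub>L W)"
  have A_apply: "A x = x - W (W x)" for x by (simp add: A_def blinfun.diff_left)
  have A_sa: "selfadj A" unfolding A_def by (intro selfadj_intros W_sa)
  have A_inner: "inner (A x) x = inner x x - inner (W x) (W x)" for x
    by (simp add: A_apply inner_diff_left selfadjD [OF W_sa])
  have A_norm: "norm (A x) \<le> norm x" for x
    using W_norm by (intro norm_le_if_between_0_1 A_sa) (simp_all add: A_inner norm_le)
  obtain Q where Q: "projection Q" "Q \<in> double_commutant A" "\<And>x. A x = x \<Longrightarrow> Q x = x" "\<And>x. A (A (Q x)) = Q x"
    using even_powers_limit [OF A_sa A_norm] by blast
  have "A \<in> double_commutant Y"
    unfolding A_def W_def by (intro double_commutant_intros R_dc)
  then have Q_dc: "Q \<in> double_commutant Y" using Q(2) double_commutant_trans by blast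
  have WQ: "W (Q x) = 0" for x
  proof -
    let ?q = "Q x"
    have "W (W ?q) + W (W ?q) = W (W (W (W ?q)))"
      using Q(4) [of x] by (simp add: A_apply blinfun.diff_right algebra_simps)
    then have "inner (W (W ?q) + W (W ?q)) ?q = inner (W (W (W (W ?q)))) ?q" by simp
    then have "2 * inner (W ?q) (W ?q) = inner (W (W ?q)) (W (W ?q))"
      by (simp add: inner_add_left selfadjD [OF W_sa])
    also have "\<dots> \<le> inner (W ?q) (W ?q)"
      using W_norm [of "W ?q"] by (simp add: norm_le)
    finally have "inner (W ?q) (W ?q) = 0"
      using inner_ge_zero [of "W ?q"] by linarith
    then show ?thesis by simp
  qed
  have "cut_projection Y Q"
    unfolding cut_projection_def
  proof (intro conjI allI impI)
    fix x
    have "Y (Q x) = - R (Q x)"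
      using WQ [of x] by (simp add: W_def blinfun.scaleR_left blinfun.add_left add_eq_0_iff)
    then show "inner (Y (Q x)) (Q x) \<le> 0" using R(2) by simp
  next
    fix x assume x: "Q x = 0" "x \<noteq> 0"
    have "Q (R x - Y x) = R x - Y x"
      by (rule Q(3)) (simp add: A_apply WD)
    moreover have "Q (R x) = R (Q x)" "Q (Y x) = Y (Q x)"
      using double_commutantD [OF R_dc, of Y] by (auto intro!: double_commutant_commute [OF Q_dc])
    ultimately have eq: "R x = Y x" using x by (simp add: blinfun.diff_right)
    have "R x \<noteq> 0"
    proof
      assume "R x = 0"
      then have "A x = x" using eq by (simp add: A_apply W_def blinfun.scaleR_left blinfun.add_left)
      then show False using Q(3) x by force
    qed
    moreover have "inner (R x) (R x) \<le> inner (R x) x"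
    proof (rule norm_le_if_between_0_1 [OF R(1,2)])
      fix x
      have "inner (R x) x \<le> norm (R x) * norm x" by (rule norm_cauchy_schwarz)
      also have "\<dots> \<le> norm x * norm x"
        using R_norm Y(2) by (simp add: mult_right_mono)
      finally show "inner (R x) x \<le> inner x x" by (simp add: norm_eq_sqrt_inner)
    qed
    ultimately show "0 < inner (Y x) x"
      using eq by (metis inner_gt_zero_iff less_le_trans)
  qed (use Q Q_dc in auto)
  then show ?thesis ..
qed

lemma cut_projection_exists:
  fixes Y :: "'a::{real_inner,banach} \<Rightarrow>\<^sub>L 'a"
  assumes "selfadj Y"
  shows "\<exists>Q. cut_projection Y Q"
proof -
  define r where "r = inverse (norm Y + 1)"
  have "r > 0" by (simp add: r_def add_nonneg_pos)
  have "norm ((r *\<^sub>R Y) x) \<le> norm x" for x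
  proof -
    have "norm (Y x) \<le> (norm Y + 1) * norm x"
      using norm_blinfun [of Y x] by (simp add: distrib_right add_increasing2)
    then show ?thesis
      by (simp add: blinfun.scaleR_left r_def abs_of_nonneg add_nonneg_nonneg divide_simps mult.commute
          add_nonneg_pos)
  qed
  then obtain Q where Q: "cut_projection (r *\<^sub>R Y) Q"
    using cut_projection_exists_contraction assms selfadj_scaleR by blast
  have "r *\<^sub>R Y \<in> double_commutant Y" by (intro double_commutant_intros)
  then have "cut_projection Y Q"
    using Q \<open>r > 0\<close> double_commutant_trans unfolding cut_projection_def
    by (auto simp: blinfun.scaleR_left mult_le_0_iff zero_less_mult_iff)
  then show ?thesis ..
qed

section \<open>Orthogonal projections\<close>

lemma projectionD:
  assumes "projection Q"
  shows "selfadj Q" "Q (Q x) = Q x" "inner (Q x) (Q x) = inner (Q x) x" "inner (Q x) y = inner x (Q y)"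
    "inner (Q x) x \<le> inner x x" "0 \<le> inner (Q x) x"
proof -
  show sa: "selfadj Q" and QQ: "Q (Q x) = Q x" for x
    using assms unfolding projection_def by (auto simp: blinfun_eq_iff)
  show sy: "inner (Q x) y = inner x (Q y)" for x y
    by (rule selfadjD [OF sa])
  show id: "inner (Q x) (Q x) = inner (Q x) x" for x
    using sy [of "Q x" x] by (simp add: QQ)
  show "0 \<le> inner (Q x) x" by (simp flip: id)
  have "0 \<le> inner (x - Q x) (x - Q x)" by simp
  also have "\<dots> = inner x x - inner (Q x) x"
    by (simp add: inner_diff_left inner_diff_right id inner_commute)
  finally show "inner (Q x) x \<le> inner x x" by simp
qed

lemma projection_id: "projection id_blinfun"
  by (simp add: projection_def selfadj_id blinfun_eq_iff)

lemma projection_0: "projection 0"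
  by (simp add: projection_def selfadj_def)

lemma projection_compl: "projection Q \<Longrightarrow> projection (id_blinfun - Q)"
  unfolding projection_def
  by (auto intro!: selfadj_intros simp: blinfun_eq_iff blinfun.diff_left blinfun.diff_right)

lemma selfadj_eqI:
  assumes P: "selfadj P" and Q: "selfadj Q" and eq: "\<And>x. inner (P x) x = inner (Q x) x"
  shows "P = Q"
proof (rule blinfun_eqI)
  fix x
  have "inner (P x) y = inner (Q x) y" for y
  proof -
    have exp: "inner (R (x + y)) (x + y) = inner (R x) x + 2 * inner (R x) y + inner (R y) y"
      if "selfadj R" for R :: "'a \<Rightarrow>\<^sub>L 'a"
      using selfadjD [OF that, of y x]
      by (simp add: blinfun.add_right inner_add_left inner_add_right inner_commute)
    show ?thesis
      using eq [of "x + y"] eq [of x] eq [of y] by (simp add: exp [OF P] exp [OF Q])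
  qed
  then show "P x = Q x" by (metis inner_commute vector_eq_ldot)
qed

text \<open>
Test the inequality on vectors of the range of \<open>Q\<close>, where the second summand already exhausts
the right-hand side.
\<close>

lemma projection_orthogonal:
  assumes P: "projection P" and Q: "projection Q"
    and le: "\<And>x. inner (P x) x + inner (Q x) x \<le> inner x x"
  shows "P (Q y) = 0"
proof -
  have "inner (P (Q y)) (P (Q y)) \<le> 0"
    using le [of "Q y"] by (simp add: projectionD [OF P] projectionD [OF Q])
  then show ?thesis by (metis inner_gt_zero_iff not_le)
qed

lemma projection_add:
  assumes P: "projection P" and Q: "projection Q"
    and le: "\<And>x. inner (P x) x + inner (Q x) x \<le> inner x x"
  shows "projection (P + Q)"
  unfolding projection_def
proof
  show "selfadj (P + Q)" using projectionD(1) [OF P] projectionD(1) [OF Q] by (rule selfadj_add)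
  have "P (Q y) = 0" "Q (P y) = 0" for y
    using projection_orthogonal [OF P Q le] projection_orthogonal [OF Q P] le
    by (simp_all add: add.commute)
  then show "(P + Q) o\<^sub>L (P + Q) = P + Q"
    by (simp add: blinfun_eq_iff blinfun.add_left blinfun.add_right projectionD [OF P] projectionD [OF Q])
qed

text \<open>
Apply \<open>projection_orthogonal\<close> to \<open>1 - Q\<close> and \<open>P\<close>.
\<close>

lemma projection_le:
  assumes P: "projection P" and Q: "projection Q" and le: "\<And>x. inner (P x) x \<le> inner (Q x) x"
  shows "Q (P y) = P y" and "(norm (Q y - P y))\<^sup>2 = inner (Q y) y - inner (P y) y"
proof -
  have "(id_blinfun - Q) (P y) = 0"
    using le by (intro projection_orthogonal projection_compl P Q)
      (simp add: blinfun.diff_left inner_diff_left)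
  then show "Q (P y) = P y" by (simp add: blinfun.diff_left)
  then have "inner (Q y) (P y) = inner (P y) y"
    using projectionD(4) [OF Q, of y "P y"] by (simp add: inner_commute)
  then show "(norm (Q y - P y))\<^sup>2 = inner (Q y) y - inner (P y) y"
    by (simp add: power2_norm_eq_inner inner_diff_left inner_diff_right projectionD(3) [OF P]
        projectionD(3) [OF Q] inner_commute)
qed

section \<open>The spectral family of a self-adjoint operator\<close>

text \<open>
A mean value principle without derivatives: sum the estimate over a partition into $n$ equal parts; the
right-hand sides telescope to $(b - a)(g(b) - g(a))/n$. It identifies a Stieltjes integral
(\<open>inner_eq_integral\<close>) as well as the integral of a monotone function
(\<open>legendre_transform_quantile\<close>) from two-sided bounds on increments.
\<close>

lemma eq_if_dist_le_increment:
  fixes \<phi> g :: "real \<Rightarrow> real"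
  assumes ab: "a \<le> b"
    and le: "\<And>u v. a \<le> u \<Longrightarrow> u \<le> v \<Longrightarrow> v \<le> b \<Longrightarrow> \<bar>\<phi> v - \<phi> u\<bar> \<le> (v - u) * (g v - g u)"
  shows "\<phi> a = \<phi> b"
proof -
  have bound: "\<bar>\<phi> b - \<phi> a\<bar> \<le> (b - a) * (g b - g a) / real (Suc n)" for n
  proof -
    define \<delta> where "\<delta> = (b - a) / real (Suc n)"
    define p where "p i = a + real i * \<delta>" for i
    have \<delta>: "0 \<le> \<delta>" using ab by (simp add: \<delta>_def)
    have p: "p 0 = a" "p (Suc n) = b"
      by (simp_all add: p_def \<delta>_def del: of_nat_Suc)
    have p_step: "p (Suc i) - p i = \<delta>" for i
      by (simp add: p_def algebra_simps)
    have "p i \<le> b" if "i \<le> Suc n" for i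
      using mult_right_mono [OF _ \<delta>, of "real i" "real (Suc n)"] that p(2) by (simp add: p_def)
    moreover have "a \<le> p i" "p i \<le> p (Suc i)" for i
      using p_step [of i] \<delta> by (auto simp: p_def)
    ultimately have "\<bar>\<phi> (p (Suc i)) - \<phi> (p i)\<bar> \<le> \<delta> * (g (p (Suc i)) - g (p i))" if "i < Suc n" for i
      using le [of "p i" "p (Suc i)"] that p_step [of i] by simp
    then have "\<bar>\<Sum>i<Suc n. \<phi> (p (Suc i)) - \<phi> (p i)\<bar> \<le> (\<Sum>i<Suc n. \<delta> * (g (p (Suc i)) - g (p i)))"
      by (intro order_trans [OF sum_abs] sum_mono) auto
    also have "\<dots> = \<delta> * (g b - g a)"
      unfolding sum_distrib_left [symmetric] sum_lessThan_telescope [where f = "\<lambda>i. g (p i)"] p ..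
    finally show ?thesis
      unfolding sum_lessThan_telescope [where f = "\<lambda>i. \<phi> (p i)"] p by (simp add: \<delta>_def)
  qed
  have "(\<lambda>n. (b - a) * (g b - g a) / real (Suc n)) \<longlonglongrightarrow> 0"
    by (intro LIMSEQ_Suc) (rule lim_const_over_n)
  then have "\<bar>\<phi> b - \<phi> a\<bar> \<le> 0"
    by (rule LIMSEQ_le_const) (use bound in blast)
  then show ?thesis by simp
qed

text \<open>
The spectral projection of \<open>T\<close> for $(-\infty, t]$.
\<close>

definition spectral_family :: "('a::{real_inner,banach} \<Rightarrow>\<^sub>L 'a) \<Rightarrow> real \<Rightarrow> 'a \<Rightarrow>\<^sub>L 'a" where
  "spectral_family T t = (SOME Q. cut_projection (T - t *\<^sub>R id_blinfun) Q)"

context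
  fixes T :: "'a::{real_inner,banach} \<Rightarrow>\<^sub>L 'a"
  assumes T: "selfadj T"
begin

private abbreviation E :: "real \<Rightarrow> 'a \<Rightarrow>\<^sub>L 'a" where "E \<equiv> spectral_family T"

lemma cut_projection_spectral_family: "cut_projection (T - t *\<^sub>R id_blinfun) (E t)"
  unfolding spectral_family_def
  by (rule someI_ex, rule cut_projection_exists, rule selfadj_diff [OF T selfadj_scaleR [OF selfadj_id]])

lemma projection_spectral_family: "projection (E t)"
  using cut_projection_spectral_family by (simp add: cut_projection_def)

lemma spectral_family_in_double_commutant: "E t \<in> double_commutant T"
proof (rule double_commutant_trans)
  show "E t \<in> double_commutant (T - t *\<^sub>R id_blinfun)"
    using cut_projection_spectral_family by (simp add: cut_projection_def)
qed (intro double_commutant_intros)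

lemma spectral_family_le: "inner (T (E t x)) (E t x) \<le> t * inner (E t x) (E t x)"
  using cut_projection_spectral_family [of t] unfolding cut_projection_def
  by (simp add: blinfun.diff_left blinfun.scaleR_left inner_diff_left)

lemma spectral_family_gt: "E t x = 0 \<Longrightarrow> x \<noteq> 0 \<Longrightarrow> t * inner x x < inner (T x) x"
  using cut_projection_spectral_family [of t] unfolding cut_projection_def
  by (simp add: blinfun.diff_left blinfun.scaleR_left inner_diff_left)

lemma spectral_family_commute: "S o\<^sub>L T = T o\<^sub>L S \<Longrightarrow> E t (S x) = S (E t x)"
  using double_commutant_commute spectral_family_in_double_commutant by blast

lemma spectral_family_commute_self: "T o\<^sub>L E t = E t o\<^sub>L T"
  using double_commutantD [OF spectral_family_in_double_commutant, of T] by simp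

text \<open>
Every projection that commutes with \<open>T\<close> and cuts it at \<open>t\<close> is complementary to the spectral family.
\<open>P\<close> and \<open>E t\<close> commute, so vectors of the range of \<open>E t P\<close>, and likewise of
$(1 - E_t)(1 - P)$, would satisfy contradictory inequalities unless they vanish. This is what
identifies $1_{(t,\infty)}(T)$ for an arbitrary spectral measure of \<open>T\<close>.
\<close>

lemma spectral_family_unique:
  assumes P: "projection P" and comm: "P o\<^sub>L T = T o\<^sub>L P"
    and pos: "\<And>x. P x = x \<Longrightarrow> x \<noteq> 0 \<Longrightarrow> t * inner x x < inner (T x) x"
    and neg: "\<And>x. P x = 0 \<Longrightarrow> inner (T x) x \<le> t * inner x x"
  shows "P = id_blinfun - E t"
proof (rule blinfun_eqI)
  fix x
  note EP = spectral_family_commute [OF comm, of t]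
  note EE = projectionD(2) [OF projection_spectral_family] and PP = projectionD(2) [OF P]
  have EP0: "E t (P x) = 0"
  proof (rule ccontr)
    let ?z = "E t (P x)"
    assume "?z \<noteq> 0"
    moreover have "P ?z = ?z" by (metis EP PP)
    ultimately show False
      using pos [of ?z] spectral_family_le [of t "P x"] by simp
  qed
  have "x - E t x - P x = 0"
  proof (rule ccontr)
    let ?w = "x - E t x - P x"
    assume "?w \<noteq> 0"
    moreover have "E t ?w = 0" "P ?w = 0"
      using EP0 EP [of x] by (simp_all add: blinfun.diff_right EE PP)
    ultimately show False
      using neg [of ?w] spectral_family_gt [of t ?w] by simp
  qed
  then show "P x = (id_blinfun - E t) x" by (simp add: blinfun.diff_left)
qed

lemma spectral_family_nested:
  assumes "t \<le> s"
  shows "E s (E t x) = E t x" "E t (E s x) = E t x"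
proof -
  have comm: "E s (E t y) = E t (E s y)" for y
    using spectral_family_commute [OF spectral_family_commute_self [symmetric]] by blast
  note EE = projectionD(2) [OF projection_spectral_family]
  have "E t x - E s (E t x) = 0"
  proof (rule ccontr)
    let ?z = "E t x - E s (E t x)"
    assume nz: "?z \<noteq> 0"
    have "E s ?z = 0" and Etz: "E t ?z = ?z"
      using comm [of "E t x"] by (simp_all add: blinfun.diff_right EE)
    then have "s * inner ?z ?z < inner (T ?z) ?z" using spectral_family_gt nz by blast
    also have "\<dots> \<le> t * inner ?z ?z" using spectral_family_le [of t ?z] unfolding Etz .
    finally have "s * inner ?z ?z < t * inner ?z ?z" .
    then show False using assms by (metis inner_ge_zero mult_right_mono not_le)
  qed
  then show "E s (E t x) = E t x" "E t (E s x) = E t x" using comm [of x] by simp_all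
qed

lemma spectral_family_right_fixed:
  assumes "\<And>s. t < s \<Longrightarrow> E s z = z"
  shows "E t z = z"
proof -
  have "z - E t z = 0"
  proof (rule ccontr)
    let ?w = "z - E t z"
    assume nz: "?w \<noteq> 0"
    then have pos: "0 < inner ?w ?w" by simp
    have "E t ?w = 0"
      by (simp add: blinfun.diff_right projectionD(2) [OF projection_spectral_family])
    then have gt: "t * inner ?w ?w < inner (T ?w) ?w" using spectral_family_gt nz by blast
    define r where "r = inner (T ?w) ?w / inner ?w ?w"
    have r: "t < r" "inner (T ?w) ?w = r * inner ?w ?w"
      using gt pos nz by (simp_all add: r_def divide_simps mult.commute)
    define s where "s = (t + r) / 2"
    have s: "t < s" "s < r" using r(1) by (simp_all add: s_def)
    have "E s ?w = ?w"
      using assms [OF s(1)] spectral_family_nested [of t s] s(1) by (simp add: blinfun.diff_right)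
    then have "r * inner ?w ?w \<le> s * inner ?w ?w"
      using spectral_family_le [of s ?w] r(2) by simp
    then show False using s(2) pos by (simp add: mult_le_cancel_right)
  qed
  then show ?thesis by simp
qed

lemma abs_inner_le_norm: "\<bar>inner (T x) x\<bar> \<le> norm T * inner x x"
proof -
  have "\<bar>inner (T x) x\<bar> \<le> norm (T x) * norm x" by (rule Cauchy_Schwarz_ineq2)
  also have "\<dots> \<le> (norm T * norm x) * norm x"
    by (intro mult_right_mono norm_blinfun norm_ge_zero)
  finally show ?thesis by (simp add: norm_eq_sqrt_inner mult.assoc)
qed

lemma spectral_family_top:
  assumes "norm T \<le> t" shows "E t = id_blinfun"
proof (rule blinfun_eqI)
  fix x
  have "x - E t x = 0"
  proof (rule ccontr)
    let ?w = "x - E t x"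
    assume nz: "?w \<noteq> 0"
    have "E t ?w = 0"
      by (simp add: blinfun.diff_right projectionD(2) [OF projection_spectral_family])
    then have "t * inner ?w ?w < norm T * inner ?w ?w"
      using less_le_trans [OF spectral_family_gt abs_le_D1 [OF abs_inner_le_norm]] nz by blast
    then show False using assms by (metis inner_ge_zero mult_right_mono not_le)
  qed
  then show "E t x = id_blinfun x" by simp
qed

lemma spectral_family_bot:
  assumes "t < - norm T" shows "E t = 0"
proof (rule blinfun_eqI)
  fix x
  show "E t x = blinfun_apply 0 x"
  proof (rule ccontr)
    let ?w = "E t x"
    assume "?w \<noteq> blinfun_apply 0 x"
    then have "0 < inner ?w ?w" by simp
    then have "t * inner ?w ?w < - norm T * inner ?w ?w"
      using assms by (intro mult_strict_right_mono)
    then show False using spectral_family_le [of t x] abs_inner_le_norm [of ?w] by simp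
  qed
qed

lemma spectral_family_mono: "t \<le> s \<Longrightarrow> inner (E t x) x \<le> inner (E s x) x"
proof -
  assume "t \<le> s"
  have "inner (E t (E s x)) (E s x) \<le> inner (E s x) (E s x)"
    by (rule projectionD(5) [OF projection_spectral_family])
  also have "\<dots> = inner (E s x) x"
    by (rule projectionD(3) [OF projection_spectral_family])
  finally show ?thesis
    using projectionD(4) [OF projection_spectral_family [of s], of x "E t x"]
    by (simp add: spectral_family_nested \<open>t \<le> s\<close> inner_commute)
qed

text \<open>
The vectors \<open>E s x\<close> converge as $s \downarrow t$, because their squared distances are differences of
a monotone function; by \<open>spectral_family_right_fixed\<close> the limit is \<open>E t x\<close>.
\<close>

lemma spectral_family_right_continuous:
  "continuous (at_right a) (\<lambda>t. inner (E t x) x)"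
  unfolding continuous_within
proof (rule tendsto_at_right_sequentially [of a "a + 1"])
  fix S :: "nat \<Rightarrow> real"
  assume S: "\<And>n. a < S n" "decseq S" "S \<longlonglongrightarrow> a"
  let ?z = "\<lambda>n. E (S n) x"
  have "convergent ?z"
  proof (rule convergent_if_dist_square_le)
    let ?f = "\<lambda>n. inner (?z n) x"
    have "decseq ?f"
      using S(2) by (auto simp: decseq_def intro: spectral_family_mono)
    then show "convergent ?f"
      using projectionD(5,6) [OF projection_spectral_family, of _ x]
      by (intro Bseq_monoseq_convergent decseq_imp_monoseq BseqI' [where K = "inner x x"]) auto
    show "(norm (?z n - ?z m))\<^sup>2 \<le> \<bar>?f n - ?f m\<bar>" if "m \<le> n" for m n
      using projection_le(2) [OF projection_spectral_family [of "S n"] projection_spectral_family [of "S m"], of x]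
        spectral_family_mono [OF decseqD [OF S(2) that]] by (simp add: norm_minus_commute)
  qed
  then obtain z where z: "?z \<longlonglongrightarrow> z" by (auto simp: convergent_def)
  have "E a z = z"
  proof (rule spectral_family_right_fixed)
    fix r assume "a < r"
    have "(\<lambda>n. E r (?z n)) \<longlonglongrightarrow> E r z" by (intro tendsto_intros z)
    moreover have "\<forall>\<^sub>F n in sequentially. ?z n = E r (?z n)"
      using order_tendstoD(2) [OF S(3) \<open>a < r\<close>]
      by eventually_elim (simp add: spectral_family_nested)
    ultimately have "?z \<longlonglongrightarrow> E r z"
      using tendsto_cong by fastforce
    then show "E r z = z" using z LIMSEQ_unique by blast
  qed
  moreover have "E a z = E a x"
  proof (rule LIMSEQ_unique)
    show "(\<lambda>n. E a (?z n)) \<longlonglongrightarrow> E a z" by (intro tendsto_intros z)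
    show "(\<lambda>n. E a (?z n)) \<longlonglongrightarrow> E a x"
      using S(1) by (simp add: spectral_family_nested less_imp_le)
  qed
  ultimately show "(\<lambda>n. inner (?z n) x) \<longlonglongrightarrow> inner (E a x) x"
    using tendsto_inner [OF z tendsto_const [of x]] by simp
qed simp

section \<open>The projection-valued measure on the real line\<close>

text \<open>
The Stieltjes measure of $t \mapsto \langle E_t x, x\rangle$, which will be
$B \mapsto \langle 1_B(T) x, x\rangle$.
\<close>

definition scalar_measure :: "'a \<Rightarrow> real measure" where
  "scalar_measure x = interval_measure (\<lambda>t. inner (E t x) x)"

lemma sets_scalar_measure [simp, measurable_cong]: "sets (scalar_measure x) = sets borel"
  and space_scalar_measure [simp]: "space (scalar_measure x) = UNIV"
  by (simp_all add: scalar_measure_def)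

lemma emeasure_scalar_measure_Ioc:
  "a \<le> b \<Longrightarrow> emeasure (scalar_measure x) {a<..b} = ennreal (inner (E b x) x - inner (E a x) x)"
  unfolding scalar_measure_def
  by (intro emeasure_interval_measure_Ioc spectral_family_mono spectral_family_right_continuous)

lemma emeasure_scalar_measure_UNIV: "emeasure (scalar_measure x) UNIV = ennreal (inner x x)"
proof -
  \<comment> \<open>Every one of these intervals contains the spectrum, so they all have the same measure.\<close>
  let ?A = "\<lambda>n. {- (norm T + 1) - real n<..norm T + real n}"
  have "(\<Union>n. ?A n) = UNIV"
  proof (intro set_eqI iffI UNIV_I)
    fix t :: real
    obtain n where "\<bar>t\<bar> \<le> real n" using real_arch_simple by blast
    then have "t \<in> ?A n" using norm_ge_zero [of T] by (simp; linarith)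
    then show "t \<in> (\<Union>n. ?A n)" by blast
  qed
  moreover have "(SUP n. emeasure (scalar_measure x) (?A n)) = emeasure (scalar_measure x) (\<Union>n. ?A n)"
    by (rule SUP_emeasure_incseq) (auto simp: incseq_def)
  moreover have "emeasure (scalar_measure x) (?A n) = ennreal (inner x x)" for n
    by (subst emeasure_scalar_measure_Ioc)
      (use norm_ge_zero [of T] of_nat_0_le_iff [of n] in
        \<open>auto simp: spectral_family_top spectral_family_bot simp del: norm_ge_zero of_nat_0_le_iff\<close>)
  ultimately show ?thesis by simp
qed

lemma finite_scalar_measure: "finite_measure (scalar_measure x)"
  by (rule finite_measureI) (simp add: emeasure_scalar_measure_UNIV)

lemma measure_scalar_measure_UNIV: "measure (scalar_measure x) UNIV = inner x x"
  by (simp add: measure_def emeasure_scalar_measure_UNIV)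

lemma measure_scalar_measure_le: "measure (scalar_measure x) B \<le> inner x x"
  using finite_measure.bounded_measure [OF finite_scalar_measure, of x B]
  by (simp add: measure_scalar_measure_UNIV)

lemma measure_scalar_measure_Ioc:
  "a \<le> b \<Longrightarrow> measure (scalar_measure x) {a<..b} = inner (E b x) x - inner (E a x) x"
  by (simp add: measure_def emeasure_scalar_measure_Ioc spectral_family_mono)

text \<open>
Membership in the double commutant of \<open>T\<close> is included because it survives strong limits and yields
complex-linearity later.
\<close>

definition represents :: "('a \<Rightarrow>\<^sub>L 'a) \<Rightarrow> real set \<Rightarrow> bool" where
  "represents Q B \<longleftrightarrow> projection Q \<and> Q \<in> double_commutant T \<and> (\<forall>x. inner (Q x) x = measure (scalar_measure x) B)"

lemma represents_unique: "represents P B \<Longrightarrow> represents Q B \<Longrightarrow> P = Q"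
  unfolding represents_def by (intro selfadj_eqI) (auto simp: projectionD)

lemma represents_compl:
  assumes "represents Q B" "B \<in> sets borel"
  shows "represents (id_blinfun - Q) (- B)"
proof -
  have "measure (scalar_measure x) (- B) = inner x x - measure (scalar_measure x) B" for x
    using finite_measure.finite_measure_compl [OF finite_scalar_measure, of B x] assms(2)
    by (simp add: measure_scalar_measure_UNIV Compl_eq_Diff_UNIV)
  then show ?thesis
    using assms(1) by (auto simp: represents_def blinfun.diff_left inner_diff_left
        intro!: projection_compl double_commutant_intros)
qed

text \<open>
Projections with $\langle Q_i x, x\rangle = \mu_x(A_i)$ for disjoint $A_i$ are mutually orthogonal, since
two of them add up to at most $\mu_x(\mathbb{R}) = \|x\|^2$. Their partial sums are therefore increasing
projections, which converge strongly because $\sum_i \mu_x(A_i)$ converges.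
\<close>

lemma represents_Union:
  assumes Q: "\<And>i::nat. represents (Q i) (A i)" and disj: "disjoint_family A"
    and A: "range A \<subseteq> sets borel"
  obtains L where "represents L (\<Union>i. A i)" "\<And>x. (\<lambda>i. Q i x) sums blinfun_apply L x"
proof -
  have mQ: "inner (Q i x) x = measure (scalar_measure x) (A i)"
    and pQ: "projection (Q i)" and dQ: "Q i \<in> double_commutant T" for i x
    using Q by (auto simp: represents_def)
  have meas_sums: "(\<lambda>i. measure (scalar_measure x) (A i)) sums measure (scalar_measure x) (\<Union>i. A i)" for x
    using finite_measure.finite_measure_UNION [OF finite_scalar_measure] A disj by simp
  define S where "S n = (\<Sum>i<n. Q i)" for n
  have S_apply: "S n x = (\<Sum>i<n. Q i x)" for n x
    by (simp add: S_def blinfun.sum_left)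
  have S_inner: "inner (S n x) x = (\<Sum>i<n. measure (scalar_measure x) (A i))" for n x
    by (simp add: S_apply inner_sum_left mQ)
  have S_le: "inner (S n x) x \<le> inner x x" for n x
  proof -
    have "(\<Sum>i<n. measure (scalar_measure x) (A i)) \<le> measure (scalar_measure x) (\<Union>i. A i)"
      unfolding sums_unique [OF meas_sums] by (intro sum_le_suminf sums_summable [OF meas_sums]) auto
    then show ?thesis
      using measure_scalar_measure_le order_trans by (simp add: S_inner) blast
  qed
  have pS: "projection (S n)" for n
  proof (induction n)
    case (Suc n)
    have "S (Suc n) = S n + Q n" by (simp add: S_def)
    moreover have "inner (S n x) x + inner (Q n x) x \<le> inner x x" for x
      using S_le [of "Suc n" x] by (simp add: S_inner mQ)
    ultimately show ?case using Suc pQ by (simp add: projection_add)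
  qed (simp add: S_def projection_0)
  have dS: "S n \<in> double_commutant T" for n
    unfolding S_def by (induction n) (auto simp: double_commutant_zero intro: double_commutant_add dQ)
  have S_mono: "inner (S m x) x \<le> inner (S n x) x" if "m \<le> n" for m n x
    unfolding S_inner using that by (intro sum_mono2) auto
  have "convergent (\<lambda>n. S n x)" for x
  proof (rule convergent_if_dist_square_le)
    show "convergent (\<lambda>n. inner (S n x) x)"
      unfolding S_inner using meas_sums by (auto simp: sums_def convergent_def)
    show "(norm (S n x - S m x))\<^sup>2 \<le> \<bar>inner (S n x) x - inner (S m x) x\<bar>" if "m \<le> n" for m n
      using projection_le(2) [OF pS pS S_mono [OF that], of x] by simp
  qed
  moreover have "norm (S n x) \<le> 1 * norm x" for n x
    using projectionD(5) [OF pS, of n x] by (simp add: norm_le projectionD(3) [OF pS])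
  ultimately obtain L where L: "\<And>x. (\<lambda>n. S n x) \<longlonglongrightarrow> blinfun_apply L x"
    using strong_limit [of S 1] by blast
  have "represents L (\<Union>i. A i)"
    unfolding represents_def
  proof (intro conjI allI)
    have LS: "L (S m x) = S m x" for m x
    proof (rule LIMSEQ_unique [OF L])
      have "\<forall>\<^sub>F n in sequentially. S n (S m x) = S m x"
        using eventually_ge_at_top [of m]
        by eventually_elim (rule projection_le(1) [OF pS pS S_mono])
      then show "(\<lambda>n. S n (S m x)) \<longlonglongrightarrow> S m x"
        by (rule tendsto_eventually)
    qed
    have "L (L x) = L x" for x
    proof (rule LIMSEQ_unique)
      show "(\<lambda>n. L (S n x)) \<longlonglongrightarrow> L (L x)" by (intro tendsto_intros L)
      show "(\<lambda>n. L (S n x)) \<longlonglongrightarrow> L x" unfolding LS by (rule L)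
    qed
    then show "projection L"
      using selfadj_strong_limit [OF projectionD(1) [OF pS] L]
      by (simp add: projection_def blinfun_eq_iff)
    show "L \<in> double_commutant T" by (rule double_commutant_strong_limit [OF dS L])
    show "inner (L x) x = measure (scalar_measure x) (\<Union>i. A i)" for x
    proof (rule LIMSEQ_unique)
      show "(\<lambda>n. inner (S n x) x) \<longlonglongrightarrow> inner (L x) x" by (intro tendsto_intros L)
      show "(\<lambda>n. inner (S n x) x) \<longlonglongrightarrow> measure (scalar_measure x) (\<Union>i. A i)"
        unfolding S_inner using meas_sums by (simp add: sums_def)
    qed
  qed
  then show ?thesis
    using L that by (simp add: sums_def S_apply)
qed

text \<open>
A Dynkin argument: the half-open intervals are an intersection-stable generator of the Borel sets,
and they are represented by increments of the spectral family.
\<close>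

lemma represents_exists:
  assumes "B \<in> sets borel"
  shows "\<exists>Q. represents Q B"
proof -
  let ?G = "range (\<lambda>(a, b). {a<..b::real})"
  have B: "B \<in> sigma_sets UNIV ?G"
    using assms unfolding borel_sigma_sets_Ioc by simp
  have borelI: "A \<in> sets borel" if "A \<in> sigma_sets UNIV ?G" for A
    using that unfolding borel_sigma_sets_Ioc by simp
  have empty: "represents 0 {}"
    by (simp add: represents_def projection_0 double_commutant_zero)
  have "Int_stable ?G"
  proof (rule Int_stableI)
    fix A B assume "A \<in> ?G" "B \<in> ?G"
    then obtain a b c d where "A = {a<..b}" "B = {c<..d}" by auto
    then have "A \<inter> B = (\<lambda>(a, b). {a<..b}) (max a c, min b d)" by auto
    then show "A \<inter> B \<in> ?G" by blast
  qed
  moreover have "?G \<subseteq> Pow UNIV" by simp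
  ultimately show ?thesis
    using B
  proof (induction rule: sigma_sets_induct_disjoint)
    case (basic A)
    then obtain a b where A: "A = {a<..b}" by auto
    show ?case
    proof (cases "a \<le> b")
      case True
      have "projection (E b - E a)"
        using selfadj_diff [OF projectionD(1) projectionD(1),
            OF projection_spectral_family projection_spectral_family, of b a]
        by (simp add: projection_def blinfun_eq_iff blinfun.diff_left blinfun.diff_right
            spectral_family_nested [OF True] projectionD(2) [OF projection_spectral_family])
      then have "represents (E b - E a) A"
        unfolding represents_def A measure_scalar_measure_Ioc [OF True]
        by (auto intro!: double_commutant_diff spectral_family_in_double_commutant simp: blinfun.diff_left inner_diff_left)
      then show ?thesis ..
    next
      case False
      then show ?thesis using empty by (auto simp: A)
    qed
  next
    case (compl A)
    then obtain Q where "represents Q A" by blast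
    then show ?case
      using represents_compl borelI compl by (metis Compl_eq_Diff_UNIV)
  next
    case (union A)
    then obtain Q where Q: "\<And>i. represents (Q i) (A i)" by metis
    have "range A \<subseteq> sets borel" using union borelI by blast
    then show ?case using represents_Union [OF Q union(1)] by blast
  qed (use empty in auto)
qed

definition real_pvm :: "real set \<Rightarrow> 'a \<Rightarrow>\<^sub>L 'a" where
  "real_pvm B = (SOME Q. represents Q B)"

lemma represents_real_pvm: "B \<in> sets borel \<Longrightarrow> represents (real_pvm B) B"
  unfolding real_pvm_def by (rule someI_ex) (rule represents_exists)

lemma real_pvm_eqI: "represents Q B \<Longrightarrow> B \<in> sets borel \<Longrightarrow> real_pvm B = Q"
  using represents_real_pvm represents_unique by blast

lemma real_pvm_sums:
  assumes "range A \<subseteq> sets borel" "disjoint_family A"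
  shows "(\<lambda>n::nat. real_pvm (A n) x) sums real_pvm (\<Union>n. A n) x"
proof -
  obtain L where L: "represents L (\<Union>i. A i)" "\<And>x. (\<lambda>i. real_pvm (A i) x) sums blinfun_apply L x"
    using represents_Union [of "\<lambda>i. real_pvm (A i)" A] assms represents_real_pvm by blast
  moreover have "(\<Union>i. A i) \<in> sets borel" using assms(1) by blast
  ultimately show ?thesis using real_pvm_eqI by metis
qed

lemma real_pvm_Un:
  assumes "A \<in> sets borel" "B \<in> sets borel" "A \<inter> B = {}"
  shows "real_pvm (A \<union> B) = real_pvm A + real_pvm B" "real_pvm A (real_pvm B x) = 0"
proof -
  have A: "represents (real_pvm A) A" and B: "represents (real_pvm B) B"
    using assms represents_real_pvm by auto
  have m: "measure (scalar_measure x) (A \<union> B) =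
      measure (scalar_measure x) A + measure (scalar_measure x) B" for x
    using finite_measure.finite_measure_Union [OF finite_scalar_measure] assms by simp
  then have le: "inner (real_pvm A x) x + inner (real_pvm B x) x \<le> inner x x" for x
    using A B measure_scalar_measure_le [of x "A \<union> B"] by (simp add: represents_def)
  show "real_pvm A (real_pvm B x) = 0"
    using A B le by (intro projection_orthogonal) (auto simp: represents_def)
  show "real_pvm (A \<union> B) = real_pvm A + real_pvm B"
  proof (rule real_pvm_eqI)
    show "represents (real_pvm A + real_pvm B) (A \<union> B)"
      using A B le m unfolding represents_def
      by (auto intro!: projection_add double_commutant_add simp: blinfun.add_left inner_add_left)
  qed (use assms in auto)
qed

text \<open>
Multiplicativity follows from additivity, because projections of disjoint sets are orthogonal.
\<close>

lemma real_pvm_Int: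
  assumes "A \<in> sets borel" "B \<in> sets borel"
  shows "real_pvm (A \<inter> B) = real_pvm A o\<^sub>L real_pvm B"
proof (rule blinfun_eqI)
  fix x
  have 1: "real_pvm A = real_pvm (A \<inter> B) + real_pvm (A - B)"
    using real_pvm_Un(1) [of "A \<inter> B" "A - B"] assms by (simp add: Int_Diff_Un Int_Diff_disjoint)
  have 2: "real_pvm B = real_pvm (A \<inter> B) + real_pvm (B - A)"
    using real_pvm_Un(1) [of "B \<inter> A" "B - A"] assms
    by (simp add: Int_Diff_Un Int_Diff_disjoint Int_commute [of A B])
  have 3: "real_pvm (A \<inter> B) (real_pvm (B - A) x) = 0" "real_pvm (A - B) (real_pvm (A \<inter> B) x) = 0"
    "real_pvm (A - B) (real_pvm (B - A) x) = 0"
    by (rule real_pvm_Un(2); use assms in auto)+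
  have "projection (real_pvm (A \<inter> B))"
    using represents_real_pvm [of "A \<inter> B"] assms by (auto simp: represents_def)
  then show "real_pvm (A \<inter> B) x = (real_pvm A o\<^sub>L real_pvm B) x"
    by (subst 1, subst 2) (simp add: blinfun.add_left blinfun.add_right 3 projectionD(2))
qed

text \<open>
On the range of $E_b - E_a$ the operator lies between \<open>a\<close> and \<open>b\<close>.
\<close>

lemma spectral_family_increment:
  fixes x
  assumes "a \<le> b"
  defines "q \<equiv> \<lambda>t. inner (T x) (E t x)" and "g \<equiv> \<lambda>t. inner (E t x) x"
  shows "a * (g b - g a) \<le> q b - q a" "q b - q a \<le> b * (g b - g a)"
proof -
  define u where "u = E b x - E a x"
  have Eu: "E a u = 0" "E b u = u"
    by (simp_all add: u_def blinfun.diff_right spectral_family_nested assms(1)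
        projectionD(2) [OF projection_spectral_family])
  have q: "q t = inner (T (E t x)) (E t x)" for t
  proof -
    have "E t (T x) = T (E t x)" by (rule spectral_family_commute) simp
    then show ?thesis
      using projectionD(4) [OF projection_spectral_family, of t "T x" "E t x"]
      by (simp add: q_def projectionD(2) [OF projection_spectral_family])
  qed
  have "E a (E b x) = E a x" by (rule spectral_family_nested) fact
  then have "inner (T (E b x)) (E a x) = q a"
    using projectionD(4) [OF projection_spectral_family, of a "T (E b x)" "E a x"]
      spectral_family_commute [of T a "E b x"]
    by (simp add: q projectionD(2) [OF projection_spectral_family])
  moreover from this have "inner (T (E a x)) (E b x) = q a"
    using selfadjD [OF T, of "E a x" "E b x"] by (simp add: inner_commute)
  ultimately have Tu: "inner (T u) u = q b - q a"
    by (simp add: u_def blinfun.diff_right inner_diff_left inner_diff_right q)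
  have uu: "inner u u = g b - g a"
    using projection_le(2) [OF projection_spectral_family projection_spectral_family
        spectral_family_mono [OF assms(1)], of x]
    by (simp add: g_def u_def power2_norm_eq_inner)
  show "q b - q a \<le> b * (g b - g a)"
    using spectral_family_le [of b u] by (simp add: Eu Tu uu)
  show "a * (g b - g a) \<le> q b - q a"
    using spectral_family_gt [of a u] Eu by (cases "u = 0") (auto simp flip: Tu uu)
qed

text \<open>
Both $t \mapsto \langle T x, E_t x\rangle$ and $t \mapsto \int_{(c,t]} s\,d\mu_x(s)$ have increments
over $(u,v]$ between $u\,\mu_x(u,v]$ and $v\,\mu_x(u,v]$. So \<open>eq_if_dist_le_increment\<close> applies to their
difference.
\<close>

lemma inner_eq_integral: "inner (T x) x = integral\<^sup>L (scalar_measure x) (\<lambda>t. t)"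
proof -
  interpret finite_measure "scalar_measure x" by (rule finite_scalar_measure)
  let ?\<mu> = "scalar_measure x"
  define g where "g t = inner (E t x) x" for t
  define c where "c = - norm T - 1"
  define d where "d = norm T"
  have cd: "c \<le> d" "E c = 0" "E d = id_blinfun"
    using norm_ge_zero [of T] by (auto simp: c_def d_def spectral_family_top spectral_family_bot
        simp del: norm_ge_zero)
  define f where "f t = (\<integral>s. indicator {c<..t} s * s \<partial>?\<mu>)" for t
  have bd: "integrable ?\<mu> (\<lambda>s. indicator {u<..v} s * s)" for u v
    by (rule integrable_const_bound [where B = "max \<bar>u\<bar> \<bar>v\<bar>"]) (auto simp: indicator_def)
  have f_incr: "u * (g v - g u) \<le> f v - f u" "f v - f u \<le> v * (g v - g u)" if "c \<le> u" "u \<le> v" for u v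
  proof -
    have "f v - f u = (\<integral>s. indicator {c<..v} s * s - indicator {c<..u} s * s \<partial>?\<mu>)"
      unfolding f_def by (subst Bochner_Integration.integral_diff) (auto intro: bd)
    also have "\<dots> = (\<integral>s. indicator {u<..v} s * s \<partial>?\<mu>)"
      by (rule Bochner_Integration.integral_cong) (use that in \<open>auto simp: indicator_def\<close>)
    finally have eq: "f v - f u = (\<integral>s. indicator {u<..v} s * s \<partial>?\<mu>)" .
    have const: "(\<integral>s. indicator {u<..v} s * r \<partial>?\<mu>) = r * (g v - g u)" for r
      using measure_scalar_measure_Ioc [OF that(2), of x] by (simp add: g_def mult.commute)
    have int: "integrable ?\<mu> (\<lambda>s. indicator {u<..v} s * r)" for r :: real
      by (rule integrable_const_bound [where B = "\<bar>r\<bar>"]) (auto simp: indicator_def)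
    show "u * (g v - g u) \<le> f v - f u"
      unfolding eq const [symmetric]
      by (rule integral_mono [OF int bd]) (auto simp: indicator_def)
    show "f v - f u \<le> v * (g v - g u)"
      unfolding eq const [symmetric]
      by (rule integral_mono [OF bd int]) (auto simp: indicator_def)
  qed
  have "inner (T x) (E c x) - f c = inner (T x) (E d x) - f d"
  proof (rule eq_if_dist_le_increment [OF cd(1), where g = g])
    fix u v assume "c \<le> u" "u \<le> v" "v \<le> d"
    show "\<bar>inner (T x) (E v x) - f v - (inner (T x) (E u x) - f u)\<bar> \<le> (v - u) * (g v - g u)"
      using f_incr [OF \<open>c \<le> u\<close> \<open>u \<le> v\<close>] spectral_family_increment [OF \<open>u \<le> v\<close>, of x]
      by (simp add: g_def left_diff_distrib)
  qed
  then have "inner (T x) x = f d" by (simp add: cd f_def)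
  also have "f d = (\<integral>s. s \<partial>?\<mu>)"
    unfolding f_def
  proof (rule integral_cong_AE)
    have "measure ?\<mu> {c<..d} = measure ?\<mu> UNIV"
      by (simp add: measure_scalar_measure_Ioc cd measure_scalar_measure_UNIV)
    then have "measure ?\<mu> (UNIV - {c<..d}) = 0"
      using finite_measure_compl [of "{c<..d}"] by simp
    then have "UNIV - {c<..d} \<in> null_sets ?\<mu>"
      by (simp add: null_sets_def emeasure_eq_measure)
    then show "AE s in ?\<mu>. indicator {c<..d} s * s = s"
      by (rule AE_I') (auto simp: indicator_def)
  qed auto
  finally show ?thesis .
qed

end

section \<open>Adjoints\<close>

text \<open>
The functional $J(x) = \frac12\|x\|^2 - f(x)$ is bounded below; by the parallelogram law a minimizing
sequence is Cauchy, and the derivative of $J$ vanishes at the minimizer.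
\<close>

lemma riesz_representation:
  fixes f :: "'a::{real_inner,banach} \<Rightarrow> real"
  assumes f: "bounded_linear f"
  obtains v where "\<And>x. f x = inner v x"
proof -
  interpret bounded_linear f by (rule f)
  obtain K where K: "\<And>x. norm (f x) \<le> norm x * K"
    using bounded by blast
  define J where "J x = inner x x / 2 - f x" for x
  have J_lower: "- (K * K / 2) \<le> J x" for x
  proof -
    have "0 \<le> (norm x - K)\<^sup>2" by simp
    then have "norm x * K - K * K / 2 \<le> inner x x / 2"
      by (simp add: power2_diff power2_norm_eq_inner [symmetric] power2_eq_square field_simps)
    then show ?thesis using K [of x] by (simp add: J_def abs_le_iff)
  qed
  define m where "m = (INF x. J x)"
  have bdd: "bdd_below (range J)" using J_lower by (intro bdd_belowI2)
  have m: "m \<le> J x" for x unfolding m_def by (rule cINF_lower [OF bdd]) simp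
  have "\<exists>x. J x < m + 1 / real (Suc n)" for n
    using cINF_less_iff [of UNIV J "m + 1 / real (Suc n)"] bdd by (simp add: m_def)
  then obtain z where z: "\<And>n. J (z n) < m + 1 / real (Suc n)" by metis
  have parallelogram: "(norm (x - y))\<^sup>2 = 4 * (J x + J y - 2 * J ((1/2) *\<^sub>R (x + y)))" for x y
    by (simp add: J_def power2_norm_eq_inner scaleR add inner_diff_left inner_diff_right inner_add_left
        inner_add_right inner_commute field_simps)
  have "convergent z"
  proof (rule convergent_if_dist_square_small)
    fix e :: real assume "0 < e"
    then obtain N where N: "8 / e < real N" using reals_Archimedean2 by blast
    have "(norm (z n - z k))\<^sup>2 < e" if "k \<ge> N" "n \<ge> k" for k n
    proof -
      have "1 / real (Suc n) \<le> 1 / real (Suc k)" using that by (simp add: frac_le)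
      then have "J (z n) + J (z k) - 2 * J ((1/2) *\<^sub>R (z n + z k)) < 2 * (1 / real (Suc k))"
        using z [of n] z [of k] m [of "(1/2) *\<^sub>R (z n + z k)"] by linarith
      then have "(norm (z n - z k))\<^sup>2 < 8 / real (Suc k)" unfolding parallelogram by simp
      also have "8 / real (Suc k) < e"
      proof -
        have "8 / e < real (Suc k)" using N that by simp
        then show ?thesis using \<open>0 < e\<close> by (simp add: field_simps)
      qed
      finally show ?thesis .
    qed
    then show "\<exists>N. \<forall>k\<ge>N. \<forall>n\<ge>k. (norm (z n - z k))\<^sup>2 < e" by blast
  qed
  then obtain v where v: "z \<longlonglongrightarrow> v" by (auto simp: convergent_def)
  have "(\<lambda>n. J (z n)) \<longlonglongrightarrow> J v"
    unfolding J_def by (intro tendsto_intros v tendsto [OF v]) simp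
  moreover have "(\<lambda>n. m + 1 / real (Suc n)) \<longlonglongrightarrow> m + 0"
    by (intro tendsto_add tendsto_const LIMSEQ_Suc lim_const_over_n)
  ultimately have "J v \<le> m"
    using LIMSEQ_le [of "\<lambda>n. J (z n)" "J v" "\<lambda>n. m + 1 / real (Suc n)" m] z less_imp_le by auto
  then have minimal: "J v \<le> J x" for x using m order_trans by blast
  have "f h = inner v h" for h
  proof -
    define d where "d = inner v h - f h"
    define q where "q = inner h h / 2"
    have quad: "0 \<le> t * d + t * t * q" for t
      using minimal [of "v + t *\<^sub>R h"]
      by (simp add: J_def d_def q_def scaleR add inner_add_left inner_add_right inner_commute field_simps)
    have "q \<ge> 0" by (simp add: q_def)
    define e where "e = d / (q + 1)"
    have d: "d = e * (q + 1)" using \<open>q \<ge> 0\<close> by (simp add: e_def)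
    \<comment> \<open>Any \<open>t = - d / r\<close> with \<open>r > q\<close> forces \<open>d = 0\<close>; the choice \<open>r = q + 1\<close> is never zero.\<close>
    have "0 \<le> (- e) * d + (- e) * (- e) * q" by (rule quad)
    also have "\<dots> = - e\<^sup>2" by (simp add: d power2_eq_square algebra_simps)
    finally have "e = 0" by simp
    then show ?thesis using d by (simp add: d_def)
  qed
  then show ?thesis by (rule that)
qed

lemma adjoint_exists:
  fixes T :: "'a::{real_inner,banach} \<Rightarrow>\<^sub>L 'a"
  obtains S :: "'a \<Rightarrow>\<^sub>L 'a" where "\<And>x y. inner (blinfun_apply T x) y = inner x (blinfun_apply S y)"
proof -
  have "\<exists>v. \<forall>x. inner (T x) y = inner v x" for y
  proof -
    have "bounded_linear (\<lambda>x. inner (T x) y)"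
      by (intro bounded_linear_inner_left_comp blinfun.bounded_linear_right)
    then show ?thesis by (metis riesz_representation)
  qed
  then obtain v where v: "\<And>x y. inner (T x) y = inner (v y) x" by metis
  have eqI: "a = b" if "\<And>x. inner a x = inner b x" for a b :: 'a
    using that by (metis inner_commute vector_eq_ldot)
  have "bounded_linear v"
  proof (rule bounded_linear_intro)
    fix x y :: 'a and r :: real
    show "v (x + y) = v x + v y" by (rule eqI) (simp add: inner_add_left inner_add_right flip: v)
    show "v (r *\<^sub>R x) = r *\<^sub>R v x" by (rule eqI) (simp flip: v)
    have "norm (v x) * norm (v x) = inner (T (v x)) x"
      by (simp add: v flip: power2_norm_eq_inner power2_eq_square)
    also have "\<dots> \<le> norm (T (v x)) * norm x" by (rule norm_cauchy_schwarz)
    also have "\<dots> \<le> (norm T * norm (v x)) * norm x"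
      by (intro mult_right_mono norm_blinfun norm_ge_zero)
    finally have "norm (v x) * norm (v x) \<le> norm (v x) * (norm x * norm T)" by (simp add: mult_ac)
    then show "norm (v x) \<le> norm x * norm T"
      by (cases "v x = 0") (auto simp: mult_le_cancel_left)
  qed
  then show ?thesis
    using that [of "Blinfun v"] v by (simp add: bounded_linear_Blinfun_apply inner_commute)
qed

lemma Re_cinner: "Re (cinner x y) = inner x y"
  by (simp add: inner_eq_Re_cinner)

lemma cinner_scaleC_right: "cinner x (a *\<^sub>C y) = cnj a * cinner x y"
  by (metis cinner_commute cinner_scaleC_left complex_cnj_mult)

lemma Im_cinner: "Im (cinner x y) = - inner (\<i> *\<^sub>C x) y"
  by (simp add: inner_eq_Re_cinner cinner_scaleC_left)

lemma Im_cinner_right: "Im (cinner x y) = inner x (\<i> *\<^sub>C y)"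
  by (simp add: inner_eq_Re_cinner cinner_scaleC_right)

lemma scaleC_apply: "blinfun_apply (c *\<^sub>C T) x = c *\<^sub>C blinfun_apply T x"
  by transfer simp

lemma bounded_opsD: "T \<in> bounded_ops \<Longrightarrow> T (c *\<^sub>C x) = c *\<^sub>C T x"
  by (simp add: bounded_ops_def)

text \<open>
The imaginary part of $\langle Tx, y\rangle$ is a real inner product with $\mathrm{i}x$.
\<close>

lemma cinner_eq_if_inner_eq:
  assumes "T \<in> bounded_ops" and eq: "\<And>x y. inner (T x) y = inner x (S y)"
  shows "cinner (T x) y = cinner x (S y)"
  using eq [of x y] eq [of "\<i> *\<^sub>C x" y]
  by (simp add: complex_eq_iff Re_cinner Im_cinner bounded_opsD [OF assms(1)])

lemma cadjoint_eqI:
  assumes "\<And>x y. cinner (blinfun_apply T x) y = cinner x (blinfun_apply S y)"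
  shows "cadjoint T = S"
  unfolding cadjoint_def
proof (rule the_equality)
  fix R :: "'a \<Rightarrow>\<^sub>L 'a" assume "\<forall>x y. cinner (blinfun_apply T x) y = cinner x (blinfun_apply R y)"
  then have "inner x (R y) = inner x (S y)" for x y
    using assms by (simp add: inner_eq_Re_cinner)
  then show "R = S" by (metis blinfun_eqI vector_eq_ldot)
qed (use assms in simp)

lemma cinner_cadjoint:
  assumes "T \<in> bounded_ops"
  shows "cinner (T x) y = cinner x (cadjoint T y)"
proof -
  obtain S where "\<And>x y. inner (T x) y = inner x (blinfun_apply S y)"
    using adjoint_exists by blast
  then have "\<And>x y. cinner (T x) y = cinner x (S y)"
    using cinner_eq_if_inner_eq [OF assms] by blast
  then show ?thesis using cadjoint_eqI by metis
qed

lemma inner_cadjoint: "T \<in> bounded_ops \<Longrightarrow> inner (T x) y = inner x (cadjoint T y)"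
  by (simp add: inner_eq_Re_cinner cinner_cadjoint)

lemma cadjoint_eq_self_iff:
  assumes "T \<in> bounded_ops"
  shows "cadjoint T = T \<longleftrightarrow> selfadj T"
proof
  assume "selfadj T"
  then show "cadjoint T = T"
    using assms by (intro cadjoint_eqI cinner_eq_if_inner_eq) (simp_all add: selfadjD)
qed (metis assms inner_cadjoint selfadj_def)

lemma double_commutant_bounded_ops:
  assumes T: "T \<in> bounded_ops" and Z: "Z \<in> double_commutant T"
  shows "Z \<in> bounded_ops"
proof -
  have "Z ((c *\<^sub>C id_blinfun) x) = (c *\<^sub>C id_blinfun) (Z x)" for c x
    by (rule double_commutant_commute [OF Z]) (simp add: blinfun_eq_iff scaleC_apply bounded_opsD [OF T])
  then show ?thesis by (simp add: bounded_ops_def scaleC_apply)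
qed

lemma cinner_self_selfadj:
  assumes "T \<in> bounded_ops" "selfadj T"
  shows "cinner (T x) x = complex_of_real (inner (T x) x)"
proof -
  have "cinner (T x) x = cinner x (T x)"
    using assms by (intro cinner_eq_if_inner_eq) (simp_all add: selfadjD)
  then have "cinner (T x) x = cnj (cinner (T x) x)" using cinner_commute by metis
  then have "Im (cinner (T x) x) = 0" by (metis cnj.simps(2) equal_neg_zero)
  then show ?thesis by (simp add: complex_eq_iff Re_cinner)
qed

section \<open>Spectral measures of a self-adjoint operator\<close>

lemma of_real_vimage_borel: "B \<in> sets borel \<Longrightarrow> complex_of_real -` B \<in> sets borel"
  by (rule measurable_sets_borel [of complex_of_real borel]) simp_all

text \<open>
The measure on $\mathbb{C}$ is the image of the one on $\mathbb{R}$ under the inclusion, so integrals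
against it are integrals over $\mathbb{R}$.
\<close>

lemma is_spectral_measure_real_pvm:
  fixes T :: "'h::complex_hilbert_space \<Rightarrow>\<^sub>L 'h"
  assumes T: "T \<in> bounded_ops" and sa: "selfadj T"
  shows "is_spectral_measure T (\<lambda>B. real_pvm T (complex_of_real -` B))"
proof -
  let ?E = "\<lambda>B. real_pvm T (complex_of_real -` B)"
  have rep: "represents T (?E B) (complex_of_real -` B)" if "B \<in> sets borel" for B
    by (intro represents_real_pvm sa of_real_vimage_borel that)
  have proj: "projection (?E B)" and bops: "?E B \<in> bounded_ops"
    and meas: "inner (?E B x) x = measure (scalar_measure T x) (complex_of_real -` B)"
    if "B \<in> sets borel" for B x
    using rep [OF that] double_commutant_bounded_ops [OF T] by (auto simp: represents_def [OF sa])
  have id: "represents T id_blinfun B" if "\<And>x. measure (scalar_measure T x) B = inner x x" for B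
    using that by (simp add: represents_def [OF sa] projection_id double_commutant_id)
  have "projection_valued_measure ?E"
    unfolding projection_valued_measure_def
  proof (intro conjI ballI allI impI)
    fix B :: "complex set" assume B: "B \<in> sets borel"
    show "?E B \<in> bounded_ops" by (rule bops [OF B])
    then show "cadjoint (?E B) = ?E B"
      using proj [OF B] by (simp add: cadjoint_eq_self_iff projectionD)
    show "?E B o\<^sub>L ?E B = ?E B" using proj [OF B] by (simp add: projection_def)
    fix A :: "complex set" assume A: "A \<in> sets borel"
    show "?E (A \<inter> B) = ?E A o\<^sub>L ?E B"
      using real_pvm_Int [OF sa of_real_vimage_borel [OF A] of_real_vimage_borel [OF B]] by simp
  next
    show "?E UNIV = id_blinfun"
      by (simp add: real_pvm_eqI [OF sa id] measure_scalar_measure_UNIV [OF sa])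
  next
    fix A :: "nat \<Rightarrow> complex set" and x
    assume "range A \<subseteq> sets borel" "disjoint_family A"
    then show "(\<lambda>n. ?E (A n) x) sums ?E (\<Union>n. A n) x"
      unfolding vimage_UN
      by (intro real_pvm_sums sa) (auto simp: disjoint_family_on_def intro!: of_real_vimage_borel)
  qed
  moreover have "?E (cball 0 (norm T + 1)) = id_blinfun"
  proof (rule real_pvm_eqI [OF sa id])
    fix x
    let ?B = "complex_of_real -` cball 0 (norm T + 1)"
    interpret finite_measure "scalar_measure T x" by (rule finite_scalar_measure [OF sa])
    have "measure (scalar_measure T x) {- (norm T + 1) <.. norm T + 1} \<le> measure (scalar_measure T x) ?B"
      by (intro finite_measure_mono) (auto simp: sets_scalar_measure [OF sa] intro!: of_real_vimage_borel)
    moreover have "measure (scalar_measure T x) {- (norm T + 1) <.. norm T + 1} = inner x x"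
      using norm_ge_zero [of T]
      by (subst measure_scalar_measure_Ioc [OF sa])
        (auto simp: spectral_family_top [OF sa] spectral_family_bot [OF sa] simp del: norm_ge_zero)
    ultimately show "measure (scalar_measure T x) ?B = inner x x"
      using measure_scalar_measure_le [OF sa, of x ?B] by simp
  qed (simp add: of_real_vimage_borel)
  moreover have "cinner (T x) x = integral\<^sup>L (pvm_scalar_measure ?E x) (\<lambda>z. z)" for x
  proof -
    let ?D = "distr (scalar_measure T x) borel complex_of_real"
    interpret finite_measure "scalar_measure T x" by (rule finite_scalar_measure [OF sa])
    have meas_of_real: "complex_of_real \<in> measurable (scalar_measure T x) borel"
      by (simp add: measurable_cong_sets [OF sets_scalar_measure [OF sa] refl])
    have "emeasure ?D B = ennreal (Re (cinner (?E B x) x))" if "B \<in> sets borel" for B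
      using meas [OF that] that meas_of_real
      by (simp add: emeasure_distr space_scalar_measure [OF sa] emeasure_eq_measure Re_cinner)
    then have "pvm_scalar_measure ?E x = measure_of UNIV (sets borel) (emeasure ?D)"
      unfolding pvm_scalar_measure_def
      by (intro measure_of_eq) (auto simp: sets.sigma_sets_eq [of borel, simplified])
    also have "\<dots> = ?D" using measure_of_of_measure [of ?D] by simp
    finally have "integral\<^sup>L (pvm_scalar_measure ?E x) (\<lambda>z. z)
        = (\<integral>t. complex_of_real t \<partial>scalar_measure T x)"
      using meas_of_real by (simp add: integral_distr)
    then show ?thesis
      using inner_eq_integral [OF sa, of x] by (simp add: cinner_self_selfadj [OF T sa])
  qed
  ultimately show ?thesis unfolding is_spectral_measure_def by blast
qed

context
  fixes T :: "'h::complex_hilbert_space \<Rightarrow>\<^sub>L 'h" and E :: "complex set \<Rightarrow> 'h \<Rightarrow>\<^sub>L 'h"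
  assumes T: "T \<in> bounded_ops" and sa: "selfadj T" and E: "is_spectral_measure T E"
begin

lemma pvm_projection: "B \<in> sets borel \<Longrightarrow> projection (E B)"
  using E cadjoint_eq_self_iff
  by (auto simp: is_spectral_measure_def projection_valued_measure_def projection_def)

lemma pvm_UNIV: "E UNIV = id_blinfun"
  using E by (simp add: is_spectral_measure_def projection_valued_measure_def)

lemma pvm_Int: "A \<in> sets borel \<Longrightarrow> B \<in> sets borel \<Longrightarrow> E A (E B x) = E (A \<inter> B) x"
  using E by (simp add: is_spectral_measure_def projection_valued_measure_def)

lemma pvm_sums:
  "range A \<subseteq> sets borel \<Longrightarrow> disjoint_family A \<Longrightarrow> (\<lambda>n::nat. E (A n) x) sums E (\<Union>n. A n) x"
  using E by (simp add: is_spectral_measure_def projection_valued_measure_def)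

lemma pvm_empty: "E {} x = 0"
proof -
  have "(\<lambda>n::nat. E {} x) sums E {} x"
    using pvm_sums [of "\<lambda>_. {}" x] by (simp add: disjoint_family_on_def)
  then have "(\<lambda>n::nat. E {} x) \<longlonglongrightarrow> 0"
    by (intro summable_LIMSEQ_zero sums_summable)
  then show ?thesis by (simp add: LIMSEQ_const_iff)
qed

private abbreviation m :: "'h \<Rightarrow> complex measure" where "m \<equiv> pvm_scalar_measure E"

lemma sets_pvm_scalar_measure [simp, measurable_cong]: "sets (m x) = sets borel"
  and space_pvm_scalar_measure [simp]: "space (m x) = UNIV"
  by (simp_all add: pvm_scalar_measure_def sets.sigma_sets_eq [of borel, simplified])

lemma emeasure_pvm:
  assumes "B \<in> sets borel"
  shows "emeasure (m x) B = ennreal (inner (E B x) x)"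
proof -
  have "emeasure (m x) B = ennreal (Re (cinner (E B x) x))"
    unfolding pvm_scalar_measure_def
  proof (rule emeasure_measure_of)
    let ?S = "sets (measure_of UNIV (sets borel) (\<lambda>B. ennreal (Re (cinner (E B x) x))))"
    have S: "?S = sets borel" by (simp add: sets.sigma_sets_eq [of borel, simplified])
    show "B \<in> ?S" using assms S by simp
    show "positive ?S (\<lambda>B. ennreal (Re (cinner (E B x) x)))"
      by (simp add: positive_def pvm_empty Re_cinner)
    show "countably_additive ?S (\<lambda>B. ennreal (Re (cinner (E B x) x)))"
    proof (rule countably_additiveI)
      fix A :: "nat \<Rightarrow> complex set"
      assume A: "range A \<subseteq> ?S" "disjoint_family A"
      have "(\<lambda>n. inner (E (A n) x) x) sums inner (E (\<Union>n. A n) x) x"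
        using pvm_sums [of A x] A S
        by (intro bounded_linear.sums [OF bounded_linear_inner_left]) auto
      moreover have "0 \<le> inner (E (A n) x) x" for n
        using A S by (intro projectionD(6) pvm_projection) auto
      ultimately show "(\<Sum>n. ennreal (Re (cinner (E (A n) x) x))) = ennreal (Re (cinner (E (\<Union>n. A n) x) x))"
        unfolding Re_cinner by (intro suminf_ennreal_eq)
    qed
  qed auto
  then show ?thesis by (simp add: Re_cinner)
qed

lemma finite_pvm: "finite_measure (m x)"
  by (rule finite_measureI) (simp add: emeasure_pvm)

text \<open>
For commuting projections $\langle E_B E_A x, E_A x\rangle = \langle E_{A \cap B} x, x\rangle$.
\<close>

lemma pvm_scalar_measure_restrict:
  assumes A: "A \<in> sets borel"
  shows "m (E A x) = density (m x) (indicator A)"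
proof (rule measure_eqI)
  fix B assume "B \<in> sets (m (E A x))"
  then have B: "B \<in> sets borel" by simp
  have "inner (E B (E A x)) (E A x) = inner (E (A \<inter> B) x) x"
    using projectionD(4) [OF pvm_projection [OF A], of "E B (E A x)" x] A B
    by (simp add: pvm_Int Int_ac)
  then show "emeasure (m (E A x)) B = emeasure (density (m x) (indicator A)) B"
    using A B by (simp add: emeasure_restricted emeasure_pvm)
qed simp

lemma pvm_AE_in:
  assumes A: "A \<in> sets borel" and fixed: "E A x = x"
  shows "AE z in m x. z \<in> A"
proof (rule AE_I')
  have "E (- A) x = E (- A) (E A x)" by (simp add: fixed)
  also have "\<dots> = 0" using A by (subst pvm_Int) (auto simp: pvm_empty)
  finally show "- A \<in> null_sets (m x)"
    using A by (simp add: null_sets_def emeasure_pvm)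
qed auto

lemma integrable_pvm: "integrable (m x) (\<lambda>z. z)"
proof -
  obtain r where r: "E (cball 0 r) = id_blinfun" using E by (auto simp: is_spectral_measure_def)
  interpret finite_measure "m x" by (rule finite_pvm)
  have "AE z in m x. z \<in> cball 0 r" by (rule pvm_AE_in) (simp_all add: r)
  then show ?thesis by (intro integrable_const_bound [where B = r]) auto
qed

lemma integral_pvm: "integral\<^sup>L (m x) (\<lambda>z. z) = complex_of_real (inner (T x) x)"
  using E by (simp add: is_spectral_measure_def flip: cinner_self_selfadj [OF T sa])

lemma integral_Re_pvm: "(\<integral>z. Re z \<partial>m x) = inner (T x) x" and integrable_Re_pvm: "integrable (m x) Re"
  and integral_Im_pvm: "(\<integral>z. Im z \<partial>m x) = 0" and integrable_Im_pvm: "integrable (m x) Im"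
  using integral_Re [OF integrable_pvm, of x] integral_Im [OF integrable_pvm, of x]
    integrable_Re [OF integrable_pvm, of x] integrable_Im [OF integrable_pvm, of x]
  by (simp_all add: integral_pvm)

text \<open>
The scalar measure of \<open>x\<close> is concentrated on \<open>A\<close>, where \<open>h\<close> is positive, so an integral that is at
most \<open>0\<close> forces the measure, and with it $\|x\|^2$, to vanish. Used with \<open>h = \<plusminus>Im\<close> to see that the measure
lives on the real line, and with \<open>h = Re - t\<close> to see that the operator exceeds \<open>t\<close> on a ray.
\<close>

lemma pvm_zero_if_integral_le_0:
  assumes A: "A \<in> sets borel" and fixed: "E A x = x" and pos: "\<And>z. z \<in> A \<Longrightarrow> 0 < h z"
    and h: "integrable (m x) h" "(\<integral>z. h z \<partial>m x) \<le> (0::real)"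
  shows "x = 0"
proof -
  have AE: "AE z in m x. 0 < h z"
    using pvm_AE_in [OF A fixed] by eventually_elim (rule pos)
  then have nonneg: "AE z in m x. 0 \<le> h z" by eventually_elim simp
  then have "0 \<le> (\<integral>z. h z \<partial>m x)" by (rule integral_nonneg_AE)
  with h have "(\<integral>z. h z \<partial>m x) = 0" by simp
  then have "AE z in m x. h z = 0"
    using integral_nonneg_eq_0_iff_AE [OF h(1) nonneg] by simp
  with AE have "AE z in m x. False" by eventually_elim simp
  then have "emeasure (m x) UNIV = 0"
    using AE_iff_null [of "m x" "\<lambda>_. False"] by (simp add: null_sets_def)
  then have "inner x x \<le> 0" by (simp add: emeasure_pvm pvm_UNIV ennreal_eq_0_iff)
  then show "x = 0" by (metis inner_gt_zero_iff not_le)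
qed

lemma pvm_nonreal: "E {z. 0 < Im z} x = 0" "E {z. Im z < 0} x = 0"
proof -
  have b: "{z. 0 < Im z} \<in> sets borel" "{z. Im z < 0} \<in> sets borel" by measurable
  show "E {z. 0 < Im z} x = 0"
    by (rule pvm_zero_if_integral_le_0 [OF b(1), where h = Im])
      (use b in \<open>auto simp: pvm_Int integrable_Im_pvm integral_Im_pvm\<close>)
  show "E {z. Im z < 0} x = 0"
    by (rule pvm_zero_if_integral_le_0 [OF b(2), where h = "\<lambda>z. - Im z"])
      (use b in \<open>auto simp: pvm_Int integrable_Im_pvm integral_Im_pvm\<close>)
qed

lemma pvm_compl: "A \<in> sets borel \<Longrightarrow> E (- A) x = x - E A x"
proof -
  assume A: "A \<in> sets borel"
  let ?A = "binaryset A (- A)"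
  have "range ?A \<subseteq> sets borel" using A by (auto simp: range_binaryset_eq)
  moreover have "disjoint_family ?A" by (auto simp: disjoint_family_on_def binaryset_def)
  ultimately have "(\<lambda>n. E (?A n) x) sums E (\<Union>n. ?A n) x" by (rule pvm_sums)
  moreover have "(\<Union>n. ?A n) = UNIV" by (simp add: UN_binaryset_eq)
  moreover have "(\<lambda>n. E (?A n) x) sums (\<Sum>n\<in>{0, Suc 0}. E (?A n) x)"
    by (rule sums_finite) (auto simp: binaryset_def pvm_empty)
  ultimately have "x = E A x + E (- A) x"
    using sums_unique2 by (fastforce simp: pvm_UNIV binaryset_def)
  then show ?thesis by (simp add: algebra_simps)
qed

text \<open>
A spectral measure is tied to \<open>T\<close> only through the numbers $\langle Tx, x\rangle$. Splitting the
integral over \<open>A\<close> and its complement shows that the quadratic form of \<open>T\<close> has no cross terms between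
the ranges of \<open>E A\<close> and \<open>1 - E A\<close>.
\<close>

lemma pvm_commute:
  assumes A: "A \<in> sets borel"
  shows "E A o\<^sub>L T = T o\<^sub>L E A"
proof -
  note P = pvm_projection [OF A]
  have split: "inner (T x) x = inner (T (E A x)) (E A x) + inner (T (x - E A x)) (x - E A x)" for x
  proof -
    have part: "inner (T (E B x)) (E B x) = (\<integral>z. indicator B z *\<^sub>R Re z \<partial>m x)" if B: "B \<in> sets borel" for B
    proof -
      have "inner (T (E B x)) (E B x) = (\<integral>z. Re z \<partial>density (m x) (\<lambda>z. ennreal (indicator B z)))"
        using integral_Re_pvm [of "E B x"] by (simp add: pvm_scalar_measure_restrict [OF B] ennreal_indicator)
      also have "\<dots> = (\<integral>z. indicator B z *\<^sub>R Re z \<partial>m x)"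
        using B by (intro integral_density) auto
      finally show ?thesis .
    qed
    have int: "integrable (m x) (\<lambda>z. indicator B z *\<^sub>R Re z)" if "B \<in> sets borel" for B
      using integrable_mult_indicator [OF _ integrable_Re_pvm] that by simp
    have "inner (T (E A x)) (E A x) + inner (T (E (- A) x)) (E (- A) x) =
        (\<integral>z. indicator A z *\<^sub>R Re z + indicator (- A) z *\<^sub>R Re z \<partial>m x)"
      using A by (simp only: part borel_comp) (rule Bochner_Integration.integral_add [symmetric]; rule int; simp)
    also have "\<dots> = (\<integral>z. Re z \<partial>m x)"
      by (rule Bochner_Integration.integral_cong) (auto simp: indicator_def)
    finally show ?thesis by (simp add: integral_Re_pvm pvm_compl [OF A])
  qed
  have ortho: "inner (T (E A a)) (b - E A b) = 0" for a b
  proof -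
    let ?x = "E A a + (b - E A b)"
    have x: "E A ?x = E A a"
      by (simp add: blinfun.add_right blinfun.diff_right projectionD(2) [OF P])
    have "inner (T ?x) ?x = inner (T (E A a)) (E A a) + inner (T (b - E A b)) (b - E A b)"
      using split [of ?x] unfolding x by simp
    moreover have "inner (T ?x) ?x = inner (T (E A a)) (E A a) + inner (T (b - E A b)) (b - E A b)
        + 2 * inner (T (E A a)) (b - E A b)"
      using selfadjD [OF sa, of "b - E A b" "E A a"]
      by (simp add: blinfun.add_right inner_add_left inner_add_right inner_commute)
    ultimately show ?thesis by simp
  qed
  have "E A (T x) = T (E A x)" for x
  proof -
    have "inner (E A (T x) - T (E A x)) y = 0" for y
    proof -
      have "inner (E A (T x)) y = inner (T x) (E A y)" by (rule projectionD(4) [OF P])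
      also have "\<dots> = inner x (T (E A y))" by (rule selfadjD [OF sa])
      also have "\<dots> = inner (E A x) (T (E A y))"
        using ortho [of y x] by (simp add: inner_diff_right inner_commute)
      also have "\<dots> = inner (T (E A x)) (E A y)" by (rule selfadjD [OF sa, symmetric])
      also have "\<dots> = inner (T (E A x)) y"
        using ortho [of x y] by (simp add: inner_diff_right)
      finally show ?thesis by (simp add: inner_diff_left)
    qed
    then show ?thesis by (metis inner_eq_zero_iff right_minus_eq)
  qed
  then show ?thesis by (simp add: blinfun_eq_iff)
qed

text \<open>
The spectral projections of rays do not depend on the choice of the spectral measure, because
\<open>spectral_family_unique\<close> characterizes them.
\<close>

lemma pvm_ray: "E (complex_of_real ` {t<..}) = id_blinfun - spectral_family T t"
proof (rule spectral_family_unique [OF sa])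
  let ?A = "complex_of_real ` {t<..}"
  have eq: "?A = {z. Im z = 0 \<and> t < Re z}"
    by (auto simp: complex_eq_iff image_iff intro!: bexI [of _ "Re _"])
  have A: "?A \<in> sets borel" unfolding eq by measurable
  show "projection (E ?A)" by (rule pvm_projection [OF A])
  show "E ?A o\<^sub>L T = T o\<^sub>L E ?A" by (rule pvm_commute [OF A])
  interpret finite_measure "m x" for x by (rule finite_pvm)
  have int: "integrable (m x) (\<lambda>z. Re z - t)" for x
    by (intro Bochner_Integration.integrable_diff integrable_Re_pvm) simp
  have "measure (m x) UNIV = inner x x" for x
    by (simp add: measure_def emeasure_pvm pvm_UNIV)
  then have integral_shift: "(\<integral>z. Re z - t \<partial>m x) = inner (T x) x - t * inner x x" for x
    by (subst Bochner_Integration.integral_diff) (auto simp: integrable_Re_pvm integral_Re_pvm mult.commute)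
  show "t * inner x x < inner (T x) x" if fixed: "E ?A x = x" and nz: "x \<noteq> 0" for x
  proof (rule ccontr)
    assume "\<not> ?thesis"
    then have "x = 0"
      by (intro pvm_zero_if_integral_le_0 [OF A fixed _ int]) (auto simp: integral_shift)
    then show False using nz by simp
  qed
  show "inner (T x) x \<le> t * inner x x" if "E ?A x = 0" for x
  proof -
    have b: "{z. 0 < Im z} \<in> sets borel" "{z. Im z < 0} \<in> sets borel" by measurable
    have AE: "AE z in m x. z \<in> - B" if "B \<in> sets borel" "E B x = 0" for B
      using that by (intro pvm_AE_in) (auto simp: pvm_compl)
    have "AE z in m x. Re z - t \<le> 0"
      using AE [OF A that] AE [OF b(1) pvm_nonreal(1)] AE [OF b(2) pvm_nonreal(2)]
      by eventually_elim (auto simp: eq)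
    then have "(\<integral>z. Re z - t \<partial>m x) \<le> 0"
      using integral_mono_AE [OF int integrable_zero] by simp
    then show ?thesis by (simp add: integral_shift)
  qed
qed

end

lemma spectral_projection_ray:
  assumes "T \<in> bounded_ops" "selfadj T"
  shows "spectral_projection T (complex_of_real ` {t<..}) = id_blinfun - spectral_family T t"
  unfolding spectral_projection_def
  by (rule the_equality) (metis is_spectral_measure_real_pvm pvm_ray assms)+

section \<open>Integrals of quantile functions\<close>

text \<open>
\<open>F\<close> plays the distribution function $c \mapsto \tau(1_{(c,\infty)}(X))$ and \<open>G\<close> the function
$c \mapsto \tau((X - c)_+)$, which is convex with subgradient $-F(c)$ at $c$; the quantile function
$\lambda(s) = \inf\{c \mid F(c) \le s\}$ then makes $-s$ a subgradient of \<open>G\<close> at $\lambda(s)$. In other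
words, $\lambda(s)$ minimizes $c \mapsto G(c) + cs$. Comparing the minimizers for two values of \<open>s\<close>
shows that the minimal value $h(s)$ has increments between $(v-u)\lambda(v)$ and $(v-u)\lambda(u)$. So does
the integral of the decreasing function $\lambda$, whence $\int_0^t \lambda = h(t) = \min_c (G(c) + ct)$.

\<open>sub\<close> says exactly that $-F$ is a subgradient; it implies that \<open>F\<close> is decreasing.
\<close>

lemma legendre_transform_quantile:
  fixes F G :: "real \<Rightarrow> real"
  assumes sub: "\<And>c d. (d - c) * F d \<le> G c - G d"
    and F0: "\<And>t. 0 \<le> F t" and F1: "\<And>t. F t \<le> 1" and K: "0 \<le> K"
    and low: "\<And>t. t < - K \<Longrightarrow> F t = 1" and high: "\<And>t. K \<le> t \<Longrightarrow> F t = 0"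
    and GK: "G K = 0" and t: "t \<in> {0..1}"
  defines "H \<equiv> (LBINT s:{0..t}. Inf {c. F c \<le> s})"
  shows "H \<le> G c + c * t" and "\<exists>c. H = G c + c * t"
proof -
  \<comment> \<open>The lower cutoff changes nothing for \<open>s < 1\<close>, as \<open>F = 1\<close> below \<open>-K\<close>, and gives a finite value also at \<open>s = 1\<close>.\<close>
  define A where "A s = {c. - K - 1 \<le> c \<and> F c \<le> s}" for s
  define l where "l s = Inf (A s)" for s
  have bdd: "bdd_below (A s)" for s by (auto simp: A_def intro: bdd_belowI)
  have K_in: "K \<in> A s" if "0 \<le> s" for s using K high [of K] that by (simp add: A_def)
  have l_le: "l s \<le> c" if "c \<in> A s" for s c
    unfolding l_def by (rule cInf_lower [OF that bdd])
  have l_ge: "- K - 1 \<le> l s" if "0 \<le> s" for s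
    unfolding l_def
  proof (rule cInf_greatest)
    show "A s \<noteq> {}" using K_in [OF that] by blast
  qed (simp add: A_def)
  have l_anti: "l v \<le> l u" if "0 \<le> u" "u \<le> v" for u v
    unfolding l_def
  proof (rule cInf_superset_mono [OF _ bdd])
    show "A u \<noteq> {}" using K_in [OF that(1)] by blast
    show "A u \<subseteq> A v" using that(2) by (auto simp: A_def)
  qed
  have G_anti: "G d \<le> G c" if "c \<le> d" for c d
    using sub [of d c] mult_nonneg_nonneg [of "d - c" "F d"] F0 [of d] that by linarith
  have G_lip: "G l - e \<le> G c" if "c \<le> l + e" "0 \<le> e" for c l e
  proof -
    have "G (l + e) \<le> G c" using that by (intro G_anti)
    moreover have "- e \<le> - e * F l"
      using F1 [of l] F0 [of l] that by (simp add: mult_left_le)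
    moreover have "- e * F l \<le> G (l + e) - G l" using sub [of l "l + e"] by simp
    ultimately show ?thesis by simp
  qed
  have minimal: "G (l s) + l s * s \<le> G c + c * s" if s: "s \<in> {0..1}" for s c
  proof (rule field_le_epsilon)
    fix e :: real assume e: "0 < e"
    consider "c < l s" | "c = l s" | "l s < c" by linarith
    then show "G (l s) + l s * s \<le> G c + c * s + e"
    proof cases
      case 1
      define d where "d = max c (l s - e)"
      have d: "c \<le> d" "d < l s" "l s - e \<le> d" using 1 e by (auto simp: d_def)
      have "d \<notin> A s" using l_le [of d s] d by linarith
      then have "s \<le> F d" using low [of d] s K by (auto simp: A_def)
      then have "(d - c) * s \<le> (d - c) * F d" using d by (intro mult_left_mono) auto
      also have "\<dots> \<le> G c - G d" by (rule sub)
      finally have "G d + d * s \<le> G c + c * s" by (simp add: algebra_simps)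
      moreover have "G (l s) \<le> G d" using d by (intro G_anti) simp
      moreover have "l s * s \<le> d * s + e"
      proof -
        have "(l s - d) * s \<le> e * 1" using d s by (intro mult_mono) auto
        then show ?thesis by (simp add: algebra_simps)
      qed
      ultimately show ?thesis by linarith
    next
      case 3
      then obtain d where d: "d \<in> A s" "d < min c (l s + e)"
        using cInf_lessD [of "A s" "min c (l s + e)"] K_in [of s] s e by (auto simp: l_def)
      have "(c - d) * F d \<le> (c - d) * s" using d by (intro mult_left_mono) (auto simp: A_def)
      moreover have "(d - c) * F d \<le> G c - G d" by (rule sub)
      ultimately have "G d + d * s \<le> G c + c * s" by (simp add: algebra_simps)
      moreover have "l s * s \<le> d * s" using l_le [OF d(1)] s by (intro mult_right_mono) auto
      moreover have "G (l s) - e \<le> G d" using d e by (intro G_lip) auto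
      ultimately show ?thesis by linarith
    qed (use e in simp)
  qed
  define h where "h s = G (l s) + l s * s" for s
  have h_incr: "h v - h u \<le> (v - u) * l u" if "u \<in> {0..1}" "v \<in> {0..1}" for u v
    using minimal [OF that(2), of "l u"] by (simp add: h_def algebra_simps)
  \<comment> \<open>Clamping the argument makes the quantile function monotone on the whole line.\<close>
  define k where "k s = l (max 0 (min 1 s))" for s
  have k_eq: "k s = l s" if "s \<in> {0..1}" for s using that by (simp add: k_def)
  have "(\<lambda>s. - k s) \<in> borel_measurable borel"
    by (intro borel_measurable_mono) (auto simp: mono_def k_def intro!: l_anti)
  then have k_meas: "k \<in> borel_measurable borel" by simp
  have k_bound: "\<bar>k s\<bar> \<le> K + 1" for s
    using l_ge [of "max 0 (min 1 s)"] l_le [OF K_in, of "max 0 (min 1 s)"] K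
    by (simp add: k_def abs_le_iff)
  have k_int: "set_integrable lborel {a..b} k" for a b
    unfolding set_integrable_def using k_bound k_meas
    by (intro integrableI_bounded_set_indicator [where B = "K + 1"]) (auto simp: emeasure_lborel_Icc_eq)
  note k_hk = set_borel_integral_eq_integral [OF k_int]
  have "H = (LBINT s:{0..t}. k s)"
    unfolding H_def set_lebesgue_integral_def
  proof (rule integral_discrete_difference [where X = "{1}"])
    fix s :: real assume "s \<notin> {1}"
    show "indicator {0..t} s *\<^sub>R Inf {c. F c \<le> s} = indicator {0..t} s *\<^sub>R k s"
    proof (cases "s \<in> {0..t}")
      case True
      then have "s < 1" "0 \<le> s" using t \<open>s \<notin> {1}\<close> by auto
      moreover have "- K - 1 \<le> c" if "F c \<le> s" for c
        using low [of c] that \<open>s < 1\<close> by fastforce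
      then have "{c. F c \<le> s} = A s" by (auto simp: A_def)
      ultimately show ?thesis by (simp add: k_eq l_def)
    qed simp
  qed auto
  also have "\<dots> = integral {0..t} k" by (rule k_hk)
  finally have H: "H = integral {0..t} k" .
  have I_incr: "(v - u) * l v \<le> integral {0..v} k - integral {0..u} k"
    "integral {0..v} k - integral {0..u} k \<le> (v - u) * l u" if uv: "0 \<le> u" "u \<le> v" "v \<le> 1" for u v
  proof -
    have eq: "integral {0..v} k - integral {0..u} k = integral {u..v} k"
      using Henstock_Kurzweil_Integration.integral_combine [OF uv(1,2) k_hk(1)] by simp
    have "integral {u..v} (\<lambda>_. l v) \<le> integral {u..v} k"
      using uv by (intro integral_le k_hk) (auto simp: k_eq intro!: l_anti)
    then show "(v - u) * l v \<le> integral {0..v} k - integral {0..u} k"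
      using uv by (simp add: eq)
    have "integral {u..v} k \<le> integral {u..v} (\<lambda>_. l u)"
      using uv by (intro integral_le k_hk) (auto simp: k_eq intro!: l_anti)
    then show "integral {0..v} k - integral {0..u} k \<le> (v - u) * l u"
      using uv by (simp add: eq)
  qed
  have "h 0 - integral {0..0} k = h t - integral {0..t} k"
  proof (rule eq_if_dist_le_increment [where \<phi> = "\<lambda>s. h s - integral {0..s} k"
        and g = "\<lambda>s. - l s"])
    fix u v assume uv: "0 \<le> u" "u \<le> v" "v \<le> t"
    then have "u \<in> {0..1}" "v \<in> {0..1}" using t by auto
    then show "\<bar>h v - integral {0..v} k - (h u - integral {0..u} k)\<bar> \<le> (v - u) * (- l v - - l u)"
      using h_incr [of u v] h_incr [of v u] I_incr [of u v] uv
      by (simp add: algebra_simps abs_le_iff)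
  qed (use t in simp)
  moreover have "h 0 = 0"
  proof -
    have "h 0 \<le> 0" using minimal [of 0 K] by (simp add: h_def GK)
    moreover have "0 \<le> G (l 0)" using G_anti [OF l_le [OF K_in, of 0]] by (simp add: GK)
    ultimately show ?thesis by (simp add: h_def)
  qed
  ultimately have Hh: "H = G (l t) + l t * t" by (simp add: H h_def)
  then show "\<exists>c. H = G c + c * t" by blast
  show "H \<le> G c + c * t" unfolding Hh by (rule minimal [OF t])
qed

section \<open>Positivity of the trace\<close>

lemma scaleR_eq_scaleC_blinfun: "r *\<^sub>R A = complex_of_real r *\<^sub>C (A :: 'a::real_normed_vector \<Rightarrow>\<^sub>L 'h::complex_hilbert_space)"
  by (simp add: blinfun_eq_iff scaleC_apply blinfun.scaleR_left scaleR_scaleC)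

definition nonneg_op :: "('a::real_inner \<Rightarrow>\<^sub>L 'a) \<Rightarrow> bool" where
  "nonneg_op A \<longleftrightarrow> selfadj A \<and> (\<forall>x. 0 \<le> inner (A x) x)"

text \<open>
The projections of $M$ would suffice for computing $\tau((X - c)_+)$. The effects contain in addition
$rY + \frac12$ for self-adjoint $Y \in M$ and small $r$, which \<open>majorized_set_scalar\<close> exploits.
\<close>

definition effects :: "('a::real_inner \<Rightarrow>\<^sub>L 'a) set \<Rightarrow> ('a \<Rightarrow>\<^sub>L 'a) set" where
  "effects M = {A \<in> M. nonneg_op A \<and> nonneg_op (id_blinfun - A)}"

lemma bounded_ops_add: "S \<in> bounded_ops \<Longrightarrow> T \<in> bounded_ops \<Longrightarrow> S + T \<in> bounded_ops"
  by (simp add: bounded_ops_def blinfun.add_left scaleC_add_right)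

lemma bounded_ops_scaleC: "T \<in> bounded_ops \<Longrightarrow> c *\<^sub>C T \<in> bounded_ops"
  by (simp add: bounded_ops_def scaleC_apply scaleC_scaleC mult.commute)

lemma bounded_ops_compose: "S \<in> bounded_ops \<Longrightarrow> T \<in> bounded_ops \<Longrightarrow> S o\<^sub>L T \<in> bounded_ops"
  by (simp add: bounded_ops_def)

lemma bounded_ops_id: "id_blinfun \<in> bounded_ops"
  by (simp add: bounded_ops_def)

context von_neumann_algebra
begin

lemma mem_iff: "T \<in> M \<longleftrightarrow> T \<in> bounded_ops \<and> (\<forall>S\<in>commutant M. \<forall>x. T (S x) = S (T x))"
proof -
  have "T \<in> M \<longleftrightarrow> T \<in> commutant (commutant M)" by (simp add: bicommutant)
  then show ?thesis by (simp add: commutant_def [of "commutant M"] blinfun_eq_iff)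
qed

lemma bounded: "T \<in> M \<Longrightarrow> T \<in> bounded_ops"
  using subset_bounded_ops by blast

lemma commutant_bounded: "S \<in> commutant M \<Longrightarrow> S \<in> bounded_ops"
  by (simp add: commutant_def)

lemma id_closed: "id_blinfun \<in> M"
  by (simp add: mem_iff bounded_ops_id)

lemma add_closed: "S \<in> M \<Longrightarrow> T \<in> M \<Longrightarrow> S + T \<in> M"
  by (simp add: mem_iff bounded_ops_add blinfun.add_left blinfun.add_right)

lemma scaleC_closed: "T \<in> M \<Longrightarrow> c *\<^sub>C T \<in> M"
  using commutant_bounded by (auto simp: mem_iff bounded_ops_scaleC scaleC_apply bounded_opsD)

lemma scaleR_closed: "T \<in> M \<Longrightarrow> r *\<^sub>R T \<in> M"
  by (simp add: scaleR_eq_scaleC_blinfun scaleC_closed)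

lemma diff_closed: "S \<in> M \<Longrightarrow> T \<in> M \<Longrightarrow> S - T \<in> M"
  using add_closed [of S "(-1) *\<^sub>R T"] scaleR_closed [of T "-1"] by simp

lemma compose_closed: "S \<in> M \<Longrightarrow> T \<in> M \<Longrightarrow> S o\<^sub>L T \<in> M"
  by (simp add: mem_iff bounded_ops_compose)

lemmas closed = id_closed add_closed scaleC_closed scaleR_closed diff_closed compose_closed

lemma double_commutant_closed:
  assumes "T \<in> M" "Z \<in> double_commutant T"
  shows "Z \<in> M"
proof -
  have "Z (S x) = S (Z x)" if "S \<in> commutant M" for S x
    using that assms by (intro double_commutant_commute [OF assms(2)]) (simp add: commutant_def)
  moreover have "Z \<in> bounded_ops" using double_commutant_bounded_ops [OF bounded] assms by blast
  ultimately show ?thesis by (simp add: mem_iff)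
qed

lemma selfadjoints_iff: "X \<in> selfadjoints M \<longleftrightarrow> X \<in> M \<and> selfadj X"
  using cadjoint_eq_self_iff bounded by (auto simp: selfadjoints_def)

lemma square_root_closed:
  assumes B: "B \<in> M" "nonneg_op B"
  obtains S where "S \<in> M" "selfadj S" "S o\<^sub>L S = B"
proof -
  define r where "r = 1 / (norm B + 1)"
  have p: "0 < norm B + 1" by (simp add: add_nonneg_pos)
  then have r: "r > 0" by (simp add: r_def)
  have sa: "selfadj B" and pos: "0 \<le> inner (B x) x" for x using B by (auto simp: nonneg_op_def)
  have le: "inner ((r *\<^sub>R B) x) x \<le> inner x x" for x
  proof -
    have "inner (B x) x \<le> norm B * inner x x"
      using abs_inner_le_norm [OF sa, of x] by simp
    also have "\<dots> \<le> (norm B + 1) * inner x x" by (simp add: distrib_right)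
    finally show ?thesis
      using p by (simp add: blinfun.scaleR_left r_def pos_divide_le_eq mult.commute)
  qed
  obtain R where R: "selfadj R" "R o\<^sub>L R = r *\<^sub>R B" "R \<in> double_commutant (r *\<^sub>R B)"
  proof (rule square_root_exists [of "r *\<^sub>R B"])
    show "0 \<le> inner ((r *\<^sub>R B) x) x" for x using pos r by (simp add: blinfun.scaleR_left)
  qed (use le sa that selfadj_scaleR in auto)
  show ?thesis
  proof (rule that [of "sqrt (1 / r) *\<^sub>R R"])
    show "sqrt (1 / r) *\<^sub>R R \<in> M"
      by (rule scaleR_closed [OF double_commutant_closed [OF scaleR_closed [OF B(1)] R(3)]])
    show "selfadj (sqrt (1 / r) *\<^sub>R R)" by (rule selfadj_scaleR [OF R(1)])
    have "R (R x) = r *\<^sub>R B x" for x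
      using arg_cong [OF R(2), of "\<lambda>Z. blinfun_apply Z x"] by (simp add: blinfun.scaleR_left)
    moreover have "sqrt (1 / r) * (sqrt (1 / r) * r) = 1"
    proof -
      have "sqrt (1 / r) * sqrt (1 / r) = 1 / r" using r by (intro real_sqrt_mult_self [THEN trans]) simp
      then show ?thesis using r by (simp only: mult.assoc [symmetric]) simp
    qed
    ultimately show "(sqrt (1 / r) *\<^sub>R R) o\<^sub>L (sqrt (1 / r) *\<^sub>R R) = B"
      by (simp add: blinfun_eq_iff blinfun.scaleR_left blinfun.scaleR_right del: real_sqrt_divide)
  qed
qed

end

context tracial_von_neumann_algebra
begin

lemma trace_scaleR: "A \<in> M \<Longrightarrow> \<tau> (r *\<^sub>R A) = r * \<tau> A"
  by (simp add: scaleR_eq_scaleC_blinfun trace_scaleC)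

lemma trace_diff: "A \<in> M \<Longrightarrow> B \<in> M \<Longrightarrow> \<tau> (A - B) = \<tau> A - \<tau> B"
  using trace_add [of A "(-1) *\<^sub>R B"] trace_scaleR [of B "-1"] scaleR_closed [of B "-1"] by simp

lemma trace_nonneg:
  assumes "B \<in> M" "nonneg_op B"
  shows "0 \<le> Re (\<tau> B)" "Im (\<tau> B) = 0"
proof -
  obtain S where S: "S \<in> M" "selfadj S" "S o\<^sub>L S = B"
    using square_root_closed assms by blast
  then have "\<tau> B \<in> \<real>\<^sub>\<ge>\<^sub>0"
    using trace_positive [OF S(1)] cadjoint_eq_self_iff [OF bounded [OF S(1)]] by simp
  then show "0 \<le> Re (\<tau> B)" "Im (\<tau> B) = 0" by (simp_all add: complex_nonneg_Reals_iff)
qed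

text \<open>
If $B = S^2$, then $\tau(BD) = \tau(SDS)$ and $SDS$ is positive.
\<close>

lemma trace_mult_nonneg:
  assumes B: "B \<in> M" "nonneg_op B" and D: "D \<in> M" "nonneg_op D"
  shows "0 \<le> Re (\<tau> (B o\<^sub>L D))"
proof -
  obtain S where S: "S \<in> M" "selfadj S" "S o\<^sub>L S = B"
    using square_root_closed B by blast
  have "\<tau> (B o\<^sub>L D) = \<tau> (S o\<^sub>L (S o\<^sub>L D))"
    by (rule arg_cong [where f = \<tau>]) (simp add: blinfun_eq_iff flip: S(3))
  also have "\<dots> = \<tau> ((S o\<^sub>L D) o\<^sub>L S)"
    using S D by (intro trace_tracial closed)
  finally have eq: "\<tau> (B o\<^sub>L D) = \<tau> ((S o\<^sub>L D) o\<^sub>L S)" .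
  have "nonneg_op ((S o\<^sub>L D) o\<^sub>L S)"
    unfolding nonneg_op_def
  proof (intro conjI allI)
    have "selfadj D" using D(2) by (simp add: nonneg_op_def)
    then show "selfadj ((S o\<^sub>L D) o\<^sub>L S)" using S(2) by (simp add: selfadj_def)
    have "inner (S (D (S x))) x = inner (D (S x)) (S x)" for x by (rule selfadjD [OF S(2)])
    then show "0 \<le> inner (((S o\<^sub>L D) o\<^sub>L S) x) x" for x
      using D(2) by (simp add: nonneg_op_def)
  qed
  then show ?thesis unfolding eq using S D by (intro trace_nonneg closed)
qed

text \<open>
$H + \|H\| \cdot 1$ is positive.
\<close>

lemma trace_selfadj_real:
  assumes H: "H \<in> M" "selfadj H"
  shows "Im (\<tau> H) = 0"
proof -
  have "nonneg_op (H + norm H *\<^sub>R id_blinfun)"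
    unfolding nonneg_op_def
  proof (intro conjI allI)
    show "selfadj (H + norm H *\<^sub>R id_blinfun)"
      by (rule selfadj_add [OF H(2) selfadj_scaleR [OF selfadj_id]])
    show "0 \<le> inner ((H + norm H *\<^sub>R id_blinfun) x) x" for x
      using abs_inner_le_norm [OF H(2), of x]
      by (simp add: blinfun.add_left blinfun.scaleR_left inner_add_left)
  qed
  then have "Im (\<tau> (H + norm H *\<^sub>R id_blinfun)) = 0"
    using H by (intro trace_nonneg closed)
  then show ?thesis using H by (simp add: trace_add trace_scaleR trace_unit closed)
qed

text \<open>
$A + A^*$ and $\mathrm{i}(A - A^*)$ are self-adjoint, hence have real traces.
\<close>

lemma trace_cadjoint:
  assumes A: "A \<in> M"
  shows "\<tau> (cadjoint A) = cnj (\<tau> A)"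
proof -
  let ?B = "cadjoint A"
  have B: "?B \<in> M" by (rule cadjoint_closed [OF A])
  have AB: "inner (A x) y = inner x (?B y)" for x y
    by (rule inner_cadjoint [OF bounded [OF A]])
  have BA: "inner (?B x) y = inner x (A y)" for x y
    using AB [of y x] by (simp add: inner_commute)
  have "selfadj (A + ?B)"
    by (simp add: selfadj_def blinfun.add_left inner_add_left inner_add_right AB BA)
  then have 1: "Im (\<tau> (A + ?B)) = 0"
    using A B by (intro trace_selfadj_real closed)
  have i: "inner (\<i> *\<^sub>C u) v = - inner u (\<i> *\<^sub>C v)" for u v :: 'h
    using Im_cinner [of u v] Im_cinner_right [of u v] by simp
  have "selfadj (\<i> *\<^sub>C (A - ?B))"
    unfolding selfadj_def
  proof (intro allI)
    fix x y
    have "inner ((\<i> *\<^sub>C (A - ?B)) x) y = inner x (A (\<i> *\<^sub>C y)) - inner x (?B (\<i> *\<^sub>C y))"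
      by (simp add: scaleC_apply i blinfun.diff_left inner_diff_left AB BA)
    also have "\<dots> = inner x (\<i> *\<^sub>C A y - \<i> *\<^sub>C ?B y)"
      by (simp add: bounded_opsD [OF bounded] A B inner_diff_right)
    also have "\<i> *\<^sub>C A y - \<i> *\<^sub>C ?B y = (\<i> *\<^sub>C (A - ?B)) y"
      using scaleC_add_right [of "\<i>" "A y - ?B y" "?B y"] by (simp add: scaleC_apply blinfun.diff_left)
    finally show "inner ((\<i> *\<^sub>C (A - ?B)) x) y = inner x ((\<i> *\<^sub>C (A - ?B)) y)" .
  qed
  then have 2: "Im (\<tau> (\<i> *\<^sub>C (A - ?B))) = 0"
    using A B by (intro trace_selfadj_real closed)
  show ?thesis
    using 1 2 A B by (simp add: trace_add trace_diff trace_scaleC closed complex_eq_iff)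
qed

section \<open>Majorization tested on effects\<close>

lemma effect_closed: "A \<in> effects M \<Longrightarrow> A \<in> M"
  by (simp add: effects_def)

lemma id_effect: "id_blinfun \<in> effects M"
  by (simp add: effects_def closed nonneg_op_def selfadj_def)

lemma compl_effect: "A \<in> effects M \<Longrightarrow> id_blinfun - A \<in> effects M"
  by (simp add: effects_def closed)

lemma projection_effect: "Q \<in> M \<Longrightarrow> projection Q \<Longrightarrow> Q \<in> effects M"
  using projectionD(1,6) [of Q] projectionD(1,6) [OF projection_compl [of Q]]
  by (auto simp: effects_def nonneg_op_def)

text \<open>
$\tau((X - c)_+)$, since $(X - c)_+ = (X - c)\,1_{(c,\infty)}(X)$.
\<close>

definition trace_positive_part :: "('h \<Rightarrow>\<^sub>L 'h) \<Rightarrow> real \<Rightarrow> real" where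
  "trace_positive_part X c = Re (\<tau> ((X - c *\<^sub>R id_blinfun) o\<^sub>L (id_blinfun - spectral_family X c)))"

lemma spectral_family_closed: "X \<in> selfadjoints M \<Longrightarrow> spectral_family X t \<in> M"
  using double_commutant_closed spectral_family_in_double_commutant selfadjoints_iff by blast

lemma trace_shift:
  assumes "X \<in> M" "A \<in> M"
  shows "\<tau> ((X - c *\<^sub>R id_blinfun) o\<^sub>L A) = \<tau> (X o\<^sub>L A) - c * \<tau> A"
proof -
  have "(X - c *\<^sub>R id_blinfun) o\<^sub>L A = (X o\<^sub>L A) - c *\<^sub>R A"
    by (simp add: blinfun_eq_iff blinfun.diff_left blinfun.scaleR_left)
  then show ?thesis using assms by (simp add: trace_diff trace_scaleR closed)
qed

lemma compose_diff_right: "X o\<^sub>L (A - B) = (X o\<^sub>L A) - (X o\<^sub>L B)"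
  for X :: "'h \<Rightarrow>\<^sub>L 'h"
  by (rule bounded_bilinear.diff_right [OF bounded_bilinear_blinfun_compose])

lemma compose_diff_left: "(A - B) o\<^sub>L X = (A o\<^sub>L X) - (B o\<^sub>L X)"
  for X :: "'h \<Rightarrow>\<^sub>L 'h"
  by (rule bounded_bilinear.diff_left [OF bounded_bilinear_blinfun_compose])

lemma compose_id_left: "id_blinfun o\<^sub>L A = A" and compose_id_right: "A o\<^sub>L id_blinfun = A"
  for A :: "'h \<Rightarrow>\<^sub>L 'h"
  by (simp_all add: blinfun_eq_iff)

text \<open>
With $P = 1_{(c,\infty)}(X)$ and $Y = X - c$, both $YP$ and $-Y(1 - P)$ are positive, and
$YP - YA = (YP)(1 - A) + (-Y(1 - P))A$ has nonnegative trace as a sum of products of positive elements.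
So $\tau((X - c)_+)$ is a maximum of functions that are affine in \<open>X\<close>.
\<close>

lemma trace_positive_part_max:
  assumes X: "X \<in> selfadjoints M" and A: "A \<in> effects M"
  shows "Re (\<tau> ((X - c *\<^sub>R id_blinfun) o\<^sub>L A)) \<le> trace_positive_part X c"
proof -
  have XM: "X \<in> M" and sa: "selfadj X" using X by (simp_all add: selfadjoints_iff)
  let ?Q = "spectral_family X c" and ?Y = "X - c *\<^sub>R id_blinfun"
  let ?P = "id_blinfun - ?Q"
  have Q: "projection ?Q" "?Q \<in> M" by (auto intro: projection_spectral_family sa spectral_family_closed X)
  have P: "projection ?P" by (rule projection_compl [OF Q(1)])
  have Y: "?Y \<in> M" and Ysa: "selfadj ?Y"
    using XM sa by (auto intro: closed selfadj_diff selfadj_scaleR selfadj_id)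
  have QY: "?Q (?Y x) = ?Y (?Q x)" for x
    by (rule spectral_family_commute [OF sa])
      (simp add: blinfun_eq_iff blinfun.diff_left blinfun.diff_right blinfun.scaleR_left blinfun.scaleR_right)
  have PY: "?P (?Y x) = ?Y (?P x)" for x
    using QY [of x] by (simp add: blinfun.diff_left [of id_blinfun] blinfun.diff_right [of ?Y])
  have nonneg: "nonneg_op (Z o\<^sub>L R)"
    if R: "projection R" and Z: "selfadj Z" "\<And>x. R (Z x) = Z (R x)" "\<And>x. 0 \<le> inner (Z (R x)) (R x)"
    for Z R :: "'h \<Rightarrow>\<^sub>L 'h"
    unfolding nonneg_op_def
  proof (intro conjI allI)
    show "selfadj (Z o\<^sub>L R)"
      by (simp add: selfadj_def selfadjD [OF Z(1)] projectionD(4) [OF R] flip: Z(2))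
    show "0 \<le> inner ((Z o\<^sub>L R) x) x" for x
      using Z(3) [of x] projectionD(4) [OF R, of "Z (R x)" x]
        projectionD(4) [OF R, of "Z x" "R x"]
      by (simp add: Z(2) [symmetric] projectionD(2,4) [OF R])
  qed
  have pos: "nonneg_op (?Y o\<^sub>L ?P)"
  proof (rule nonneg [OF P Ysa PY])
    fix x
    have "?Q (?P x) = 0" by (simp add: blinfun.diff_left blinfun.diff_right projectionD(2) [OF Q(1)])
    then show "0 \<le> inner (?Y (?P x)) (?P x)"
      using spectral_family_gt [OF sa, of c "?P x"]
      by (cases "?P x = 0") (auto simp: blinfun.diff_left [of X] blinfun.scaleR_left inner_diff_left [of "X _"])
  qed
  have neg: "nonneg_op ((- ?Y) o\<^sub>L ?Q)"
  proof (rule nonneg [OF Q(1)])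
    show "selfadj (- ?Y)" using selfadj_scaleR [OF Ysa, of "-1"] by simp
    show "?Q ((- ?Y) x) = (- ?Y) (?Q x)" for x
      using QY [of x] by (simp only: blinfun.minus_left blinfun.minus_right)
    show "0 \<le> inner ((- ?Y) (?Q x)) (?Q x)" for x
      using spectral_family_le [OF sa, of c x]
      by (simp only: blinfun.minus_left) (simp add: blinfun.diff_left blinfun.scaleR_left inner_diff_left)
  qed
  have YP: "?Y o\<^sub>L ?P \<in> M" and mYQ: "(- ?Y) o\<^sub>L ?Q \<in> M"
    using Y Q closed scaleR_closed [OF Y, of "-1"] by auto
  have AM: "A \<in> M" "nonneg_op A" "nonneg_op (id_blinfun - A)" using A by (auto simp: effects_def)
  have "0 \<le> Re (\<tau> ((?Y o\<^sub>L ?P) o\<^sub>L (id_blinfun - A)))"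
    by (intro trace_mult_nonneg YP pos AM closed)
  moreover have "0 \<le> Re (\<tau> (((- ?Y) o\<^sub>L ?Q) o\<^sub>L A))"
    by (intro trace_mult_nonneg mYQ neg AM)
  ultimately have "0 \<le> Re (\<tau> (((?Y o\<^sub>L ?P) o\<^sub>L (id_blinfun - A)) + (((- ?Y) o\<^sub>L ?Q) o\<^sub>L A)))"
    unfolding trace_add [OF compose_closed [OF YP diff_closed [OF id_closed AM(1)]]
        compose_closed [OF mYQ AM(1)]] by simp
  also have "((?Y o\<^sub>L ?P) o\<^sub>L (id_blinfun - A)) + (((- ?Y) o\<^sub>L ?Q) o\<^sub>L A) = (?Y o\<^sub>L ?P) - (?Y o\<^sub>L A)"
    by (rule blinfun_eqI) (simp add: blinfun.diff_left blinfun.diff_right blinfun.add_left blinfun.minus_left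
        blinfun.scaleR_left algebra_simps)
  finally show ?thesis
    using Y YP AM by (simp add: trace_positive_part_def trace_diff closed)
qed

lemma trace_positive_part_attained:
  assumes "X \<in> selfadjoints M"
  obtains A where "A \<in> effects M" "trace_positive_part X c = Re (\<tau> ((X - c *\<^sub>R id_blinfun) o\<^sub>L A))"
proof (rule that)
  show "id_blinfun - spectral_family X c \<in> effects M"
    using assms projection_spectral_family selfadjoints_iff
    by (intro compl_effect projection_effect spectral_family_closed) auto
qed (simp add: trace_positive_part_def)

text \<open>
The maximum property, tested on the spectral projection at \<open>d\<close>, is the subgradient inequality of
\<open>legendre_transform_quantile\<close>. At \<open>t = 1\<close> the minimum of
$\tau((X - c)_+) + c$ is attained at all small \<open>c\<close>, where $(X - c)_+ = X - c$.
\<close>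

lemma integral_eigenvalue_function:
  assumes X: "X \<in> selfadjoints M" and t: "t \<in> {0..1}"
  defines "H \<equiv> (LBINT s:{0..t}. eigenvalue_function \<tau> X s)"
  shows "H \<le> trace_positive_part X c + c * t" and "\<exists>c. H = trace_positive_part X c + c * t"
    and "t = 1 \<Longrightarrow> H = Re (\<tau> X)"
proof -
  have XM: "X \<in> M" and sa: "selfadj X" using X by (simp_all add: selfadjoints_iff)
  define F where "F c = Re (\<tau> (id_blinfun - spectral_family X c))" for c
  have eff: "id_blinfun - spectral_family X c \<in> effects M" "spectral_family X c \<in> effects M" for c
    using X projection_spectral_family [OF sa]
    by (auto intro!: compl_effect projection_effect spectral_family_closed)
  note clo = effect_closed [OF eff(1)] effect_closed [OF eff(2)]
  have ev: "eigenvalue_function \<tau> X s = Inf {c. F c \<le> s}" for s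
    by (simp add: eigenvalue_function_def F_def spectral_projection_ray [OF bounded [OF XM] sa])
  have sub: "(d - c) * F d \<le> trace_positive_part X c - trace_positive_part X d" for c d
  proof -
    have "trace_positive_part X d + (d - c) * F d = Re (\<tau> ((X - c *\<^sub>R id_blinfun) o\<^sub>L (id_blinfun - spectral_family X d)))"
      unfolding trace_positive_part_def F_def trace_shift [OF XM clo(1)] by (simp add: algebra_simps)
    also have "\<dots> \<le> trace_positive_part X c" by (rule trace_positive_part_max [OF X eff(1)])
    finally show ?thesis by simp
  qed
  have F0: "0 \<le> F c" for c
    using eff(1) [of c] unfolding F_def effects_def by (auto intro: trace_nonneg(1))
  have "0 \<le> Re (\<tau> (spectral_family X c))" for c
    using eff(2) [of c] unfolding effects_def by (auto intro: trace_nonneg(1))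
  then have F1: "F c \<le> 1" for c
    unfolding F_def trace_diff [OF id_closed clo(2)] by (simp add: trace_unit)
  have zero: "\<tau> 0 = 0" using trace_scaleR [OF id_closed, of 0] by simp
  have low: "F c = 1" if "c < - norm X" for c
    using spectral_family_bot [OF sa that] by (simp add: F_def trace_unit)
  have high: "F c = 0" "trace_positive_part X c = 0" if "norm X \<le> c" for c
    using spectral_family_top [OF sa that] by (simp_all add: F_def trace_positive_part_def zero)
  note L = legendre_transform_quantile [of F "trace_positive_part X", OF sub F0 F1 norm_ge_zero low high(1)
      high(2) [OF order_refl] t]
  show le: "H \<le> trace_positive_part X c + c * t" for c
    unfolding H_def ev by (rule L)
  show ex: "\<exists>c. H = trace_positive_part X c + c * t"
    unfolding H_def ev by (rule L)
  show "H = Re (\<tau> X)" if "t = 1"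
  proof (rule antisym)
    define c where "c = - norm X - 1"
    have "trace_positive_part X c = Re (\<tau> X) - c"
      using spectral_family_bot [OF sa, of c] trace_shift [OF XM id_closed, of c]
      by (simp add: trace_positive_part_def c_def trace_unit compose_id_right)
    then show "H \<le> Re (\<tau> X)" using le [of c] that by simp
    obtain c where c: "H = trace_positive_part X c + c * t" using ex by blast
    have "Re (\<tau> X) - c \<le> trace_positive_part X c"
      using trace_positive_part_max [OF X id_effect, of c] trace_shift [OF XM id_closed, of c]
      by (simp add: trace_unit compose_id_right)
    then show "Re (\<tau> X) \<le> H" using c that by simp
  qed
qed

text \<open>
The Legendre transform inverted: at $t = \tau(1_{(c,\infty)}(X))$ the minimum over \<open>c\<close> is attained
at the given \<open>c\<close>.
\<close>

lemma trace_positive_part_eq_integral: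
  assumes X: "X \<in> selfadjoints M"
  shows "\<exists>t\<in>{0..1}. trace_positive_part X c = (LBINT s:{0..t}. eigenvalue_function \<tau> X s) - c * t"
proof -
  have XM: "X \<in> M" and sa: "selfadj X" using X by (simp_all add: selfadjoints_iff)
  let ?P = "id_blinfun - spectral_family X c"
  define t where "t = Re (\<tau> ?P)"
  have eff: "?P \<in> effects M" "spectral_family X c \<in> effects M"
    using X projection_spectral_family [OF sa]
    by (auto intro!: compl_effect projection_effect spectral_family_closed)
  have "0 \<le> Re (\<tau> (spectral_family X c))" "0 \<le> t"
    using eff unfolding effects_def t_def by (auto intro: trace_nonneg(1))
  then have t: "t \<in> {0..1}"
    unfolding t_def trace_diff [OF id_closed effect_closed [OF eff(2)]] by (simp add: trace_unit)
  obtain d where d: "(LBINT s:{0..t}. eigenvalue_function \<tau> X s) = trace_positive_part X d + d * t"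
    using integral_eigenvalue_function(2) [OF X t] by blast
  have "trace_positive_part X c + (c - d) * t = Re (\<tau> ((X - d *\<^sub>R id_blinfun) o\<^sub>L ?P))"
    unfolding trace_positive_part_def t_def trace_shift [OF XM effect_closed [OF eff(1)]] by (simp add: algebra_simps)
  also have "\<dots> \<le> trace_positive_part X d" by (rule trace_positive_part_max [OF X eff(1)])
  finally have "trace_positive_part X c = (LBINT s:{0..t}. eigenvalue_function \<tau> X s) - c * t"
    using integral_eigenvalue_function(1) [OF X t, of c] d by (simp add: algebra_simps)
  then show ?thesis using t by blast
qed

lemma majorized_by_iff_trace_positive_part:
  assumes X: "X \<in> selfadjoints M" and C: "C \<in> selfadjoints M"
  shows "eigenvalue_function \<tau> X majorized_by eigenvalue_function \<tau> C \<longleftrightarrow>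
    \<tau> X = \<tau> C \<and> (\<forall>c. trace_positive_part X c \<le> trace_positive_part C c)"
proof
  assume maj: "eigenvalue_function \<tau> X majorized_by eigenvalue_function \<tau> C"
  have "Re (\<tau> X) = Re (\<tau> C)"
    using maj integral_eigenvalue_function(3) [OF X, of 1] integral_eigenvalue_function(3) [OF C, of 1]
    by (simp add: majorized_by_def)
  then have "\<tau> X = \<tau> C"
    using X C trace_selfadj_real by (simp add: complex_eq_iff selfadjoints_iff)
  moreover have "trace_positive_part X c \<le> trace_positive_part C c" for c
  proof -
    obtain t where t: "t \<in> {0..1}"
      "trace_positive_part X c = (LBINT s:{0..t}. eigenvalue_function \<tau> X s) - c * t"
      using trace_positive_part_eq_integral [OF X] by blast
    then show ?thesis
      using maj integral_eigenvalue_function(1) [OF C t(1), of c]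
      unfolding majorized_by_def by fastforce
  qed
  ultimately show "\<tau> X = \<tau> C \<and> (\<forall>c. trace_positive_part X c \<le> trace_positive_part C c)" by blast
next
  assume R: "\<tau> X = \<tau> C \<and> (\<forall>c. trace_positive_part X c \<le> trace_positive_part C c)"
  show "eigenvalue_function \<tau> X majorized_by eigenvalue_function \<tau> C"
    unfolding majorized_by_def
  proof (intro conjI ballI)
    fix t :: real assume t: "t \<in> {0..1}"
    obtain c where "(LBINT s:{0..t}. eigenvalue_function \<tau> C s) = trace_positive_part C c + c * t"
      using integral_eigenvalue_function(2) [OF C t] by blast
    moreover have "trace_positive_part X c \<le> trace_positive_part C c" using R by blast
    ultimately show "(LBINT s:{0..t}. eigenvalue_function \<tau> X s) \<le> (LBINT s:{0..t}. eigenvalue_function \<tau> C s)"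
      using integral_eigenvalue_function(1) [OF X t, of c] by linarith
  qed (use R integral_eigenvalue_function(3) [OF X, of 1] integral_eigenvalue_function(3) [OF C, of 1] in simp)
qed

text \<open>
Eigenvalue functions are eliminated here: since $\tau((X - c)_+)$ is the maximum of
$\mathrm{Re}\,\tau((X - c)A)$ over the effects \<open>A\<close>, majorization becomes a condition in which \<open>X\<close> enters
only through linear functionals.
\<close>

lemma majorized_by_iff:
  assumes X: "X \<in> selfadjoints M" and C: "C \<in> selfadjoints M"
  shows "eigenvalue_function \<tau> X majorized_by eigenvalue_function \<tau> C \<longleftrightarrow>
    \<tau> X = \<tau> C \<and> (\<forall>c. \<forall>A\<in>effects M. \<exists>B\<in>effects M.
      Re (\<tau> (X o\<^sub>L A)) - c * Re (\<tau> A) \<le> Re (\<tau> (C o\<^sub>L B)) - c * Re (\<tau> B))"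
proof -
  have shift: "Re (\<tau> ((Y - c *\<^sub>R id_blinfun) o\<^sub>L A)) = Re (\<tau> (Y o\<^sub>L A)) - c * Re (\<tau> A)"
    if "Y \<in> selfadjoints M" "A \<in> effects M" for Y A c
    using that trace_shift [of Y A c] effect_closed by (simp add: selfadjoints_iff)
  have "trace_positive_part X c \<le> trace_positive_part C c \<longleftrightarrow> (\<forall>A\<in>effects M. \<exists>B\<in>effects M.
      Re (\<tau> (X o\<^sub>L A)) - c * Re (\<tau> A) \<le> Re (\<tau> (C o\<^sub>L B)) - c * Re (\<tau> B))" for c
  proof
    assume le: "trace_positive_part X c \<le> trace_positive_part C c"
    obtain B where B: "B \<in> effects M" "trace_positive_part C c = Re (\<tau> ((C - c *\<^sub>R id_blinfun) o\<^sub>L B))"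
      using trace_positive_part_attained [OF C] .
    show "\<forall>A\<in>effects M. \<exists>B\<in>effects M.
        Re (\<tau> (X o\<^sub>L A)) - c * Re (\<tau> A) \<le> Re (\<tau> (C o\<^sub>L B)) - c * Re (\<tau> B)"
    proof (intro ballI bexI [OF _ B(1)])
      fix A assume A: "A \<in> effects M"
      show "Re (\<tau> (X o\<^sub>L A)) - c * Re (\<tau> A) \<le> Re (\<tau> (C o\<^sub>L B)) - c * Re (\<tau> B)"
        using trace_positive_part_max [OF X A, of c] le B(2) by (simp only: shift X C A B(1))
    qed
  next
    assume R: "\<forall>A\<in>effects M. \<exists>B\<in>effects M.
        Re (\<tau> (X o\<^sub>L A)) - c * Re (\<tau> A) \<le> Re (\<tau> (C o\<^sub>L B)) - c * Re (\<tau> B)"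
    obtain A where A: "A \<in> effects M" "trace_positive_part X c = Re (\<tau> ((X - c *\<^sub>R id_blinfun) o\<^sub>L A))"
      using trace_positive_part_attained [OF X] .
    then obtain B where B: "B \<in> effects M"
      "Re (\<tau> (X o\<^sub>L A)) - c * Re (\<tau> A) \<le> Re (\<tau> (C o\<^sub>L B)) - c * Re (\<tau> B)"
      using R by blast
    show "trace_positive_part X c \<le> trace_positive_part C c"
      using trace_positive_part_max [OF C B(1), of c] A(2) B(2) by (simp only: shift X C A(1) B(1))
  qed
  then show ?thesis unfolding majorized_by_iff_trace_positive_part [OF X C] by simp
qed

definition majorized_set :: "('h \<Rightarrow>\<^sub>L 'h) \<Rightarrow> ('h \<Rightarrow>\<^sub>L 'h) set" where
  "majorized_set C = {X \<in> selfadjoints M. eigenvalue_function \<tau> X majorized_by eigenvalue_function \<tau> C}"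

lemma majorized_set_iff:
  assumes "C \<in> selfadjoints M"
  shows "X \<in> majorized_set C \<longleftrightarrow> X \<in> selfadjoints M \<and> \<tau> X = \<tau> C \<and>
    (\<forall>c. \<forall>A\<in>effects M. \<exists>B\<in>effects M.
      Re (\<tau> (X o\<^sub>L A)) - c * Re (\<tau> A) \<le> Re (\<tau> (C o\<^sub>L B)) - c * Re (\<tau> B))"
  using majorized_by_iff [OF _ assms, of X] by (auto simp: majorized_set_def)

lemma C_numerical_range_image: "C_numerical_range M \<tau> C T = (\<lambda>X. \<tau> (T o\<^sub>L X)) ` majorized_set C"
  by (auto simp: C_numerical_range_def majorized_set_def)

lemma majorized_set_self: "C \<in> selfadjoints M \<Longrightarrow> C \<in> majorized_set C"
  by (auto simp: majorized_set_def majorized_by_def)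

lemma selfadjoints_closed:
  "X \<in> selfadjoints M \<Longrightarrow> Y \<in> selfadjoints M \<Longrightarrow> X + Y \<in> selfadjoints M"
  "X \<in> selfadjoints M \<Longrightarrow> r *\<^sub>R X \<in> selfadjoints M"
  "id_blinfun \<in> selfadjoints M"
  by (auto simp: selfadjoints_iff closed selfadj_add selfadj_scaleR selfadj_id)

lemma trace_lincomb_left:
  assumes "X \<in> M" "Y \<in> M" "A \<in> M"
  shows "\<tau> ((u *\<^sub>R X + v *\<^sub>R Y) o\<^sub>L A) = u * \<tau> (X o\<^sub>L A) + v * \<tau> (Y o\<^sub>L A)"
proof -
  have "(u *\<^sub>R X + v *\<^sub>R Y) o\<^sub>L A = u *\<^sub>R (X o\<^sub>L A) + v *\<^sub>R (Y o\<^sub>L A)"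
    by (simp add: blinfun_eq_iff blinfun.add_left blinfun.scaleR_left)
  then show ?thesis using assms by (simp add: trace_add trace_scaleR closed)
qed

lemma trace_lincomb_right:
  assumes "X \<in> M" "Y \<in> M" "A \<in> M"
  shows "\<tau> (A o\<^sub>L (u *\<^sub>R X + v *\<^sub>R Y)) = u * \<tau> (A o\<^sub>L X) + v * \<tau> (A o\<^sub>L Y)"
proof -
  have "A o\<^sub>L (u *\<^sub>R X + v *\<^sub>R Y) = u *\<^sub>R (A o\<^sub>L X) + v *\<^sub>R (A o\<^sub>L Y)"
    by (simp add: blinfun_eq_iff blinfun.add_left blinfun.scaleR_left blinfun.add_right blinfun.scaleR_right)
  then show ?thesis using assms by (simp add: trace_add trace_scaleR closed)
qed

text \<open>
Of the two effects that dominate \<open>X\<close> and \<open>Y\<close>, the one with the larger value dominates the convex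
combination.
\<close>

lemma majorized_set_convex:
  assumes C: "C \<in> selfadjoints M"
    and X: "X \<in> majorized_set C" and Y: "Y \<in> majorized_set C"
    and uv: "0 \<le> u" "0 \<le> v" "u + v = 1"
  shows "u *\<^sub>R X + v *\<^sub>R Y \<in> majorized_set C"
  unfolding majorized_set_iff [OF C]
proof (intro conjI allI ballI)
  have XY: "X \<in> M" "Y \<in> M" "X \<in> selfadjoints M" "Y \<in> selfadjoints M"
    using X Y by (auto simp: majorized_set_def selfadjoints_iff)
  then show "u *\<^sub>R X + v *\<^sub>R Y \<in> selfadjoints M" by (simp add: selfadjoints_closed)
  have "\<tau> (u *\<^sub>R X + v *\<^sub>R Y) = complex_of_real (u + v) * \<tau> C"
    using XY X Y by (simp add: majorized_set_iff [OF C] trace_add trace_scaleR closed distrib_right)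
  then show "\<tau> (u *\<^sub>R X + v *\<^sub>R Y) = \<tau> C" by (simp add: uv)
  fix c A assume A: "A \<in> effects M"
  define g where "g Z B = Re (\<tau> (Z o\<^sub>L B)) - c * Re (\<tau> B)" for Z B
  obtain B1 B2 where B: "B1 \<in> effects M" "B2 \<in> effects M" "g X A \<le> g C B1" "g Y A \<le> g C B2"
    using X Y A unfolding majorized_set_iff [OF C] g_def by blast
  define B where "B = (if g C B1 \<le> g C B2 then B2 else B1)"
  have "g (u *\<^sub>R X + v *\<^sub>R Y) A = u * g X A + v * g Y A + (u + v - 1) * c * Re (\<tau> A)"
    unfolding g_def trace_lincomb_left [OF XY(1,2) effect_closed [OF A]] by (simp add: algebra_simps)
  also have "\<dots> \<le> g C B"
    using B uv by (auto intro!: convex_bound_le simp: B_def)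
  finally show "\<exists>B\<in>effects M. Re (\<tau> ((u *\<^sub>R X + v *\<^sub>R Y) o\<^sub>L A)) - c * Re (\<tau> A)
      \<le> Re (\<tau> (C o\<^sub>L B)) - c * Re (\<tau> B)"
    using B(1,2) unfolding g_def B_def by (auto split: if_splits)
qed

text \<open>
For \<open>a < 0\<close> replace the effects by their complements; the terms without an effect cancel because
$\tau(X) = \tau(C)$.
\<close>

lemma majorized_set_affine:
  assumes C: "C \<in> selfadjoints M" and X: "X \<in> majorized_set C"
  shows "a *\<^sub>R X + b *\<^sub>R id_blinfun \<in> majorized_set (a *\<^sub>R C + b *\<^sub>R id_blinfun)"
proof -
  have XM: "X \<in> M" "X \<in> selfadjoints M" "C \<in> M"
    using X C by (auto simp: majorized_set_def selfadjoints_iff)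
  have C': "a *\<^sub>R C + b *\<^sub>R id_blinfun \<in> selfadjoints M" by (intro selfadjoints_closed C)
  have tr: "\<tau> X = \<tau> C" using X by (simp add: majorized_set_iff [OF C])
  have aff: "Re (\<tau> ((a *\<^sub>R Z + b *\<^sub>R id_blinfun) o\<^sub>L A)) = a * Re (\<tau> (Z o\<^sub>L A)) + b * Re (\<tau> A)"
    if "Z \<in> M" "A \<in> effects M" for Z A
    using trace_lincomb_left [OF that(1) id_closed effect_closed [OF that(2)]] by (simp add: compose_id_left)
  show ?thesis
    unfolding majorized_set_iff [OF C']
  proof (intro conjI allI ballI)
    show "a *\<^sub>R X + b *\<^sub>R id_blinfun \<in> selfadjoints M" by (intro selfadjoints_closed XM)
    show "\<tau> (a *\<^sub>R X + b *\<^sub>R id_blinfun) = \<tau> (a *\<^sub>R C + b *\<^sub>R id_blinfun)"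
      using XM by (simp add: trace_add trace_scaleR closed tr)
    fix c A assume A: "A \<in> effects M"
    consider "a = 0" | "0 < a" | "a < 0" by linarith
    then show "\<exists>B\<in>effects M. Re (\<tau> ((a *\<^sub>R X + b *\<^sub>R id_blinfun) o\<^sub>L A)) - c * Re (\<tau> A)
        \<le> Re (\<tau> ((a *\<^sub>R C + b *\<^sub>R id_blinfun) o\<^sub>L B)) - c * Re (\<tau> B)"
    proof cases
      case 1
      then show ?thesis using A by auto
    next
      case 2
      define d where "d = (c - b) / a"
      have c: "c = a * d + b" using 2 by (simp add: d_def)
      obtain B where B: "B \<in> effects M"
        "Re (\<tau> (X o\<^sub>L A)) - d * Re (\<tau> A) \<le> Re (\<tau> (C o\<^sub>L B)) - d * Re (\<tau> B)"
        using X A unfolding majorized_set_iff [OF C] by blast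
      have "a * (Re (\<tau> (X o\<^sub>L A)) - d * Re (\<tau> A)) \<le> a * (Re (\<tau> (C o\<^sub>L B)) - d * Re (\<tau> B))"
        using B(2) 2 by (intro mult_left_mono) auto
      then have "Re (\<tau> ((a *\<^sub>R X + b *\<^sub>R id_blinfun) o\<^sub>L A)) - c * Re (\<tau> A)
          \<le> Re (\<tau> ((a *\<^sub>R C + b *\<^sub>R id_blinfun) o\<^sub>L B)) - c * Re (\<tau> B)"
        by (simp add: aff [OF XM(1) A] aff [OF XM(3) B(1)] c algebra_simps)
      then show ?thesis using B(1) by blast
    next
      case 3
      define d where "d = (c - b) / a"
      have c: "c = a * d + b" using 3 by (simp add: d_def)
      let ?A = "id_blinfun - A"
      have A': "?A \<in> effects M" by (rule compl_effect [OF A])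
      obtain B where B: "B \<in> effects M"
        "Re (\<tau> (X o\<^sub>L ?A)) - d * Re (\<tau> ?A) \<le> Re (\<tau> (C o\<^sub>L B)) - d * Re (\<tau> B)"
        using X A' unfolding majorized_set_iff [OF C] by blast
      let ?B = "id_blinfun - B"
      have B': "?B \<in> effects M" by (rule compl_effect [OF B(1)])
      have compl: "\<tau> (Z o\<^sub>L (id_blinfun - D)) = \<tau> Z - \<tau> (Z o\<^sub>L D)" "\<tau> (id_blinfun - D) = 1 - \<tau> D"
        if "Z \<in> M" "D \<in> effects M" for Z D
        using that effect_closed
        by (simp_all add: compose_diff_right compose_id_right trace_diff trace_unit closed)
      have "a * (Re (\<tau> (C o\<^sub>L B)) - d * Re (\<tau> B)) \<le> a * (Re (\<tau> (X o\<^sub>L ?A)) - d * Re (\<tau> ?A))"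
        using B(2) 3 by (intro mult_left_mono_neg) auto
      then have "Re (\<tau> ((a *\<^sub>R X + b *\<^sub>R id_blinfun) o\<^sub>L A)) - c * Re (\<tau> A)
          \<le> Re (\<tau> ((a *\<^sub>R C + b *\<^sub>R id_blinfun) o\<^sub>L ?B)) - c * Re (\<tau> ?B)"
        unfolding aff [OF XM(1) A] aff [OF XM(3) B'] c
        by (simp add: compl [OF XM(1) A] compl [OF XM(3) B(1)] tr algebra_simps)
      then show ?thesis using B' by blast
    qed
  qed
qed

lemma compose_assoc: "(A o\<^sub>L B) o\<^sub>L D = A o\<^sub>L (B o\<^sub>L D)" for A B D :: "'h \<Rightarrow>\<^sub>L 'h"
  by (simp add: blinfun_eq_iff)

lemma unitaryD:
  assumes "U \<in> unitaries M"
  shows "U \<in> M" "cadjoint U \<in> M" "cadjoint U o\<^sub>L U = id_blinfun" "U o\<^sub>L cadjoint U = id_blinfun"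
    "inner (U x) y = inner x (cadjoint U y)" "cadjoint (cadjoint U) = U" "cadjoint U \<in> unitaries M"
proof -
  show U: "U \<in> M" "cadjoint U \<in> M" "cadjoint U o\<^sub>L U = id_blinfun" "U o\<^sub>L cadjoint U = id_blinfun"
    using assms cadjoint_closed by (auto simp: unitaries_def)
  show adj: "inner (U x) y = inner x (cadjoint U y)" for x y
    by (rule inner_cadjoint [OF bounded [OF U(1)]])
  show "cadjoint (cadjoint U) = U"
    using adj by (intro cadjoint_eqI cinner_eq_if_inner_eq bounded U) (metis inner_commute)
  then show "cadjoint U \<in> unitaries M" using U by (simp add: unitaries_def)
qed

lemma unitary_conj_nonneg:
  assumes U: "U \<in> unitaries M" and A: "nonneg_op A"
  shows "nonneg_op (cadjoint U o\<^sub>L (A o\<^sub>L U))"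
proof -
  have adj: "inner (cadjoint U x) y = inner x (U y)" for x y
    using unitaryD(5) [OF U, of y x] by (simp add: inner_commute)
  show ?thesis
    unfolding nonneg_op_def
  proof (intro conjI allI)
    show "selfadj (cadjoint U o\<^sub>L (A o\<^sub>L U))"
      using A by (simp add: nonneg_op_def selfadj_def adj unitaryD(5) [OF U])
    have "inner (cadjoint U (A (U x))) x = inner (A (U x)) (U x)" for x by (rule adj)
    then show "0 \<le> inner ((cadjoint U o\<^sub>L (A o\<^sub>L U)) x) x" for x
      using A by (simp add: nonneg_op_def)
  qed
qed

lemma unitary_conj_effect:
  assumes U: "U \<in> unitaries M" and A: "A \<in> effects M"
  shows "cadjoint U o\<^sub>L (A o\<^sub>L U) \<in> effects M"
proof -
  have "id_blinfun - (cadjoint U o\<^sub>L (A o\<^sub>L U)) = cadjoint U o\<^sub>L ((id_blinfun - A) o\<^sub>L U)"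
    using unitaryD(3) [OF U] by (simp add: compose_diff_left compose_diff_right compose_id_left)
  then show ?thesis
    using A unitary_conj_nonneg [OF U] unitaryD [OF U] by (simp add: effects_def closed)
qed

text \<open>
Conjugation moves from \<open>X\<close> to the test effect by the trace property.
\<close>

lemma majorized_set_unitary_conj:
  assumes U: "U \<in> unitaries M" and C: "C \<in> selfadjoints M" and X: "X \<in> majorized_set C"
  shows "U o\<^sub>L (X o\<^sub>L cadjoint U) \<in> majorized_set C"
  unfolding majorized_set_iff [OF C]
proof (intro conjI allI ballI)
  note u = unitaryD [OF U]
  let ?W = "cadjoint U"
  have XM: "X \<in> M" "selfadj X" using X by (auto simp: majorized_set_def selfadjoints_iff)
  have adj: "inner (?W x) y = inner x (U y)" for x y
    using u(5) [of y x] by (simp add: inner_commute)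
  show "U o\<^sub>L (X o\<^sub>L ?W) \<in> selfadjoints M"
    using XM u(1,2) by (simp add: selfadjoints_iff closed selfadj_def adj u(5))
  have "\<tau> (U o\<^sub>L (X o\<^sub>L ?W)) = \<tau> ((X o\<^sub>L ?W) o\<^sub>L U)"
    using XM u(1,2) by (intro trace_tracial closed)
  then show "\<tau> (U o\<^sub>L (X o\<^sub>L ?W)) = \<tau> C"
    using X by (simp add: compose_assoc u(3) compose_id_right majorized_set_iff [OF C])
  fix c A assume A: "A \<in> effects M"
  let ?A = "?W o\<^sub>L (A o\<^sub>L U)"
  have A': "?A \<in> effects M" by (rule unitary_conj_effect [OF U A])
  then obtain B where B: "B \<in> effects M"
    "Re (\<tau> (X o\<^sub>L ?A)) - c * Re (\<tau> ?A) \<le> Re (\<tau> (C o\<^sub>L B)) - c * Re (\<tau> B)"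
    using X unfolding majorized_set_iff [OF C] by blast
  have AM: "A \<in> M" by (rule effect_closed [OF A])
  have "\<tau> (U o\<^sub>L (X o\<^sub>L (?W o\<^sub>L A))) = \<tau> ((X o\<^sub>L (?W o\<^sub>L A)) o\<^sub>L U)"
    using XM u(1,2) AM by (intro trace_tracial closed)
  then have 1: "\<tau> ((U o\<^sub>L (X o\<^sub>L ?W)) o\<^sub>L A) = \<tau> (X o\<^sub>L ?A)" by (simp add: compose_assoc)
  have "\<tau> ?A = \<tau> ((A o\<^sub>L U) o\<^sub>L ?W)"
    using u(1,2) AM by (intro trace_tracial closed)
  then have 2: "\<tau> ?A = \<tau> A" by (simp add: compose_assoc u(4) compose_id_right)
  show "\<exists>B\<in>effects M. Re (\<tau> ((U o\<^sub>L (X o\<^sub>L ?W)) o\<^sub>L A)) - c * Re (\<tau> A)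
      \<le> Re (\<tau> (C o\<^sub>L B)) - c * Re (\<tau> B)"
    using B unfolding 1 2 by blast
qed

text \<open>
If $Y = X - b$, majorization gives $\mathrm{Re}\,\tau(YA) \le 0$ for every effect. The effect
$A = rY + \frac12$ with small $r > 0$ turns this into $\tau(Y^2) \le 0$, because $\tau(Y) = 0$, and
faithfulness gives $Y = 0$.
\<close>

lemma majorized_set_scalar:
  assumes X: "X \<in> majorized_set (b *\<^sub>R id_blinfun)"
  shows "X = b *\<^sub>R id_blinfun"
proof -
  have b: "b *\<^sub>R id_blinfun \<in> selfadjoints M" by (intro selfadjoints_closed)
  note X' = X [unfolded majorized_set_iff [OF b]]
  have XM: "X \<in> M" "selfadj X" using X' by (auto simp: selfadjoints_iff)
  define Y where "Y = X - b *\<^sub>R id_blinfun"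
  have Y: "Y \<in> M" "selfadj Y"
    using XM b by (auto simp: Y_def selfadjoints_iff intro: closed selfadj_diff)
  have le: "Re (\<tau> (Y o\<^sub>L A)) \<le> 0" if A: "A \<in> effects M" for A
  proof -
    obtain B where B: "B \<in> effects M" "Re (\<tau> (X o\<^sub>L A)) - b * Re (\<tau> A)
        \<le> Re (\<tau> ((b *\<^sub>R id_blinfun) o\<^sub>L B)) - b * Re (\<tau> B)"
      using X' A by blast
    have "(b *\<^sub>R id_blinfun) o\<^sub>L B = b *\<^sub>R B" by (simp add: blinfun_eq_iff blinfun.scaleR_left)
    then have "Re (\<tau> (X o\<^sub>L A)) - b * Re (\<tau> A) \<le> 0"
      using B by (simp add: trace_scaleR effect_closed)
    then show ?thesis
      unfolding Y_def trace_shift [OF XM(1) effect_closed [OF A]] by simp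
  qed
  have trY: "\<tau> Y = 0" using X' XM b by (simp add: Y_def trace_diff selfadjoints_iff)
  \<comment> \<open>With this factor the spectrum of \<open>r Y\<close> lies in \<open>[-1/2, 1/2]\<close>.\<close>
  define r where "r = 1 / (2 * (norm Y + 1))"
  have p: "0 < norm Y + 1" by (simp add: add_nonneg_pos)
  then have r: "0 < r" by (simp add: r_def)
  define A where "A = r *\<^sub>R Y + (1/2) *\<^sub>R id_blinfun"
  have half: "\<bar>r * inner (Y x) x\<bar> \<le> inner x x / 2" for x
  proof -
    have "\<bar>inner (Y x) x\<bar> \<le> (norm Y + 1) * inner x x"
      using abs_inner_le_norm [OF Y(2), of x] inner_ge_zero [of x] by (simp add: distrib_right del: inner_ge_zero)
    then have "r * \<bar>inner (Y x) x\<bar> \<le> r * ((norm Y + 1) * inner x x)"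
      using r by (intro mult_left_mono) auto
    also have "\<dots> = (r * (norm Y + 1)) * inner x x" by simp
    also have "r * (norm Y + 1) = 1 / 2" using p by (simp add: r_def divide_eq_eq)
    finally have "r * \<bar>inner (Y x) x\<bar> \<le> inner x x / 2" by simp
    then show ?thesis using r by (simp add: abs_mult)
  qed
  have "A \<in> effects M"
    unfolding effects_def nonneg_op_def mem_Collect_eq
  proof (intro conjI allI)
    show "A \<in> M" unfolding A_def by (intro closed Y)
    show sa: "selfadj A" unfolding A_def by (intro selfadj_add selfadj_scaleR selfadj_id Y)
    show "selfadj (id_blinfun - A)" by (intro selfadj_diff selfadj_id sa)
    fix x
    show "0 \<le> inner (A x) x" "0 \<le> inner ((id_blinfun - A) x) x"
      using half [of x] by (simp_all add: A_def blinfun.add_left blinfun.scaleR_left blinfun.diff_left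
          inner_add_left inner_diff_left abs_le_iff)
  qed
  then have "Re (\<tau> (Y o\<^sub>L A)) \<le> 0" by (rule le)
  moreover have "\<tau> (Y o\<^sub>L A) = r * \<tau> (Y o\<^sub>L Y)"
    unfolding A_def trace_lincomb_right [OF Y(1) id_closed Y(1)] by (simp add: compose_id_right trY)
  ultimately have "Re (\<tau> (Y o\<^sub>L Y)) \<le> 0" using r by (simp add: mult_le_0_iff)
  moreover have cY: "cadjoint Y = Y" using Y cadjoint_eq_self_iff bounded by blast
  moreover have "\<tau> (Y o\<^sub>L Y) \<in> \<real>\<^sub>\<ge>\<^sub>0" using trace_positive [OF Y(1)] by (simp add: cY)
  ultimately have "\<tau> (cadjoint Y o\<^sub>L Y) = 0" by (simp add: complex_nonneg_Reals_iff complex_eq_iff)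
  then have "Y = 0" by (rule trace_faithful [OF Y(1)])
  then show ?thesis by (simp add: Y_def)
qed

section \<open>Numerical ranges\<close>

lemma majorized_set_closed: "X \<in> majorized_set C \<Longrightarrow> X \<in> M" "X \<in> majorized_set C \<Longrightarrow> selfadj X"
  by (auto simp: majorized_set_def selfadjoints_iff)

lemma convex_C_numerical_range:
  assumes C: "C \<in> selfadjoints M" and T: "T \<in> M"
  shows "convex (C_numerical_range M \<tau> C T)"
  unfolding convex_def C_numerical_range_image
proof (intro ballI allI impI)
  fix z w and u v :: real
  assume z: "z \<in> (\<lambda>X. \<tau> (T o\<^sub>L X)) ` majorized_set C" and w: "w \<in> (\<lambda>X. \<tau> (T o\<^sub>L X)) ` majorized_set C"
    and uv: "0 \<le> u" "0 \<le> v" "u + v = 1"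
  then obtain X Y where XY: "X \<in> majorized_set C" "Y \<in> majorized_set C"
    and eq: "z = \<tau> (T o\<^sub>L X)" "w = \<tau> (T o\<^sub>L Y)" by blast
  have "u *\<^sub>R z + v *\<^sub>R w = \<tau> (T o\<^sub>L (u *\<^sub>R X + v *\<^sub>R Y))"
    unfolding trace_lincomb_right [OF majorized_set_closed(1) [OF XY(1)] majorized_set_closed(1) [OF XY(2)] T] eq
    by (simp add: scaleR_conv_of_real)
  then show "u *\<^sub>R z + v *\<^sub>R w \<in> (\<lambda>X. \<tau> (T o\<^sub>L X)) ` majorized_set C"
    using majorized_set_convex [OF C XY uv] by blast
qed

lemma trace_cadjoint_compose:
  assumes T: "T \<in> M" and X: "X \<in> M" "selfadj X"
  shows "\<tau> (cadjoint T o\<^sub>L X) = cnj (\<tau> (T o\<^sub>L X))"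
proof -
  have TX: "cinner (T x) y = cinner x (cadjoint T y)" for x y
    by (rule cinner_cadjoint [OF bounded [OF T]])
  have "cadjoint (X o\<^sub>L T) = cadjoint T o\<^sub>L X"
  proof (rule cadjoint_eqI)
    fix x y
    have "cinner (X (T x)) y = cinner (T x) (X y)"
      using bounded [OF X(1)] selfadjD [OF X(2)] by (rule cinner_eq_if_inner_eq)
    then show "cinner ((X o\<^sub>L T) x) y = cinner x ((cadjoint T o\<^sub>L X) y)" by (simp add: TX)
  qed
  then have "\<tau> (cadjoint T o\<^sub>L X) = cnj (\<tau> (X o\<^sub>L T))"
    using trace_cadjoint [of "X o\<^sub>L T"] T X by (simp add: closed)
  then show ?thesis using trace_tracial [OF X(1) T] by simp
qed

lemma trace_scaleC_compose: "T \<in> M \<Longrightarrow> X \<in> M \<Longrightarrow> \<tau> ((c *\<^sub>C T) o\<^sub>L X) = c * \<tau> (T o\<^sub>L X)"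
proof -
  assume "T \<in> M" "X \<in> M"
  moreover have "(c *\<^sub>C T) o\<^sub>L X = c *\<^sub>C (T o\<^sub>L X)" by (simp add: blinfun_eq_iff scaleC_apply)
  ultimately show ?thesis by (simp add: trace_scaleC closed)
qed

lemma trace_add_compose:
  assumes "S \<in> M" "T \<in> M" "X \<in> M"
  shows "\<tau> ((S + T) o\<^sub>L X) = \<tau> (S o\<^sub>L X) + \<tau> (T o\<^sub>L X)"
    "\<tau> ((S - T) o\<^sub>L X) = \<tau> (S o\<^sub>L X) - \<tau> (T o\<^sub>L X)"
  using trace_lincomb_left [OF assms, of 1 1] trace_lincomb_left [OF assms, of 1 "-1"] by simp_all

lemma C_numerical_range_cadjoint:
  assumes T: "T \<in> M"
  shows "C_numerical_range M \<tau> C (cadjoint T) = cnj ` C_numerical_range M \<tau> C T"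
  unfolding C_numerical_range_image image_image
  by (intro image_cong refl trace_cadjoint_compose T majorized_set_closed)

lemma C_numerical_range_Re_op:
  assumes T: "T \<in> M"
  shows "C_numerical_range M \<tau> C (Re_op T) = (\<lambda>z. complex_of_real (Re z)) ` C_numerical_range M \<tau> C T"
  unfolding C_numerical_range_image image_image
proof (intro image_cong refl)
  fix X assume "X \<in> majorized_set C"
  note X = majorized_set_closed [OF this]
  have "\<tau> (Re_op T o\<^sub>L X) = (1/2) * (\<tau> (T o\<^sub>L X) + cnj (\<tau> (T o\<^sub>L X)))"
    unfolding Re_op_def using T X cadjoint_closed [OF T]
    by (simp add: trace_scaleC_compose trace_add_compose trace_cadjoint_compose closed)
  then show "\<tau> (Re_op T o\<^sub>L X) = complex_of_real (Re (\<tau> (T o\<^sub>L X)))"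
    by (simp add: complex_add_cnj)
qed

lemma C_numerical_range_Im_op:
  assumes T: "T \<in> M"
  shows "C_numerical_range M \<tau> C (Im_op T) = (\<lambda>z. complex_of_real (Im z)) ` C_numerical_range M \<tau> C T"
  unfolding C_numerical_range_image image_image
proof (intro image_cong refl)
  fix X assume "X \<in> majorized_set C"
  note X = majorized_set_closed [OF this]
  have "\<tau> (Im_op T o\<^sub>L X) = (1/(2 * \<i>)) * (\<tau> (T o\<^sub>L X) - cnj (\<tau> (T o\<^sub>L X)))"
    unfolding Im_op_def using T X cadjoint_closed [OF T]
    by (simp add: trace_scaleC_compose trace_add_compose trace_cadjoint_compose closed)
  then show "\<tau> (Im_op T o\<^sub>L X) = complex_of_real (Im (\<tau> (T o\<^sub>L X)))"
    by (simp add: complex_diff_cnj complex_eq_iff)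
qed

lemma C_numerical_range_add:
  assumes "T \<in> M" "S \<in> M"
  shows "C_numerical_range M \<tau> C (T + S) \<subseteq> C_numerical_range M \<tau> C T + C_numerical_range M \<tau> C S"
  unfolding C_numerical_range_image
proof
  fix z assume "z \<in> (\<lambda>X. \<tau> ((T + S) o\<^sub>L X)) ` majorized_set C"
  then obtain X where X: "X \<in> majorized_set C" "z = \<tau> ((T + S) o\<^sub>L X)" by blast
  then have "z = \<tau> (T o\<^sub>L X) + \<tau> (S o\<^sub>L X)"
    using assms majorized_set_closed(1) [OF X(1)] by (simp add: trace_add_compose)
  then show "z \<in> (\<lambda>X. \<tau> (T o\<^sub>L X)) ` majorized_set C + (\<lambda>X. \<tau> (S o\<^sub>L X)) ` majorized_set C"
    using X(1) by (auto intro: set_plus_intro)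
qed

lemma plus_times_image: "a +o (b *o (f ` A)) = (\<lambda>x. a + b * f x) ` A"
  by (auto simp: elt_set_plus_def elt_set_times_def)

lemma C_numerical_range_affine_operator:
  assumes T: "T \<in> M" and C: "C \<in> selfadjoints M"
  shows "C_numerical_range M \<tau> C (z *\<^sub>C id_blinfun + w *\<^sub>C T) =
      (z * \<tau> C) +o (w *o C_numerical_range M \<tau> C T)"
  unfolding C_numerical_range_image plus_times_image
proof (intro image_cong refl)
  fix X assume X: "X \<in> majorized_set C"
  then have "\<tau> X = \<tau> C" "X \<in> M" by (auto simp: majorized_set_iff [OF C] selfadjoints_iff)
  then show "\<tau> ((z *\<^sub>C id_blinfun + w *\<^sub>C T) o\<^sub>L X) = z * \<tau> C + w * \<tau> (T o\<^sub>L X)"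
    using T by (simp add: trace_add_compose trace_scaleC_compose closed compose_id_left)
qed

lemma C_numerical_range_unitary_subset:
  assumes T: "T \<in> M" and C: "C \<in> selfadjoints M" and U: "U \<in> unitaries M"
  shows "C_numerical_range M \<tau> C (cadjoint U o\<^sub>L T o\<^sub>L U) \<subseteq> C_numerical_range M \<tau> C T"
  unfolding C_numerical_range_image
proof (rule image_subsetI)
  fix X assume X: "X \<in> majorized_set C"
  note u = unitaryD(1,2) [OF U] and XM = majorized_set_closed(1) [OF X]
  have "\<tau> (cadjoint U o\<^sub>L (T o\<^sub>L (U o\<^sub>L X))) = \<tau> ((T o\<^sub>L (U o\<^sub>L X)) o\<^sub>L cadjoint U)"
    using u XM T by (intro trace_tracial closed)
  then have "\<tau> (cadjoint U o\<^sub>L T o\<^sub>L U o\<^sub>L X) = \<tau> (T o\<^sub>L (U o\<^sub>L (X o\<^sub>L cadjoint U)))"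
    by (simp add: compose_assoc)
  then show "\<tau> (cadjoint U o\<^sub>L T o\<^sub>L U o\<^sub>L X) \<in> (\<lambda>X. \<tau> (T o\<^sub>L X)) ` majorized_set C"
    using majorized_set_unitary_conj [OF U C X] by blast
qed

lemma C_numerical_range_unitary:
  assumes T: "T \<in> M" and C: "C \<in> selfadjoints M" and U: "U \<in> unitaries M"
  shows "C_numerical_range M \<tau> C (cadjoint U o\<^sub>L T o\<^sub>L U) = C_numerical_range M \<tau> C T"
proof
  note u = unitaryD [OF U]
  let ?T = "cadjoint U o\<^sub>L T o\<^sub>L U"
  have "U o\<^sub>L (cadjoint U o\<^sub>L A) = A" for A :: "'h \<Rightarrow>\<^sub>L 'h"
    by (simp add: u(4) compose_id_left flip: compose_assoc)
  then have "cadjoint (cadjoint U) o\<^sub>L ?T o\<^sub>L cadjoint U = T"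
    by (simp add: u(4,6) compose_assoc compose_id_right)
  moreover have "?T \<in> M" using u(1,2) T by (intro closed)
  ultimately show "C_numerical_range M \<tau> C T \<subseteq> C_numerical_range M \<tau> C ?T"
    using C_numerical_range_unitary_subset [OF _ C u(7), of ?T] by simp
qed (rule C_numerical_range_unitary_subset [OF assms])

lemma C_numerical_range_mono:
  assumes "eigenvalue_function \<tau> C1 majorized_by eigenvalue_function \<tau> C2"
  shows "C_numerical_range M \<tau> C1 T \<subseteq> C_numerical_range M \<tau> C2 T"
  using assms unfolding C_numerical_range_def majorized_by_def by fastforce

text \<open>
The set of elements majorized by $aC + b$ is the image of the set for \<open>C\<close> under the same affine map. For
$a \neq 0$ the inverse map gives the other inclusion; for $a = 0$ this is
\<open>majorized_set_scalar\<close>.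
\<close>

lemma C_numerical_range_affine_weight:
  assumes T: "T \<in> M" and C: "C \<in> selfadjoints M"
  shows "C_numerical_range M \<tau> (a *\<^sub>R C + b *\<^sub>R id_blinfun) T =
      (complex_of_real b * \<tau> T) +o (complex_of_real a *o C_numerical_range M \<tau> C T)"
proof -
  let ?f = "\<lambda>X. a *\<^sub>R X + b *\<^sub>R id_blinfun"
  have "majorized_set (?f C) = ?f ` majorized_set C"
  proof
    show "?f ` majorized_set C \<subseteq> majorized_set (?f C)"
      using majorized_set_affine [OF C] by blast
    show "majorized_set (?f C) \<subseteq> ?f ` majorized_set C"
    proof
      fix Y assume Y: "Y \<in> majorized_set (?f C)"
      show "Y \<in> ?f ` majorized_set C"
      proof (cases "a = 0")
        case True
        then have "Y = ?f C" using majorized_set_scalar [of Y b] Y by simp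
        then show ?thesis using majorized_set_self [OF C] by blast
      next
        case False
        have "?f C \<in> selfadjoints M" by (intro selfadjoints_closed C)
        then have "(1/a) *\<^sub>R Y + (- b/a) *\<^sub>R id_blinfun
            \<in> majorized_set ((1/a) *\<^sub>R ?f C + (- b/a) *\<^sub>R id_blinfun)"
          using Y by (rule majorized_set_affine)
        moreover have "(1/a) *\<^sub>R ?f C + (- b/a) *\<^sub>R id_blinfun = C"
          using False by (simp add: scaleR_add_right)
        moreover have "Y = ?f ((1/a) *\<^sub>R Y + (- b/a) *\<^sub>R id_blinfun)"
          using False by (simp add: scaleR_add_right scaleR_diff_right)
        ultimately show ?thesis by (metis imageI)
      qed
    qed
  qed
  moreover have "\<tau> (T o\<^sub>L ?f X) = b * \<tau> T + a * \<tau> (T o\<^sub>L X)" if "X \<in> majorized_set C" for X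
    using trace_lincomb_right [OF majorized_set_closed(1) [OF that] id_closed T, of a b]
    by (simp add: compose_id_right)
  ultimately show ?thesis
    unfolding C_numerical_range_image plus_times_image by (auto simp: image_image)
qed

end

theorem proposition2p7:
  fixes M :: "('h::complex_hilbert_space \<Rightarrow>\<^sub>L 'h) set"
    and \<tau> :: "('h \<Rightarrow>\<^sub>L 'h) \<Rightarrow> complex"
    and T S C C1 C2 :: "'h \<Rightarrow>\<^sub>L 'h"
  assumes "tracial_von_neumann_algebra M \<tau>"
    and "T \<in> M" and "S \<in> M"
    and "C \<in> selfadjoints M" and "C1 \<in> selfadjoints M" and "C2 \<in> selfadjoints M"
  shows
    "convex (C_numerical_range M \<tau> C T) \<and>
     C_numerical_range M \<tau> C (cadjoint T) = cnj ` C_numerical_range M \<tau> C T \<and>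
     C_numerical_range M \<tau> C (Re_op T) = (\<lambda>z. complex_of_real (Re z)) ` C_numerical_range M \<tau> C T \<and>
     C_numerical_range M \<tau> C (Im_op T) = (\<lambda>z. complex_of_real (Im z)) ` C_numerical_range M \<tau> C T \<and>
     C_numerical_range M \<tau> C (T + S) \<subseteq> C_numerical_range M \<tau> C T + C_numerical_range M \<tau> C S \<and>
     (\<forall>z w :: complex. C_numerical_range M \<tau> C (z *\<^sub>C id_blinfun + w *\<^sub>C T) =
        (z * \<tau> C) +o (w *o C_numerical_range M \<tau> C T)) \<and>
     (\<forall>U \<in> unitaries M. C_numerical_range M \<tau> C (cadjoint U o\<^sub>L T o\<^sub>L U) = C_numerical_range M \<tau> C T) \<and>
     (eigenvalue_function \<tau> C1 majorized_by eigenvalue_function \<tau> C2 \<longrightarrow>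
        C_numerical_range M \<tau> C1 T \<subseteq> C_numerical_range M \<tau> C2 T) \<and>
     (\<forall>a b :: real. C_numerical_range M \<tau> (a *\<^sub>R C + b *\<^sub>R id_blinfun) T =
        (complex_of_real b * \<tau> T) +o (complex_of_real a *o C_numerical_range M \<tau> C T))"
proof -
  interpret tracial_von_neumann_algebra M \<tau> by fact
  show ?thesis
    using assms(2-) by (intro conjI allI ballI impI convex_C_numerical_range C_numerical_range_cadjoint
        C_numerical_range_Re_op C_numerical_range_Im_op C_numerical_range_add
        C_numerical_range_affine_operator C_numerical_range_unitary C_numerical_range_mono
        C_numerical_range_affine_weight)
qed

end
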